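(* For every $\beta\in(0,1]$ there exist constants $C,c_e,c_l>0$ (depending only on $\beta$) such that the following holds for all $n_1,n_2$ with $\min\{n_1,n_2\}\ge\beta n$, where $n=\max\{n_1,n_2\}$. Let $X^*\in\mathcal M(n_1,n_2,r,\mu,\kappa)$. Assume $\Omega\subseteq[n_1]\times[n_2]$ is sampled uniformly at random among subsets of a given cardinality $|\Omega|$, and that $p=|\Omega|/(n_1n_2)$ satisfies $np\ge C\mu r\log n$. Set $\gamma=\frac{c_e}{2\sigma_r^*\sqrt p}$. Then with probability at least $1-3/n^3$, for every initial iterate $$\begin{pmatrix} U_0 \\ V_0 \end{pmatrix}\in\mathcal B_{\rm err}\!\left(\tfrac{\sqrt p}{c_e\sqrt\kappa}\right)\cap\mathcal B_{\rm bln}\!\left(\tfrac1{c_l}\right)\cap\mathcal B_\mu,$$ the estimates $X_t=U_tV_t^\top$ of constrained GNMR (defined in the context) satisfy, for all $t\ge0$, $$\|X_{t+1}-X^*\|_F\le\gamma\|X_t-X^*\|_F^2,\qquad\text{where }\ \gamma\|X_t-X^*\|_F\le\frac{1}{2\sqrt\kappa}\le\frac12.$$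
   Context: Norms: $\|\cdot\|_F$ Frobenius, $\|A\|_{2,\infty}$ the largest Euclidean norm of a row of $A$, $\|A\|_{F(\Omega)}^2=\sum_{(i,j)\in\Omega}A_{ij}^2$. $\mathcal P_\Omega(X)\in\mathbb R^{|\Omega|}$ is the vector of entries $X_{ij}$, $(i,j)\in\Omega$. $\sigma_i^*=\sigma_i(X^* )$ is the $i$-th largest singular value of $X^*$. A rank-$r$ matrix $X\in\mathbb R^{n_1\times n_2}$ with SVD $X=U\Sigma V^\top$ ($U\in\mathbb R^{n_1\times r}$, $V\in\mathbb R^{n_2\times r}$) is $\mu$-incoherent if $\|U\|_{2,\infty}\le\sqrt{\mu r/n_1}$ and $\|V\|_{2,\infty}\le\sqrt{\mu r/n_2}$. $\mathcal M(n_1,n_2,r,\mu,\kappa)$ is the set of $\mu$-incoherent $n_1\times n_2$ matrices of rank $r$ with condition number $\sigma_1/\sigma_r=\kappa$. The following are sets of stacked factor matrices $\begin{pmatrix} U \\ V \end{pmatrix}\in\mathbb R^{(n_1+n_2)\times r}$ with $U\in\mathbb R^{n_1\times r}$, $V\in\mathbb R^{n_2\times r}$: $\mathcal B_{\rm err}(\epsilon)$: $\|UV^\top-X^*\|_F\le\epsilon\sigma_r^*$; $\mathcal B_{\rm bln}(\delta)$: $\|U^\top U-V^\top V\|_F\le\delta\sigma_r^*$; $\mathcal B_\mu$: $\|U\|_{2,\infty}\le\sqrt{3\mu r\sigma_1^*/n_1}$ and $\|V\|_{2,\infty}\le\sqrt{3\mu r\sigma_1^*/n_2}$. Constrained GNMR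 (setting variant) with $b=\mathcal P_\Omega(X^* )$: given $(U_t,V_t)$ and $X_t=U_tV_t^\top$, $(U_{t+1},V_{t+1})$ is any minimizer of $\|\mathcal P_\Omega(U_tV^\top+UV_t^\top-U_tV_t^\top)-b\|^2$ over $\begin{pmatrix} U \\ V \end{pmatrix}\in\mathcal B_\mu\cap\mathcal C^{(t)}$, where $\mathcal C^{(t)}$ is the set of $\begin{pmatrix} U \\ V \end{pmatrix}$ with $\|U-U_t\|_F^2+\|V-V_t\|_F^2\le\frac{8}{p\sigma_r^*}\|X_t-X^*\|_{F(\Omega)}^2$. *)

theory Defs
  imports
    "HOL-Analysis.L2_Norm"
    "HOL-Probability.Probability_Mass_Function"
    "Jordan_Normal_Form.DL_Rank"
    "Jordan_Normal_Form.Char_Poly"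
begin

text \<open>Matrices are those of Jordan_Normal_Form, so that the dimensions are ordinary natural
  numbers and can be quantified after the constants. Rows and columns are numbered from 0: an entry
  set is a subset of \<open>{..<n1} \<times> {..<n2}\<close>. A stacked matrix with blocks \<open>U\<close> and \<open>V\<close> is
  represented by the pair \<open>(U, V)\<close>.\<close>

type_synonym entries = "(nat \<times> nat) set"
type_synonym factors = "real mat \<times> real mat"

definition frob_on :: "entries \<Rightarrow> real mat \<Rightarrow> real" where
  "frob_on \<Omega> A = L2_set (\<lambda>k. A $$ k) \<Omega>"

definition frob :: "real mat \<Rightarrow> real" where
  "frob A = frob_on ({..<dim_row A} \<times> {..<dim_col A}) A"

text \<open>Only meaningful for matrices with at least one row.\<close>
definition norm_2_inf :: "real mat \<Rightarrow> real" where
  "norm_2_inf A = Max ((\<lambda>i. L2_set (\<lambda>j. A $$ (i, j)) {..<dim_col A}) ` {..<dim_row A})"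

text \<open>A vector of \<open>\<real>\<^sup>\<Omega>\<close> is a function on \<open>\<Omega>\<close> extended by \<open>undefined\<close>; its Euclidean norm is
  \<open>L2_set v \<Omega>\<close>.\<close>
definition sample :: "entries \<Rightarrow> real mat \<Rightarrow> nat \<times> nat \<Rightarrow> real" where
  "sample \<Omega> X = restrict (\<lambda>k. X $$ k) \<Omega>"

text \<open>The square roots of the eigenvalues of \<open>X\<^sup>T X\<close>, with multiplicity, in decreasing order. The
  list has as many entries as \<open>X\<close> has columns; the excess over the smaller dimension is zeros.\<close>
definition singular_values :: "real mat \<Rightarrow> real list" where
  "singular_values X =
     rev (sorted_list_of_multiset (image_mset sqrt (proots (char_poly (transpose_mat X * X)))))"

text \<open>\<open>sing_val X i\<close> is the \<open>i\<close>-th largest singular value, counted from 1.\<close>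
definition sing_val :: "real mat \<Rightarrow> nat \<Rightarrow> real" where
  "sing_val X i = singular_values X ! (i - 1)"

definition is_compact_svd ::
    "nat \<Rightarrow> real mat \<Rightarrow> real mat \<Rightarrow> real mat \<Rightarrow> real mat \<Rightarrow> bool" where
  "is_compact_svd r X U S V \<longleftrightarrow>
     U \<in> carrier_mat (dim_row X) r \<and> S \<in> carrier_mat r r \<and> V \<in> carrier_mat (dim_col X) r \<and>
     transpose_mat U * U = 1\<^sub>m r \<and> transpose_mat V * V = 1\<^sub>m r \<and>
     diagonal_mat S \<and> (\<forall>i<r. S $$ (i, i) = sing_val X (Suc i)) \<and>
     X = U * S * transpose_mat V"

text \<open>The row norms of \<open>U\<close> and \<open>V\<close> do not depend on the choice of the compact SVD, as they are
  the square roots of the diagonal entries of the projections onto the column and row space.\<close>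
definition incoherent :: "nat \<Rightarrow> real \<Rightarrow> real mat \<Rightarrow> bool" where
  "incoherent r \<mu> X \<longleftrightarrow> (\<exists>U S V. is_compact_svd r X U S V \<and>
     norm_2_inf U \<le> sqrt (\<mu> * real r / real (dim_row X)) \<and>
     norm_2_inf V \<le> sqrt (\<mu> * real r / real (dim_col X)))"

definition incoherent_mats :: "nat \<Rightarrow> nat \<Rightarrow> nat \<Rightarrow> real \<Rightarrow> real \<Rightarrow> real mat set" where
  "incoherent_mats n1 n2 r \<mu> \<kappa> =
     {X \<in> carrier_mat n1 n2. vec_space.rank n1 X = r \<and> incoherent r \<mu> X \<and>
        sing_val X 1 / sing_val X r = \<kappa>}"

definition factor_space :: "nat \<Rightarrow> nat \<Rightarrow> nat \<Rightarrow> factors set" where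
  "factor_space n1 n2 r = carrier_mat n1 r \<times> carrier_mat n2 r"

text \<open>Below, \<open>Xs\<close> is the target matrix \<open>X\<^sup>*\<close>, whose dimensions and rank \<open>r\<close> fix the factor space.\<close>

definition B_err :: "nat \<Rightarrow> real mat \<Rightarrow> real \<Rightarrow> factors set" where
  "B_err r Xs \<epsilon> = {(U, V) \<in> factor_space (dim_row Xs) (dim_col Xs) r.
     frob (U * transpose_mat V - Xs) \<le> \<epsilon> * sing_val Xs r}"

definition B_bln :: "nat \<Rightarrow> real mat \<Rightarrow> real \<Rightarrow> factors set" where
  "B_bln r Xs \<delta> = {(U, V) \<in> factor_space (dim_row Xs) (dim_col Xs) r.
     frob (transpose_mat U * U - transpose_mat V * V) \<le> \<delta> * sing_val Xs r}"

definition B_mu :: "nat \<Rightarrow> real mat \<Rightarrow> real \<Rightarrow> factors set" where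
  "B_mu r Xs \<mu> = {(U, V) \<in> factor_space (dim_row Xs) (dim_col Xs) r.
     norm_2_inf U \<le> sqrt (3 * \<mu> * real r * sing_val Xs 1 / real (dim_row Xs)) \<and>
     norm_2_inf V \<le> sqrt (3 * \<mu> * real r * sing_val Xs 1 / real (dim_col Xs))}"

definition sampling_rate :: "real mat \<Rightarrow> entries \<Rightarrow> real" where
  "sampling_rate Xs \<Omega> = real (card \<Omega>) / (real (dim_row Xs) * real (dim_col Xs))"

definition C_step :: "nat \<Rightarrow> real mat \<Rightarrow> entries \<Rightarrow> factors \<Rightarrow> factors set" where
  "C_step r Xs \<Omega> = (\<lambda>(Ut, Vt). {(U, V) \<in> factor_space (dim_row Xs) (dim_col Xs) r.
     (frob (U - Ut))\<^sup>2 + (frob (V - Vt))\<^sup>2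
       \<le> 8 / (sampling_rate Xs \<Omega> * sing_val Xs r) * (frob_on \<Omega> (Ut * transpose_mat Vt - Xs))\<^sup>2})"

definition gnmr_objective :: "entries \<Rightarrow> (nat \<times> nat \<Rightarrow> real) \<Rightarrow> factors \<Rightarrow> factors \<Rightarrow> real" where
  "gnmr_objective \<Omega> b = (\<lambda>(Ut, Vt) (U, V).
     (L2_set (\<lambda>k. sample \<Omega> (Ut * transpose_mat V + U * transpose_mat Vt - Ut * transpose_mat Vt) k
                  - b k) \<Omega>)\<^sup>2)"

text \<open>The minimizer need not be unique, so the algorithm is a relation: a run is any sequence of
  factors in which every element is some minimizer of the problem set up by its predecessor.\<close>
definition gnmr_run ::
    "nat \<Rightarrow> real mat \<Rightarrow> real \<Rightarrow> entries \<Rightarrow> (nat \<Rightarrow> factors) \<Rightarrow> bool" where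
  "gnmr_run r Xs \<mu> \<Omega> Z \<longleftrightarrow>
     (\<forall>t. is_arg_min (gnmr_objective \<Omega> (sample \<Omega> Xs) (Z t))
            (\<lambda>W. W \<in> B_mu r Xs \<mu> \<inter> C_step r Xs \<Omega> (Z t)) (Z (Suc t)))"

definition estimate :: "factors \<Rightarrow> real mat" where
  "estimate = (\<lambda>(U, V). U * transpose_mat V)"

definition uniform_sample :: "nat \<Rightarrow> nat \<Rightarrow> nat \<Rightarrow> entries pmf" where
  "uniform_sample n1 n2 m = pmf_of_set {\<Omega>. \<Omega> \<subseteq> {..<n1} \<times> {..<n2} \<and> card \<Omega> = m}"

end

theory Submission
  imports Defs
begin

text \<open>
  Randomness enters only through a restricted isometry of \<open>\<Omega>\<close> on the tangent space
  \<open>{Us A + B Vs\<^sup>T}\<close> at \<open>Xs\<close>. Since this space does not depend on the iterates, one event of high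
  probability covers all runs. It is proved by the moment method for \<open>Z = \<Sum>\<^sub>k (\<xi>\<^sub>k - p) P\<^sub>k P\<^sub>k\<^sup>T\<close>, where
  \<open>P\<^sub>k\<close> is the projection of the \<open>k\<close>-th matrix unit to the tangent space and the \<open>\<xi>\<^sub>k\<close> are independent
  Bernoulli variables: resampling one \<open>\<xi>\<^sub>k\<close> bounds \<open>E tr Z\<^bsup>2s+2\<^esup>\<close> by a multiple of
  \<open>E tr Z\<^bsup>2s\<^esup>\<close>, and only the log-convexity of scalar moments is used. Subsets of the fixed
  size \<open>m\<close> are reached by conditioning on the mode of the binomial distribution.

  Given the isometry, let \<open>e\<close> be the error of \<open>(U, V)\<close>. There is an exact factorization \<open>(Ub, Vb)\<close> of \<open>Xs\<close>
  at squared distance \<open>O(e\<^sup>2 / \<sigma>\<^sub>r)\<close> from \<open>(U, V)\<close>. The linearization evaluated there is off by the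
  bilinear term \<open>(Ub - U)(Vb - V)\<^sup>T\<close> only, which is quadratic in \<open>e\<close>, so the minimizer does at least as well on
  \<open>\<Omega>\<close>. The difference between \<open>U V\<^sup>T - Xs\<close> and a tangent vector is bilinear too. Because \<open>e\<close> is of
  order \<open>\<surd>p\<close>, bounding its restriction to \<open>\<Omega>\<close> by the full Frobenius norm is harmless. The
  imbalance changes by \<open>O(\<surd>\<kappa> e)\<close> per step, which is summable.
\<close>

section \<open>Moments of a random frame operator\<close>

text \<open>With the other coordinates fixed, the mean of xi_k - p times a function f of the sample
  is p (1 - p) times the jump of f at k. For f = <P_k, Z^(2s+1) P_k> the jump is a sum of 2s + 1
  products of moments, and convexity bounds it by the two end terms, which carry the factor P_kk <=
  L. If K L <= p, the mean of tr Z^(2K) is at most N (5 p K L)^K, so a deviation of p/4 has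
  probability at most N q^K with q = 80 K L / p. The fixed size costs a factor N + 1, in total at
  most 2 n^4; K >= ln n and q <= exp (-7) leave 2 / n^3.

  The minimizer ranges over \<open>B_mu\<close>, so the reference factorization must lie there too.
  Hence its form (Us R, Vs R') with R, R' of norm at most sqrt (3 s1): its rows inherit the
  incoherence of Us and Vs, and its linear terms are tangent at Xs, where the isometry holds. The
  initial error of order sr sqrt p / sqrt kappa pays for two things: e^2 / sr is small against sqrt
  p e, and the increments sqrt kappa e of the imbalance sum to a fraction of sr.\<close>

lemma convex_chord:
  fixes b :: "nat \<Rightarrow> real"
  assumes "\<And>a. 0 < a \<Longrightarrow> a \<le> n \<Longrightarrow> 2 * b a \<le> b (a - 1) + b (a + 1)"
  shows "real (n + 1) * b n \<le> b 0 + real n * b (n + 1)"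
  using assms
proof (induction n)
  case (Suc n)
  have 1: "real (n + 1) * b n \<le> b 0 + real n * b (n + 1)" using Suc by auto
  have "2 * b (n + 1) \<le> b n + b (n + 2)" using Suc.prems[of "n + 1"] by simp
  from mult_left_mono[OF this, of "real (n + 1)"]
  have "real (n + 1) * (2 * b (n + 1)) \<le> real (n + 1) * b n + real (n + 1) * b (n + 2)"
    by (simp add: algebra_simps)
  with 1 show ?case by (simp add: algebra_simps)
qed simp

text \<open>Discrete trapezoid rule: a convex sequence lies below its chord, whose average is the
  mean of the two end values.\<close>

lemma convex_sum_le:
  fixes b :: "nat \<Rightarrow> real"
  assumes "\<And>a. 0 < a \<Longrightarrow> a < n \<Longrightarrow> 2 * b a \<le> b (a - 1) + b (a + 1)"
  shows "(\<Sum>a\<le>n. b a) \<le> real (n + 1) / 2 * (b 0 + b n)"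
  using assms
proof (induction n)
  case (Suc n)
  have 1: "(\<Sum>a\<le>n. b a) \<le> real (n + 1) / 2 * (b 0 + b n)" using Suc by auto
  have 2: "real (n + 1) * b n \<le> b 0 + real n * b (n + 1)"
    by (rule convex_chord) (use Suc.prems in auto)
  from 1 2 show ?case by (simp add: field_simps)
qed simp

lemma sum_odd_even:
  fixes a :: "nat \<Rightarrow> real"
  shows "(\<Sum>q\<le>2 * s. a q) = (\<Sum>q\<le>s. a (2 * q)) + (\<Sum>q<s. a (2 * q + 1))"
  by (induction s) (auto simp: algebra_simps)

text \<open>By AM-GM the even-indexed terms form a convex sequence and each odd one is at most the
  mean of its even neighbours. Nonnegativity is asked of even indices only, because odd moments of a
  symmetric operator can be negative.\<close>

lemma log_convex_sum_le:
  fixes a :: "nat \<Rightarrow> real"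
  assumes pos: "\<And>q. a (2 * q) \<ge> 0"
    and ev: "\<And>q. 0 < q \<Longrightarrow> q < s \<Longrightarrow> (a (2 * q))\<^sup>2 \<le> a (2 * q - 2) * a (2 * q + 2)"
    and od: "\<And>q. q < s \<Longrightarrow> (a (2 * q + 1))\<^sup>2 \<le> a (2 * q) * a (2 * q + 2)"
  shows "(\<Sum>q\<le>2 * s. a q) \<le> real (2 * s + 1) / 2 * (a 0 + a (2 * s))"
proof -
  have amgm: "2 * z \<le> x + y" if "z\<^sup>2 \<le> x * y" "x \<ge> 0" "y \<ge> 0" for x y z :: real
  proof -
    have "(2 * z)\<^sup>2 \<le> (x + y)\<^sup>2"
      using that(1) sum_squares_ge_zero[of "x - y" 0] by (simp add: power2_eq_square algebra_simps)
    thus ?thesis using that by (meson add_nonneg_nonneg power2_le_imp_le)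
  qed
  have E: "(\<Sum>q\<le>s. a (2 * q)) \<le> real (s + 1) / 2 * (a 0 + a (2 * s))"
  proof -
    have "(\<Sum>q\<le>s. a (2 * q)) \<le> real (s + 1) / 2 * (a (2 * 0) + a (2 * s))"
    proof (rule convex_sum_le)
      fix q assume "0 < q" "q < s"
      then show "2 * a (2 * q) \<le> a (2 * (q - 1)) + a (2 * (q + 1))"
        using amgm[OF ev, of q] pos[of "q - 1"] pos[of "q + 1"] by (simp add: right_diff_distrib')
    qed
    thus ?thesis by simp
  qed
  have O: "(\<Sum>q<s. a (2 * q + 1)) \<le> (\<Sum>q<s. (a (2 * q) + a (2 * (q + 1))) / 2)"
  proof (rule sum_mono)
    fix q assume "q \<in> {..<s}"
    then show "a (2 * q + 1) \<le> (a (2 * q) + a (2 * (q + 1))) / 2"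
      using amgm[OF od, of q] pos[of q] pos[of "q + 1"] by simp
  qed
  have "(\<Sum>q<s. (a (2 * q) + a (2 * (q + 1))) / 2)
      = (\<Sum>q\<le>s. a (2 * q)) - (a 0 + a (2 * s)) / 2"
    by (induction s) (auto simp: algebra_simps add_divide_distrib)
  with E O show ?thesis unfolding sum_odd_even by (simp add: field_simps)
qed

section \<open>Trace moments of a centred random sum of rank-one operators\<close>

text \<open>\<open>P\<close> is the matrix of an orthogonal projection in the coordinates
  \<open>G\<close>, so \<open>P k k\<close> is the squared norm of the projected k-th unit vector
  and \<open>L\<close> bounds the coherence of the projected space.\<close>

locale bernoulli_frame =
  fixes G :: "'k set" and P :: "'k \<Rightarrow> 'k \<Rightarrow> real" and p L :: real
  assumes fin: "finite G"
    and P_sym: "\<And>i j. i \<in> G \<Longrightarrow> j \<in> G \<Longrightarrow> P i j = P j i"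
    and P_idem: "\<And>i k. i \<in> G \<Longrightarrow> k \<in> G \<Longrightarrow> (\<Sum>j\<in>G. P i j * P j k) = P i k"
    and P_diag: "\<And>k. k \<in> G \<Longrightarrow> P k k \<le> L"
    and p01: "0 \<le> p" "p \<le> 1"
begin

definition ip :: "('k \<Rightarrow> real) \<Rightarrow> ('k \<Rightarrow> real) \<Rightarrow> real" where
  "ip u v = (\<Sum>i\<in>G. u i * v i)"

text \<open>On \<open>G\<close> this is the operator P D P, where D is diagonal with entries xi_k -
  p and xi_k indicates that k belongs to \<open>S\<close>.\<close>

definition Z :: "'k set \<Rightarrow> ('k \<Rightarrow> real) \<Rightarrow> 'k \<Rightarrow> real" where
  "Z S v = (\<lambda>i. \<Sum>k\<in>G. (of_bool (k \<in> S) - p) * ip (P k) v * P k i)"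

definition unit :: "'k \<Rightarrow> 'k \<Rightarrow> real" where
  "unit e = (\<lambda>i. of_bool (i = e))"

definition tr :: "nat \<Rightarrow> 'k set \<Rightarrow> real" where
  "tr n S = (\<Sum>e\<in>G. ip (unit e) ((Z S ^^ n) (unit e)))"

definition wt :: "'k set \<Rightarrow> real" where
  "wt S = p ^ card S * (1 - p) ^ (card G - card S)"

lemma ip_commute: "ip u v = ip v u"
  by (simp add: ip_def mult.commute)

lemma ip_nonneg: "ip u u \<ge> 0"
  by (simp add: ip_def sum_nonneg)

lemma ip_add_right: "ip u (\<lambda>i. v i + c * w i) = ip u v + c * ip u w"
  by (simp add: ip_def algebra_simps sum.distrib sum_distrib_left)

lemma ip_add_square:
  "ip (\<lambda>i. v i + c * u i) (\<lambda>i. v i + c * u i) = ip v v + 2 * c * ip u v + c\<^sup>2 * ip u u"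
proof -
  have "ip (\<lambda>i. v i + c * u i) (\<lambda>i. v i + c * u i)
      = (\<Sum>i\<in>G. v i * v i + 2 * c * (u i * v i) + c\<^sup>2 * (u i * u i))"
    unfolding ip_def by (intro sum.cong refl) (simp add: power2_eq_square algebra_simps)
  then show ?thesis by (simp add: ip_def sum.distrib sum_distrib_left)
qed

lemma ip_unit: "e \<in> G \<Longrightarrow> ip v (unit e) = v e"
  using fin by (simp add: ip_def unit_def)

lemma cauchy_schwarz: "(ip u v)\<^sup>2 \<le> ip u u * ip v v"
  using Cauchy_Schwarz_ineq_sum[of u v G] by (simp add: ip_def power2_eq_square)

lemma ip_Z: "ip u (Z S v) = (\<Sum>k\<in>G. (of_bool (k \<in> S) - p) * ip (P k) u * ip (P k) v)"
proof -
  have "ip u (Z S v) = (\<Sum>i\<in>G. \<Sum>k\<in>G. (of_bool (k \<in> S) - p) * ip (P k) v * (P k i * u i))"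
    by (simp add: ip_def Z_def sum_distrib_left algebra_simps)
  also have "\<dots> = (\<Sum>k\<in>G. \<Sum>i\<in>G. (of_bool (k \<in> S) - p) * ip (P k) v * (P k i * u i))"
    by (rule sum.swap)
  also have "\<dots> = (\<Sum>k\<in>G. (of_bool (k \<in> S) - p) * ip (P k) v * ip (P k) u)"
    by (simp add: sum_distrib_left[symmetric]) (simp add: ip_def)
  finally show ?thesis by (simp add: algebra_simps)
qed

lemma Z_sym: "ip u (Z S v) = ip (Z S u) v"
  by (subst (2) ip_commute) (simp add: ip_Z algebra_simps)

lemma Z_pow_sym: "ip u ((Z S ^^ n) v) = ip ((Z S ^^ n) u) v"
proof (induction n arbitrary: u)
  case (Suc n)
  have "ip u ((Z S ^^ Suc n) v) = ip (Z S u) ((Z S ^^ n) v)" by (simp add: Z_sym)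
  also have "\<dots> = ip ((Z S ^^ Suc n) u) v" by (simp only: Suc funpow_Suc_right o_apply)
  finally show ?case .
qed simp

lemma Z_pow_split: "ip u ((Z S ^^ (m + n)) v) = ip ((Z S ^^ m) u) ((Z S ^^ n) v)"
  by (simp add: funpow_add Z_pow_sym)

lemma even_moment: "ip u ((Z S ^^ (2 * n)) u) = ip ((Z S ^^ n) u) ((Z S ^^ n) u)"
  unfolding mult_2 by (rule Z_pow_split)

lemma even_moment_nonneg: "ip u ((Z S ^^ (2 * n)) u) \<ge> 0"
  by (simp add: even_moment ip_nonneg)

lemma moment_log_convex:
  "(ip u ((Z S ^^ (m + n)) u))\<^sup>2 \<le> ip u ((Z S ^^ (2 * m)) u) * ip u ((Z S ^^ (2 * n)) u)"
  by (simp add: even_moment Z_pow_split cauchy_schwarz)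

lemma Z_insert:
  assumes "k \<in> G" "k \<notin> S"
  shows "Z (insert k S) v = (\<lambda>i. Z S v i + ip (P k) v * P k i)"
proof
  fix i
  have "Z (insert k S) v i = (\<Sum>j\<in>G. (of_bool (j \<in> S) - p) * ip (P j) v * P j i
      + of_bool (j = k) * (ip (P j) v * P j i))"
    unfolding Z_def by (rule sum.cong) (use assms in \<open>auto simp: algebra_simps\<close>)
  also have "\<dots> = Z S v i + ip (P k) v * P k i"
    using fin assms by (simp add: sum.distrib Z_def)
  finally show "Z (insert k S) v i = Z S v i + ip (P k) v * P k i" .
qed

text \<open>Adding k to the sample is the rank-one update W = Y + P_k P_k^T, and W^n - Y^n is the
  sum of W^q (W - Y) Y^(n-1-q). Rank one makes every summand split into a product of two
  scalars.\<close>

lemma telescope: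
  assumes k: "k \<in> G" "k \<notin> S"
  shows "ip u ((Z (insert k S) ^^ n) v) - ip u ((Z S ^^ n) v)
       = (\<Sum>q<n. ip u ((Z (insert k S) ^^ q) (P k)) * ip (P k) ((Z S ^^ (n - 1 - q)) v))"
proof (induction n arbitrary: v)
  case (Suc n)
  let ?W = "Z (insert k S)"
  have "ip u ((?W ^^ Suc n) v) = ip ((?W ^^ n) u) (?W v)"
    by (simp only: funpow_Suc_right o_apply Z_pow_sym)
  also have "\<dots> = ip ((?W ^^ n) u) (Z S v) + ip (P k) v * ip ((?W ^^ n) u) (P k)"
    by (simp add: Z_insert[OF k] ip_add_right)
  also have "\<dots> = ip u ((?W ^^ n) (Z S v)) + ip u ((?W ^^ n) (P k)) * ip (P k) v"
    by (simp add: Z_pow_sym)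
  finally have *: "ip u ((?W ^^ Suc n) v) = \<dots>" .
  have "ip u ((?W ^^ Suc n) v) - ip u ((Z S ^^ Suc n) v) =
      ip u ((?W ^^ n) (Z S v)) - ip u ((Z S ^^ n) (Z S v)) + ip u ((?W ^^ n) (P k)) * ip (P k) v"
    unfolding * by (simp add: funpow_swap1)
  also have "\<dots> = (\<Sum>q<n. ip u ((?W ^^ q) (P k)) * ip (P k) ((Z S ^^ (n - 1 - q)) (Z S v)))
      + ip u ((?W ^^ n) (P k)) * ip (P k) v"
    by (simp only: Suc)
  also have "(\<Sum>q<n. ip u ((?W ^^ q) (P k)) * ip (P k) ((Z S ^^ (n - 1 - q)) (Z S v)))
     = (\<Sum>q<n. ip u ((?W ^^ q) (P k)) * ip (P k) ((Z S ^^ (n - q)) v))"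
  proof (rule sum.cong[OF refl])
    fix q assume "q \<in> {..<n}"
    hence "n - q = Suc (n - 1 - q)" by auto
    hence "(Z S ^^ (n - q)) v = (Z S ^^ (n - 1 - q)) (Z S v)"
      by (simp only: funpow_Suc_right o_apply)
    thus "ip u ((?W ^^ q) (P k)) * ip (P k) ((Z S ^^ (n - 1 - q)) (Z S v))
      = ip u ((?W ^^ q) (P k)) * ip (P k) ((Z S ^^ (n - q)) v)" by simp
  qed
  finally show ?case by simp
qed simp

lemma P_self: "k \<in> G \<Longrightarrow> l \<in> G \<Longrightarrow> ip (P k) (P l) = P k l"
  using P_idem[of k l] P_sym[of l] by (simp add: ip_def)

lemma P_diag_01: "k \<in> G \<Longrightarrow> 0 \<le> P k k \<and> P k k \<le> 1"
proof -
  assume k: "k \<in> G"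
  have "(P k k)\<^sup>2 \<le> (\<Sum>j\<in>G. P k j * P k j)"
    unfolding power2_eq_square by (rule member_le_sum) (use k fin in auto)
  also have "\<dots> = P k k" using P_self[OF k k] by (simp add: ip_def)
  finally have "(P k k)\<^sup>2 \<le> P k k" .
  moreover have "0 \<le> P k k" using P_self[OF k k] ip_nonneg[of "P k"] by simp
  ultimately show ?thesis
    by (metis less_le_not_le linorder_le_less_linear mult.right_neutral mult_less_cancel_left_pos
        order_less_le_trans power2_eq_square zero_less_one_class.zero_less_one)
qed

text \<open>For a rank-one update the trace inequality behind the moment bound splits into products of
  scalar moments of \<open>P k\<close> under the two operators, which are log-convex.\<close>
lemma moment_difference_le:
  assumes k: "k \<in> G" "k \<notin> S"
  defines "g \<equiv> \<lambda>n S. ip (P k) ((Z S ^^ n) (P k))"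
  shows "g (2 * s + 1) (insert k S) - g (2 * s + 1) S
       \<le> real (2 * s + 1) / 2 * L * (g (2 * s) (insert k S) + g (2 * s) S)"
proof -
  let ?w = "\<lambda>q. g q (insert k S)" and ?y = "\<lambda>q. g q S"
  let ?a = "\<lambda>q. ?w q * ?y (2 * s - q)"
  have pos: "g (2 * q) T \<ge> 0" for q T
    unfolding g_def by (rule even_moment_nonneg)
  have lc: "(g (m + n) T)\<^sup>2 \<le> g (2 * m) T * g (2 * n) T" for m n T
    unfolding g_def by (rule moment_log_convex)
  have dbl: "2 * s - 2 * q = 2 * (s - q)" for q by simp
  have lcp: "(?w (m + n) * ?y (m' + n'))\<^sup>2 \<le> (?w (2 * m) * ?y (2 * m')) * (?w (2 * n) * ?y (2 * n'))"
    for m n m' n'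
    using mult_mono[OF lc[of m n "insert k S"] lc[of m' n' S]] pos
    by (simp add: power_mult_distrib algebra_simps mult_nonneg_nonneg)
  have g0: "g 0 T = P k k" for T using P_self k by (simp add: g_def)
  have "?w (2 * s + 1) - ?y (2 * s + 1) = (\<Sum>q<2 * s + 1. ?a q)"
    unfolding g_def by (subst telescope[OF k]) simp
  also have "\<dots> = (\<Sum>q\<le>2 * s. ?a q)" by (simp add: lessThan_Suc_atMost)
  also have "\<dots> \<le> real (2 * s + 1) / 2 * (?a 0 + ?a (2 * s))"
  proof (rule log_convex_sum_le)
    fix q show "?a (2 * q) \<ge> 0" unfolding dbl by (intro mult_nonneg_nonneg pos)
  next
    fix q assume q: "0 < q" "q < s"
    have "2 * q = (q - 1) + (q + 1)" "2 * s - 2 * q = (s - q + 1) + (s - q - 1)"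
      "2 * q - 2 = 2 * (q - 1)" "2 * q + 2 = 2 * (q + 1)" "2 * s - 2 * (q - 1) = 2 * (s - q + 1)"
      "2 * s - 2 * (q + 1) = 2 * (s - q - 1)"
      using q by auto
    then show "(?a (2 * q))\<^sup>2 \<le> ?a (2 * q - 2) * ?a (2 * q + 2)" using lcp by metis
  next
    fix q assume q: "q < s"
    have "2 * q + 1 = q + (q + 1)" "2 * s - (2 * q + 1) = (s - q) + (s - q - 1)"
      "2 * q + 2 = 2 * (q + 1)" "2 * s - 2 * q = 2 * (s - q)"
      "2 * s - 2 * (q + 1) = 2 * (s - q - 1)"
      using q by auto
    then show "(?a (2 * q + 1))\<^sup>2 \<le> ?a (2 * q) * ?a (2 * q + 2)" using lcp by metis
  qed
  \<comment> \<open>Each end term contains one moment of order 0, which is \<open>P k k\<close>.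
    This is the only place where the coherence bound \<open>L\<close> enters.\<close>
  also have "?a 0 + ?a (2 * s) = P k k * (?w (2 * s) + ?y (2 * s))"
    by (simp add: g0 algebra_simps)
  also have "real (2 * s + 1) / 2 * (P k k * (?w (2 * s) + ?y (2 * s)))
      \<le> real (2 * s + 1) / 2 * (L * (?w (2 * s) + ?y (2 * s)))"
    by (intro mult_left_mono mult_right_mono P_diag k add_nonneg_nonneg pos) auto
  finally show ?thesis by (simp add: mult.assoc)
qed

lemma tr_Suc: "tr (Suc n) S = (\<Sum>k\<in>G. (of_bool (k \<in> S) - p) * ip (P k) ((Z S ^^ n) (P k)))"
proof -
  have "tr (Suc n) S = (\<Sum>e\<in>G. \<Sum>k\<in>G. (of_bool (k \<in> S) - p) * (P k e * (Z S ^^ n) (P k) e))"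
    unfolding tr_def
  proof (rule sum.cong[OF refl])
    fix e assume e: "e \<in> G"
    have "ip (unit e) ((Z S ^^ Suc n) (unit e))
        = (\<Sum>k\<in>G. (of_bool (k \<in> S) - p) * ip (P k) (unit e) * ip (P k) ((Z S ^^ n) (unit e)))"
      by (simp add: ip_Z)
    also have "\<dots> = (\<Sum>k\<in>G. (of_bool (k \<in> S) - p) * (P k e * (Z S ^^ n) (P k) e))"
      by (simp add: Z_pow_sym ip_unit[OF e] mult.assoc)
    finally show "ip (unit e) ((Z S ^^ Suc n) (unit e)) = \<dots>" .
  qed
  also have "\<dots> = (\<Sum>k\<in>G. \<Sum>e\<in>G. (of_bool (k \<in> S) - p) * (P k e * (Z S ^^ n) (P k) e))"
    by (rule sum.swap)
  finally show ?thesis by (simp add: sum_distrib_left[symmetric]) (simp add: ip_def)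
qed

lemma Z_P: "e \<in> G \<Longrightarrow> Z S (P e) = Z S (unit e)"
  unfolding Z_def by (intro ext sum.cong refl) (simp add: P_self ip_unit)

text \<open>For s > 0 the first factor \<open>Z S\<close> already projects, so \<open>P k\<close>
  may replace the unit vector without changing anything. For s = 0 the comparison is P_kk <=
  1.\<close>

lemma sum_even_moment_le: "(\<Sum>k\<in>G. ip (P k) ((Z S ^^ (2 * s)) (P k))) \<le> tr (2 * s) S"
proof (cases s)
  case 0
  have "ip (unit k) (unit k) = 1" if "k \<in> G" for k
    using ip_unit[OF that] by (simp add: unit_def)
  then have "(\<Sum>k\<in>G. P k k) \<le> (\<Sum>k\<in>G. ip (unit k) (unit k))"
    by (intro sum_mono) (simp add: P_diag_01)
  then show ?thesis using 0 by (simp add: tr_def P_self)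
next
  case (Suc t)
  have "(Z S ^^ s) (P k) = (Z S ^^ s) (unit k)" if "k \<in> G" for k
    unfolding Suc by (simp only: funpow_Suc_right o_apply Z_P[OF that])
  then show ?thesis unfolding tr_def even_moment by (intro sum_mono) simp
qed

lemma tr_even_nonneg: "tr (2 * s) S \<ge> 0"
  unfolding tr_def by (intro sum_nonneg even_moment_nonneg)

text \<open>AM-GM with a free weight \<open>t\<close>, later chosen so that half of the next even
  moment can be absorbed into the left side.\<close>

lemma tr_odd_le:
  assumes t: "t > 0"
  shows "tr (2 * s + 1) S \<le> (t * tr (2 * s) S + tr (2 * s + 2) S / t) / 2"
proof -
  have "tr (2 * s + 1) S \<le> (\<Sum>e\<in>G. (t * ip (unit e) ((Z S ^^ (2 * s)) (unit e))
      + ip (unit e) ((Z S ^^ (2 * (s + 1))) (unit e)) / t) / 2)"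
    unfolding tr_def
  proof (rule sum_mono)
    fix e
    let ?u = "(Z S ^^ s) (unit e)" and ?v = "(Z S ^^ (s + 1)) (unit e)"
    have "0 \<le> ip (\<lambda>i. ?v i + (- t) * ?u i) (\<lambda>i. ?v i + (- t) * ?u i)" by (rule ip_nonneg)
    also have "\<dots> = ip ?v ?v - 2 * t * ip ?u ?v + t\<^sup>2 * ip ?u ?u"
      unfolding ip_add_square by simp
    finally have "ip ?u ?v \<le> (t * ip ?u ?u + ip ?v ?v / t) / 2"
      using t by (simp add: field_simps power2_eq_square)
    moreover have "ip (unit e) ((Z S ^^ (2 * s + 1)) (unit e)) = ip ?u ?v"
      using Z_pow_split[where S = S and m = s and n = "s + 1" and u = "unit e" and v = "unit e"] by (simp add: mult_2)
    ultimately show "ip (unit e) ((Z S ^^ (2 * s + 1)) (unit e))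
      \<le> (t * ip (unit e) ((Z S ^^ (2 * s)) (unit e)) + ip (unit e) ((Z S ^^ (2 * (s + 1))) (unit e)) / t) / 2"
      unfolding even_moment by simp
  qed
  also have "\<dots> = (t * tr (2 * s) S + tr (2 * (s + 1)) S / t) / 2"
    unfolding tr_def
    by (simp only: add_divide_distrib sum.distrib sum_distrib_left sum_divide_distrib)
  finally show ?thesis by simp
qed

section \<open>Expectation over Bernoulli subsets and the moment recursion\<close>

definition E :: "('k set \<Rightarrow> real) \<Rightarrow> real" where
  "E f = (\<Sum>S\<in>Pow G. wt S * f S)"

lemma wt_nonneg: "wt S \<ge> 0"
  using p01 by (simp add: wt_def)

lemma E_mono: "(\<And>S. S \<subseteq> G \<Longrightarrow> f S \<le> g S) \<Longrightarrow> E f \<le> E g"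
  unfolding E_def by (intro sum_mono mult_left_mono wt_nonneg) auto

lemma E_sum: "E (\<lambda>S. \<Sum>k\<in>A. f k S) = (\<Sum>k\<in>A. E (f k))"
  unfolding E_def by (subst sum.swap) (simp add: sum_distrib_left)

lemma E_add: "E (\<lambda>S. f S + g S) = E f + E g"
  unfolding E_def by (simp add: algebra_simps sum.distrib)

lemma E_cmult: "E (\<lambda>S. c * f S) = c * E f"
  unfolding E_def by (simp add: sum_distrib_left algebra_simps)

text \<open>Conditioning on all coordinates except k. The weight w of the remaining coordinates is
  hidden, since only its sign and its independence of f matter.\<close>

lemma E_split:
  assumes k: "k \<in> G"
  obtains w where "\<And>S. w S \<ge> 0"
    "\<And>f. E f = (\<Sum>S\<in>Pow (G - {k}). w S * (p * f (insert k S) + (1 - p) * f S))"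
proof
  let ?w = "\<lambda>S. p ^ card S * (1 - p) ^ (card G - 1 - card S)"
  show "?w S \<ge> 0" for S using p01 by simp
  show "E f = (\<Sum>S\<in>Pow (G - {k}). ?w S * (p * f (insert k S) + (1 - p) * f S))" for f
  proof -
    have G: "Pow G = Pow (G - {k}) \<union> insert k ` Pow (G - {k})"
      using k Pow_insert[of k "G - {k}"] by (simp add: insert_absorb)
    have "E f = (\<Sum>S\<in>Pow (G - {k}). wt S * f S) + (\<Sum>S\<in>insert k ` Pow (G - {k}). wt S * f S)"
      unfolding E_def G by (rule sum.union_disjoint) (use fin in auto)
    also have "(\<Sum>S\<in>insert k ` Pow (G - {k}). wt S * f S)
        = (\<Sum>S\<in>Pow (G - {k}). wt (insert k S) * f (insert k S))"
      by (subst sum.reindex) (auto simp: inj_on_def)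
    also have "(\<Sum>S\<in>Pow (G - {k}). wt S * f S) + (\<Sum>S\<in>Pow (G - {k}). wt (insert k S) * f (insert k S))
        = (\<Sum>S\<in>Pow (G - {k}). ?w S * (p * f (insert k S) + (1 - p) * f S))"
      unfolding sum.distrib[symmetric]
    proof (rule sum.cong[OF refl])
      fix S assume S: "S \<in> Pow (G - {k})"
      have fS: "finite S" "k \<notin> S" using S fin finite_subset by auto
      have "card S \<le> card (G - {k})" using S fin by (intro card_mono) auto
      hence c: "card S \<le> card G - 1" "card G > 0" using k fin by (auto simp: card_gt_0_iff)
      hence "card G - card S = Suc (card G - 1 - card S)" by linarith
      hence w1: "wt S = (1 - p) * ?w S" unfolding wt_def by simp
      have w2: "wt (insert k S) = p * ?w S" unfolding wt_def using fS by simp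
      show "wt S * f S + wt (insert k S) * f (insert k S)
          = ?w S * (p * f (insert k S) + (1 - p) * f S)"
        unfolding w1 w2 by (simp add: algebra_simps)
    qed
    finally show ?thesis .
  qed
qed

text \<open>For fixed other coordinates the left side is p (1 - p) times a jump, to which
  \<open>moment_difference_le\<close> applies. With a and b the even moments with and without k, the
  resulting p (1 - p) (a + b) is at most p (1 + p) a + (1 - p) p b, the mean of (xi_k + p) times the
  even moment. The weight is written as (xi_k - p) + 2 p so that summation over k produces an odd
  trace again.\<close>

lemma E_centered_le:
  assumes k: "k \<in> G"
  defines "g \<equiv> \<lambda>n S. ip (P k) ((Z S ^^ n) (P k))"
  shows "E (\<lambda>S. (of_bool (k \<in> S) - p) * g (2 * s + 1) S)
       \<le> real (2 * s + 1) / 2 * L * E (\<lambda>S. (of_bool (k \<in> S) - p) * g (2 * s) S + 2 * p * g (2 * s) S)"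
proof -
  obtain w where w: "\<And>S. w S \<ge> 0"
    "\<And>f. E f = (\<Sum>S\<in>Pow (G - {k}). w S * (p * f (insert k S) + (1 - p) * f S))"
    using E_split[OF k] by metis
  have L: "L \<ge> 0" using P_diag_01[OF k] P_diag[OF k] by simp
  let ?c = "real (2 * s + 1) / 2 * L"
  show ?thesis unfolding w(2) sum_distrib_left
  proof (rule sum_mono)
    fix S assume S: "S \<in> Pow (G - {k})"
    hence kS: "k \<notin> S" by auto
    let ?a = "g (2 * s) (insert k S)" and ?b = "g (2 * s) S"
    have pos: "?a \<ge> 0" "?b \<ge> 0" unfolding g_def by (rule even_moment_nonneg)+
    have "p * (1 - p) * (g (2 * s + 1) (insert k S) - g (2 * s + 1) S) \<le> p * (1 - p) * (?c * (?a + ?b))"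
      by (intro mult_left_mono) (use p01 moment_difference_le[OF k kS] in \<open>auto simp: g_def\<close>)
    also have "\<dots> = ?c * (p * (1 - p) * (?a + ?b))" by (rule mult.left_commute)
    also have "\<dots> \<le> ?c * (p * ((1 - p) * ?a + 2 * p * ?a) + (1 - p) * ((0 - p) * ?b + 2 * p * ?b))"
    proof (rule mult_left_mono)
      have "p * (p * ?a) \<ge> 0" using p01 pos by simp
      then show "p * (1 - p) * (?a + ?b) \<le> p * ((1 - p) * ?a + 2 * p * ?a) + (1 - p) * ((0 - p) * ?b + 2 * p * ?b)"
        by (simp add: algebra_simps)
    qed (use L in auto)
    finally have "p * (1 - p) * (g (2 * s + 1) (insert k S) - g (2 * s + 1) S) \<le> \<dots>" .
    then have "w S * (p * (1 - p) * (g (2 * s + 1) (insert k S) - g (2 * s + 1) S)) \<le> w S *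
       (?c * (p * ((1 - p) * ?a + 2 * p * ?a) + (1 - p) * ((0 - p) * ?b + 2 * p * ?b)))"
      by (rule mult_left_mono[OF _ w(1)[of S]])
    also have "\<dots> = ?c * (w S * (p * ((1 - p) * ?a + 2 * p * ?a) + (1 - p) * ((0 - p) * ?b + 2 * p * ?b)))"
      by (simp only: mult.left_commute)
    also have "w S * (p * (1 - p) * (g (2 * s + 1) (insert k S) - g (2 * s + 1) S))
      = w S * (p * ((1 - p) * g (2 * s + 1) (insert k S)) + (1 - p) * ((0 - p) * g (2 * s + 1) S))"
      by (simp add: algebra_simps)
    finally
    show "w S * (p * ((of_bool (k \<in> insert k S) - p) * g (2 * s + 1) (insert k S))
            + (1 - p) * ((of_bool (k \<in> S) - p) * g (2 * s + 1) S))
        \<le> ?c * (w S * (p * ((of_bool (k \<in> insert k S) - p) * ?a + 2 * p * ?a)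
            + (1 - p) * ((of_bool (k \<in> S) - p) * ?b + 2 * p * ?b)))"
      using kS by simp
  qed
qed

text \<open>After summation over k the bound contains the odd trace of order 2s + 1.
  \<open>tr_odd_le\<close> with this very t turns it into the trace of order 2s plus half of the
  left side, which is then absorbed.\<close>

lemma moment_step:
  fixes s :: nat
  assumes L: "L > 0"
  defines "t \<equiv> real (2 * s + 1) / 2 * L"
  shows "E (tr (2 * s + 2)) \<le> (t\<^sup>2 + 4 * p * t) * E (tr (2 * s))"
proof -
  have t: "t > 0" using L by (simp add: t_def)
  let ?g = "\<lambda>k n S. ip (P k) ((Z S ^^ n) (P k))"
  have "E (tr (2 * s + 2)) = (\<Sum>k\<in>G. E (\<lambda>S. (of_bool (k \<in> S) - p) * ?g k (2 * s + 1) S))"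
    using E_sum[of "\<lambda>k S. (of_bool (k \<in> S) - p) * ?g k (2 * s + 1) S" G]
    by (simp add: tr_Suc[abs_def])
  also have "\<dots> \<le> (\<Sum>k\<in>G. t * E (\<lambda>S. (of_bool (k \<in> S) - p) * ?g k (2 * s) S + 2 * p * ?g k (2 * s) S))"
    unfolding t_def by (intro sum_mono E_centered_le)
  also have "\<dots> = t * E (\<lambda>S. \<Sum>k\<in>G. (of_bool (k \<in> S) - p) * ?g k (2 * s) S + 2 * p * ?g k (2 * s) S)"
    by (simp only: E_sum sum_distrib_left)
  also have "\<dots> \<le> t * E (\<lambda>S. (t * tr (2 * s) S + tr (2 * s + 2) S / t) / 2 + 2 * p * tr (2 * s) S)"
  proof (intro mult_left_mono E_mono)
    fix S
    have "(\<Sum>k\<in>G. (of_bool (k \<in> S) - p) * ?g k (2 * s) S + 2 * p * ?g k (2 * s) S)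
        = tr (2 * s + 1) S + 2 * p * (\<Sum>k\<in>G. ?g k (2 * s) S)"
      by (simp add: tr_Suc sum.distrib sum_distrib_left)
    also have "\<dots> \<le> (t * tr (2 * s) S + tr (2 * s + 2) S / t) / 2 + 2 * p * tr (2 * s) S"
      by (intro add_mono tr_odd_le t mult_left_mono sum_even_moment_le) (use p01 in auto)
    finally show "(\<Sum>k\<in>G. (of_bool (k \<in> S) - p) * ?g k (2 * s) S + 2 * p * ?g k (2 * s) S) \<le> \<dots>" .
  qed (use t in auto)
  also have "(\<lambda>S. (t * tr (2 * s) S + tr (2 * s + 2) S / t) / 2 + 2 * p * tr (2 * s) S)
      = (\<lambda>S. (t / 2 + 2 * p) * tr (2 * s) S + 1 / (2 * t) * tr (2 * s + 2) S)"
    using t by (auto simp: field_simps)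
  also have "t * E \<dots> = t * ((t / 2 + 2 * p) * E (tr (2 * s)) + 1 / (2 * t) * E (tr (2 * s + 2)))"
    by (simp only: E_add E_cmult)
  finally have "E (tr (2 * s + 2)) \<le> t * (t / 2 + 2 * p) * E (tr (2 * s)) + E (tr (2 * s + 2)) / 2"
    using t by (simp add: algebra_simps)
  then show ?thesis by (simp add: algebra_simps power2_eq_square)
qed

text \<open>Below order K the factor t of \<open>moment_step\<close> is at most K L <= p, so t^2 + 4
  p t <= 5 p t <= 5 p K L.\<close>

lemma moment_bound:
  assumes L: "L > 0" and KL: "real K * L \<le> p"
  shows "s \<le> K \<Longrightarrow> E (tr (2 * s)) \<le> (5 * p * real K * L) ^ s * E (tr 0)"
proof (induction s)
  case (Suc s)
  let ?t = "real (2 * s + 1) / 2 * L"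
  have t: "0 \<le> ?t" "?t \<le> real K * L" using L Suc.prems by (auto intro!: mult_right_mono)
  have "?t\<^sup>2 + 4 * p * ?t \<le> p * ?t + 4 * p * ?t"
    using t KL unfolding power2_eq_square by (intro add_right_mono mult_right_mono) auto
  also have "\<dots> \<le> 5 * p * (real K * L)" using mult_left_mono[OF t(2), of "5 * p"] p01 by simp
  finally have c: "?t\<^sup>2 + 4 * p * ?t \<le> 5 * p * real K * L" by (simp add: mult.assoc)
  have "E (tr (2 * Suc s)) \<le> (?t\<^sup>2 + 4 * p * ?t) * E (tr (2 * s))"
    using moment_step[OF L, of s] by simp
  also have "\<dots> \<le> (5 * p * real K * L) * E (tr (2 * s))"
    by (intro mult_right_mono c) (auto simp: E_def intro!: sum_nonneg mult_nonneg_nonneg wt_nonneg tr_even_nonneg)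
  also have "\<dots> \<le> (5 * p * real K * L) * ((5 * p * real K * L) ^ s * E (tr 0))"
    using Suc p01 L by (intro mult_left_mono) auto
  finally show ?case by simp
qed simp

section \<open>From moments to the probability of a deviation\<close>

lemma sum_wt: "(\<Sum>S\<in>Pow G. wt S) = 1"
proof -
  have "(\<Prod>i\<in>G. p + (1 - p)) = (\<Sum>S\<in>Pow G. (\<Prod>i\<in>S. p) * (\<Prod>i\<in>G - S. 1 - p))"
    by (rule prod_add[OF fin])
  also have "\<dots> = (\<Sum>S\<in>Pow G. wt S)"
    by (rule sum.cong) (use fin in \<open>auto simp: wt_def card_Diff_subset finite_subset\<close>)
  finally show ?thesis by simp
qed

lemma E_tr_0: "E (tr 0) = real (card G)"
proof -
  have "tr 0 S = real (card G)" for S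
    unfolding tr_def using fin by (simp add: ip_unit) (simp add: unit_def)
  then show ?thesis using sum_wt by (simp add: E_def flip: sum_distrib_right)
qed

text \<open>Repeated squaring with Cauchy-Schwarz replaces the diagonalization of
  \<open>Z S\<close>. It is the reason why the order of the moment is a power of two.\<close>

lemma quadratic_form_pow_le:
  assumes u: "ip u u = 1"
  shows "(ip u (Z S u)) ^ (2 ^ j) \<le> ip u ((Z S ^^ (2 ^ j)) u)"
proof (induction j)
  case (Suc j)
  have "\<bar>ip u (Z S u) ^ (2 ^ j)\<bar> \<le> \<bar>ip u ((Z S ^^ (2 ^ j)) u)\<bar>"
  proof (cases j)
    case (Suc i)
    then have "ip u (Z S u) ^ (2 ^ j) \<ge> 0" by (simp add: zero_le_even_power)
    then show ?thesis using \<open>ip u (Z S u) ^ (2 ^ j) \<le> _\<close> by simp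
  qed simp
  then have "(ip u (Z S u) ^ (2 ^ j))\<^sup>2 \<le> (ip u ((Z S ^^ (2 ^ j)) u))\<^sup>2"
    by (simp add: abs_le_square_iff)
  also have "\<dots> \<le> ip u u * ip ((Z S ^^ (2 ^ j)) u) ((Z S ^^ (2 ^ j)) u)" by (rule cauchy_schwarz)
  also have "\<dots> = ip u ((Z S ^^ (2 ^ Suc j)) u)" using u by (simp add: even_moment)
  finally show ?case by (simp add: power_mult[symmetric] mult.commute)
qed simp

text \<open>The squared norm of Z^s u is at most the squared Frobenius norm of Z^s, and by symmetry
  the latter is the trace of Z^(2s).\<close>

lemma ip_even_le_tr:
  assumes u: "ip u u = 1"
  shows "ip u ((Z S ^^ (2 * s)) u) \<le> tr (2 * s) S"
proof -
  have "ip u ((Z S ^^ (2 * s)) u) = (\<Sum>e\<in>G. (ip ((Z S ^^ s) u) (unit e))\<^sup>2)"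
    unfolding even_moment by (simp add: ip_unit) (simp add: ip_def power2_eq_square)
  also have "\<dots> \<le> (\<Sum>e\<in>G. ip u u * ip ((Z S ^^ s) (unit e)) ((Z S ^^ s) (unit e)))"
    by (intro sum_mono) (metis Z_pow_sym cauchy_schwarz)
  also have "\<dots> = tr (2 * s) S" using u by (simp add: tr_def even_moment)
  finally show ?thesis .
qed

text \<open>Markov's inequality for the trace of order 2K with K = 2^j. Dividing (5 p K L)^K by
  (p/4)^(2K) gives 80 = 5 * 16.\<close>

lemma bernoulli_deviation:
  assumes L: "L > 0" and p: "p > 0" and KL: "real (2 ^ j) * L \<le> p"
    and bad: "\<And>S. S \<in> B \<Longrightarrow> S \<subseteq> G \<and> (\<exists>u. ip u u = 1 \<and> p / 4 \<le> \<bar>ip u (Z S u)\<bar>)"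
  shows "(\<Sum>S\<in>B. wt S) \<le> real (card G) * (80 * real (2 ^ j) * L / p) ^ (2 ^ j)"
proof -
  let ?K = "2 ^ j :: nat"
  have BG: "B \<subseteq> Pow G" using bad by auto
  have big: "(p / 4) ^ (2 * ?K) \<le> tr (2 * ?K) S" if S: "S \<in> B" for S
  proof -
    obtain u where u: "ip u u = 1" "p / 4 \<le> \<bar>ip u (Z S u)\<bar>" using bad[OF S] by auto
    have "(p / 4) ^ (2 * ?K) \<le> \<bar>ip u (Z S u)\<bar> ^ (2 * ?K)" using p u by (intro power_mono) auto
    also have "\<dots> = (ip u (Z S u)) ^ (2 ^ Suc j)" by (simp add: power_mult)
    also have "\<dots> \<le> ip u ((Z S ^^ (2 ^ Suc j)) u)" by (rule quadratic_form_pow_le[OF u(1)])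
    also have "\<dots> \<le> tr (2 * ?K) S" using ip_even_le_tr[OF u(1), where S = S and s = ?K] by simp
    finally show ?thesis .
  qed
  have "(p / 4) ^ (2 * ?K) * (\<Sum>S\<in>B. wt S) \<le> (\<Sum>S\<in>B. wt S * tr (2 * ?K) S)"
    unfolding sum_distrib_left by (intro sum_mono) (use big wt_nonneg in \<open>auto intro!: mult_left_mono simp: mult.commute[of _ "wt _"]\<close>)
  also have "\<dots> \<le> E (tr (2 * ?K))"
    unfolding E_def by (rule sum_mono2) (use fin BG wt_nonneg tr_even_nonneg in auto)
  also have "\<dots> \<le> (5 * p * real ?K * L) ^ ?K * real (card G)"
    using moment_bound[OF L KL, of ?K] by (simp add: E_tr_0)
  also have "(5 * p * real ?K * L) ^ ?K = (p / 4) ^ (2 * ?K) * (80 * real ?K * L / p) ^ ?K"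
    unfolding power_mult power_mult_distrib[symmetric] using p
    by (intro arg_cong[of _ _ "\<lambda>x. x ^ _"]) (simp add: field_simps power2_eq_square)
  finally have "(p / 4) ^ (2 * ?K) * (\<Sum>S\<in>B. wt S)
     \<le> (p / 4) ^ (2 * ?K) * (real (card G) * (80 * real ?K * L / p) ^ ?K)" by (simp add: algebra_simps)
  then show ?thesis using p by simp
qed

end

section \<open>Uniform subsets of fixed size\<close>

text \<open>The ratio of consecutive terms is kept cross-multiplied, with N p = m and N (1 - p) = N
  - m. Comparing (i + 1) (N - m) with (N - i) m shows an increase up to m and a decrease afterwards.
  For m = N this relation degenerates to 0 = 0 at the end, hence the separate case.\<close>

lemma binomial_mode:
  fixes N m :: nat
  assumes "m \<le> N" "N > 0"
  defines "p \<equiv> real m / real N"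
  defines "b \<equiv> \<lambda>j. real (N choose j) * p ^ j * (1 - p) ^ (N - j)"
  assumes j: "j \<le> N"
  shows "b j \<le> b m"
proof (cases "m = N")
  case True
  then have p: "p = 1" using assms(2) by (simp add: p_def)
  show ?thesis using True j by (cases "j = N") (simp_all add: b_def p power_0_left)
next
  case False
  then have mN: "m < N" using assms by simp
  have b0: "b i \<ge> 0" for i
    unfolding b_def p_def using assms by (intro mult_nonneg_nonneg zero_le_power) auto
  have step: "b (Suc i) * (real (Suc i) * real (N - m)) = b i * (real (N - i) * real m)" if "i < N" for i
  proof -
    have c: "real (Suc i) * real (N choose Suc i) = real (N - i) * real (N choose i)"
      using binomial_absorb_comp[of N i] Suc_times_binomial_eq[of "N - 1" i] that
      by (metis (no_types, lifting) Suc_pred' binomial_absorption gr_implies_not_zero neq0_conv of_nat_mult mult.commute)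
    have e: "N - i = Suc (N - Suc i)" using that by simp
    have Np: "real N * (1 - p) = real (N - m)" "real N * p = real m"
      using assms by (simp_all add: p_def field_simps of_nat_diff)
    have "b (Suc i) * (real (Suc i) * (real N * (1 - p)))
        = (real (Suc i) * real (N choose Suc i)) * p ^ i * (1 - p) ^ (N - i) * (real N * p)"
      unfolding b_def e by (simp add: algebra_simps)
    also have "\<dots> = b i * (real (N - i) * (real N * p))"
      unfolding c b_def by (simp add: algebra_simps)
    finally show ?thesis unfolding Np .
  qed
  have up: "b i \<le> b (Suc i)" if "i < m" for i
  proof -
    have iN: "i < N" using that mN by simp
    have "real N * (real i + 1) \<le> real N * real m" using that by (intro mult_left_mono) auto
    then have "real (Suc i) * real (N - m) \<le> real (N - i) * real m"
      using mN that by (simp add: algebra_simps)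
    then have "b i * (real (Suc i) * real (N - m)) \<le> b (Suc i) * (real (Suc i) * real (N - m))"
      unfolding step[OF iN] by (intro mult_left_mono b0)
    then show ?thesis using mN by simp
  qed
  have down: "b (Suc i) \<le> b i" if "m \<le> i" "i < N" for i
  proof -
    have "real N * real m \<le> real N * real i" using that by (intro mult_left_mono) auto
    then have "real m + real N * real m \<le> real N + real N * real i" using mN by linarith
    then have "real (N - i) * real m \<le> real (Suc i) * real (N - m)"
      using mN that by (simp add: algebra_simps)
    then have "b (Suc i) * (real (Suc i) * real (N - m)) \<le> b i * (real (Suc i) * real (N - m))"
      unfolding step[OF that(2)] by (intro mult_left_mono b0)
    then show ?thesis using mN by simp
  qed
  show ?thesis
  proof (cases "j \<le> m")
    case True
    then show ?thesis
      by (induction rule: inc_induct) (use up order_trans in blast)+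
  next
    case False
    then have "m \<le> j" by simp
    then show ?thesis using j
      by (induction rule: dec_induct) (use down order_trans in \<open>auto simp: Suc_le_eq\<close>)
  qed
qed

lemma binomial_mode_ge:
  fixes N m :: nat
  assumes "m \<le> N" "N > 0"
  defines "p \<equiv> real m / real N"
  shows "1 \<le> real (N + 1) * (real (N choose m) * p ^ m * (1 - p) ^ (N - m))"
proof -
  have "1 = (p + (1 - p)) ^ N" by simp
  also have "\<dots> = (\<Sum>j\<le>N. real (N choose j) * p ^ j * (1 - p) ^ (N - j))"
    by (rule binomial_ring)
  also have "\<dots> \<le> (\<Sum>j\<le>N. real (N choose m) * p ^ m * (1 - p) ^ (N - m))"
    by (rule sum_mono) (use binomial_mode[OF assms(1,2)] in \<open>simp add: p_def\<close>)
  finally show ?thesis by simp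
qed

text \<open>All m-subsets have the same Bernoulli weight, so the uniform probability of a family of
  them is its Bernoulli probability divided by that of size m. As m is the mode among N + 1 sizes,
  the latter is at least 1 / (N + 1).\<close>

lemma uniform_rip:
  fixes G :: "'k set" and P :: "'k \<Rightarrow> 'k \<Rightarrow> real"
  assumes fin: "finite G" and m: "0 < m" "m \<le> card G"
    and P_sym: "\<And>i j. i \<in> G \<Longrightarrow> j \<in> G \<Longrightarrow> P i j = P j i"
    and P_idem: "\<And>i k. i \<in> G \<Longrightarrow> k \<in> G \<Longrightarrow> (\<Sum>j\<in>G. P i j * P j k) = P i k"
    and P_diag: "\<And>k. k \<in> G \<Longrightarrow> P k k \<le> L"
    and p: "p = real m / real (card G)" and L: "L > 0" and KL: "real (2 ^ j) * L \<le> p"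
  shows "measure_pmf.prob (pmf_of_set {S. S \<subseteq> G \<and> card S = m})
     {S. \<forall>v. (\<forall>k\<in>G. (\<Sum>l\<in>G. P k l * v l) = v k) \<longrightarrow>
        \<bar>(\<Sum>k\<in>S. (v k)\<^sup>2) - p * (\<Sum>k\<in>G. (v k)\<^sup>2)\<bar> \<le> p / 4 * (\<Sum>k\<in>G. (v k)\<^sup>2)}
   \<ge> 1 - real (card G + 1) * real (card G) * (80 * real (2 ^ j) * L / p) ^ (2 ^ j)"
    (is "measure_pmf.prob (pmf_of_set ?A) ?good \<ge> 1 - ?\<epsilon>")
proof -
  have N: "card G > 0" using m by simp
  have p_pos: "0 < p" "p \<le> 1" using m N p by auto
  interpret bernoulli_frame G P p L
    using assms p_pos by unfold_locales auto
  have finA: "finite ?A" using fin by simp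
  have cardA: "card ?A = card G choose m" using n_subsets[OF fin] by simp
  then have Apos: "card ?A > 0" using m by simp
  have A0: "?A \<noteq> {}" using Apos card_gt_0_iff by blast
  \<comment> \<open>For a vector fixed by the projection, \<open>ip (P k) v\<close> is the
    coordinate v k, so the form of \<open>Z S\<close> is the centred sum of squares.\<close>
  have quad: "ip v (Z S v) = (\<Sum>k\<in>S. (v k)\<^sup>2) - p * (\<Sum>k\<in>G. (v k)\<^sup>2)"
    if v: "\<forall>k\<in>G. (\<Sum>l\<in>G. P k l * v l) = v k" and S: "S \<subseteq> G" for v S
  proof -
    have "ip v (Z S v) = (\<Sum>k\<in>G. of_bool (k \<in> S) * (v k)\<^sup>2 - p * (v k)\<^sup>2)"
      unfolding ip_Z by (intro sum.cong refl)
        (use v in \<open>simp add: ip_def power2_eq_square algebra_simps\<close>)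
    also have "\<dots> = (\<Sum>k\<in>G. of_bool (k \<in> S) * (v k)\<^sup>2) - p * (\<Sum>k\<in>G. (v k)\<^sup>2)"
      by (simp add: sum_subtractf sum_distrib_left)
    also have "(\<Sum>k\<in>G. of_bool (k \<in> S) * (v k)\<^sup>2) = (\<Sum>k\<in>S. (v k)\<^sup>2)"
      by (rule sum.mono_neutral_cong_right) (use S fin in auto)
    finally show ?thesis .
  qed
  define B where "B = ?A - ?good"
  have bad: "S \<subseteq> G \<and> (\<exists>u. ip u u = 1 \<and> p / 4 \<le> \<bar>ip u (Z S u)\<bar>)" if SB: "S \<in> B" for S
  proof -
    have S: "S \<subseteq> G" using SB by (simp add: B_def)
    obtain v where v: "\<forall>k\<in>G. (\<Sum>l\<in>G. P k l * v l) = v k"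
      "p / 4 * (\<Sum>k\<in>G. (v k)\<^sup>2) < \<bar>(\<Sum>k\<in>S. (v k)\<^sup>2) - p * (\<Sum>k\<in>G. (v k)\<^sup>2)\<bar>"
      using SB unfolding B_def by (auto simp: not_le)
    define s where "s = sqrt (\<Sum>k\<in>G. (v k)\<^sup>2)"
    have s0: "(\<Sum>k\<in>G. (v k)\<^sup>2) \<noteq> 0"
    proof
      assume z: "(\<Sum>k\<in>G. (v k)\<^sup>2) = 0"
      then have "(\<Sum>k\<in>S. (v k)\<^sup>2) = 0"
        using S fin by (auto simp: sum_nonneg_eq_0_iff intro!: sum.neutral)
      with z v(2) show False by simp
    qed
    have ss: "s\<^sup>2 = (\<Sum>k\<in>G. (v k)\<^sup>2)" unfolding s_def by (simp add: sum_nonneg)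
    with s0 have sne: "s \<noteq> 0" by auto
    define u where "u = (\<lambda>k. v k / s)"
    have u: "\<forall>k\<in>G. (\<Sum>l\<in>G. P k l * u l) = u k"
      using v(1) by (simp add: u_def flip: sum_divide_distrib)
    have uu: "(\<Sum>k\<in>T. (u k)\<^sup>2) = (\<Sum>k\<in>T. (v k)\<^sup>2) / s\<^sup>2" for T
      by (simp add: u_def power_divide sum_divide_distrib)
    have "ip u u = 1" using uu[of G] ss s0 by (simp add: ip_def power2_eq_square)
    moreover have "ip u (Z S u) = ((\<Sum>k\<in>S. (v k)\<^sup>2) - p * (\<Sum>k\<in>G. (v k)\<^sup>2)) / s\<^sup>2"
      unfolding quad[OF u S] uu by (simp add: diff_divide_distrib)
    then have "p / 4 \<le> \<bar>ip u (Z S u)\<bar>"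
      using v(2) sne by (simp add: ss[symmetric] pos_le_divide_eq)
    ultimately show ?thesis using S by blast
  qed
  have "(\<Sum>S\<in>B. wt S) = real (card B) * (p ^ m * (1 - p) ^ (card G - m))"
    by (simp add: wt_def B_def)
  then have dev: "real (card B) * (p ^ m * (1 - p) ^ (card G - m))
      \<le> real (card G) * (80 * real (2 ^ j) * L / p) ^ (2 ^ j)"
    using bernoulli_deviation[where B = B, OF L p_pos(1) KL bad] by simp
  have mode: "1 \<le> real (card G + 1) * (real (card ?A) * (p ^ m * (1 - p) ^ (card G - m)))"
    using binomial_mode_ge[OF m(2) N] by (simp add: p cardA mult.assoc)
  have "real (card B) * 1 \<le> real (card B) *
     (real (card G + 1) * (real (card ?A) * (p ^ m * (1 - p) ^ (card G - m))))"
    by (rule mult_left_mono[OF mode]) simp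
  also have "\<dots> = (real (card G + 1) * real (card ?A)) * (real (card B) * (p ^ m * (1 - p) ^ (card G - m)))"
    by (simp only: mult_ac)
  also have "\<dots> \<le> (real (card G + 1) * real (card ?A)) *
      (real (card G) * (80 * real (2 ^ j) * L / p) ^ (2 ^ j))"
    by (rule mult_left_mono[OF dev]) simp
  also have "\<dots> = ?\<epsilon> * real (card ?A)" by (simp only: mult_ac)
  finally have cB: "real (card B) \<le> ?\<epsilon> * real (card ?A)" by simp
  have "card B = card ?A - card (?A \<inter> ?good)"
    unfolding B_def using finA by (subst card_Diff_subset_Int) (auto simp: Int_commute)
  moreover have "card (?A \<inter> ?good) \<le> card ?A" using finA by (intro card_mono) auto
  ultimately have "real (card (?A \<inter> ?good)) = real (card ?A) - real (card B)" by simp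
  then have "measure_pmf.prob (pmf_of_set ?A) ?good = 1 - real (card B) / real (card ?A)"
    using Apos by (simp add: measure_pmf_of_set[OF A0 finA] diff_divide_distrib)
  moreover have "real (card B) / real (card ?A) \<le> ?\<epsilon>" using cB Apos by (simp add: divide_le_eq)
  ultimately show ?thesis by linarith
qed

section \<open>Singular values of a compact factorization\<close>

text \<open>Side conditions on dimensions instead of carriers, so that the simplifier can solve them.\<close>
lemma mult_assoc_dim:
  fixes A B C :: "'a::semiring_0 mat"
  shows "dim_col A = dim_row B \<Longrightarrow> dim_col B = dim_row C \<Longrightarrow> (A * B) * C = A * (B * C)"
  by (rule assoc_mult_mat) auto

lemma transpose_mult_dim:
  fixes A B :: "'a::comm_semiring_0 mat"
  shows "dim_col A = dim_row B \<Longrightarrow> transpose_mat (A * B) = transpose_mat B * transpose_mat A"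
  by (rule transpose_mult) auto

text \<open>Eliminate in the block matrix with rows (x I, A) and (B, I) in two ways: its determinant
  is the characteristic polynomial of A B, and x^r times it is x^n times that of B A.\<close>

lemma char_poly_mult_swap:
  fixes A B :: "real mat"
  assumes A: "A \<in> carrier_mat n r" and B: "B \<in> carrier_mat r n"
  shows "[:0, 1:] ^ r * char_poly (A * B) = [:0, 1:] ^ n * char_poly (B * A)"
proof -
  define x :: "real poly" where "x = [:0, 1:]"
  define a where "a = map_mat (\<lambda>c. [:c:]) A"
  define b where "b = map_mat (\<lambda>c. [:c:]) B"
  have a: "a \<in> carrier_mat n r" and b: "b \<in> carrier_mat r n"
    using A B by (simp_all add: a_def b_def)
  have cp: "char_poly_matrix (C * D) = x \<cdot>\<^sub>m 1\<^sub>m k - map_mat (\<lambda>c. [:c:]) C * map_mat (\<lambda>c. [:c:]) D"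
    if C: "C \<in> carrier_mat k l" and D: "D \<in> carrier_mat l k" for C D :: "real mat" and k l
    unfolding map_poly_mult(1)[OF C D, symmetric]
    by (rule eq_matI) (use C D in \<open>auto simp: char_poly_matrix_def x_def\<close>)
  let ?M = "four_block_mat (x \<cdot>\<^sub>m 1\<^sub>m n) a b (1\<^sub>m r)"
  let ?R = "four_block_mat (1\<^sub>m n) (0\<^sub>m n r) (- b) (1\<^sub>m r)"
  let ?L = "four_block_mat (1\<^sub>m n) (0\<^sub>m n r) (- b) (x \<cdot>\<^sub>m 1\<^sub>m r)"
  have M: "?M \<in> carrier_mat (n + r) (n + r)" and R: "?R \<in> carrier_mat (n + r) (n + r)"
    and L: "?L \<in> carrier_mat (n + r) (n + r)" using a b by auto
  have ab: "a * b \<in> carrier_mat n n" and ba: "b * a \<in> carrier_mat r r" using a b by auto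
  have "?M * ?R = four_block_mat (x \<cdot>\<^sub>m 1\<^sub>m n - a * b) a (0\<^sub>m r n) (1\<^sub>m r)"
    by (subst mult_four_block_mat[of _ n n _ r _ r _ _ n _ r])
      (use a b in \<open>auto intro!: cong_four_block_mat eq_matI\<close>)
  moreover have "det (four_block_mat (x \<cdot>\<^sub>m 1\<^sub>m n - a * b) a (0\<^sub>m r n) (1\<^sub>m r))
      = det (x \<cdot>\<^sub>m 1\<^sub>m n - a * b) * det (1\<^sub>m r)"
    by (rule det_four_block_mat_lower_left_zero[OF minus_carrier_mat[OF ab] a refl one_carrier_mat])
  ultimately have "det ?M * det ?R = det (x \<cdot>\<^sub>m 1\<^sub>m n - a * b)"
    using det_mult[OF M R] by (metis det_one mult.right_neutral)
  moreover have "det ?R = 1"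
    using b by (subst det_four_block_mat_upper_right_zero[of _ n _ r]) auto
  ultimately have 1: "det ?M = char_poly (A * B)"
    using cp[OF A B] by (simp add: char_poly_def a_def b_def)
  have "?L * ?M = four_block_mat (x \<cdot>\<^sub>m 1\<^sub>m n) a (0\<^sub>m r n) (x \<cdot>\<^sub>m 1\<^sub>m r - b * a)"
    by (subst mult_four_block_mat[of _ n n _ r _ r _ _ n _ r])
      (use a b in \<open>auto intro!: cong_four_block_mat eq_matI\<close>)
  moreover have "det (four_block_mat (x \<cdot>\<^sub>m 1\<^sub>m n) a (0\<^sub>m r n) (x \<cdot>\<^sub>m 1\<^sub>m r - b * a))
      = det (x \<cdot>\<^sub>m 1\<^sub>m n) * det (x \<cdot>\<^sub>m 1\<^sub>m r - b * a)"
    by (rule det_four_block_mat_lower_left_zero[OF smult_carrier_mat[OF one_carrier_mat] a refl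
          minus_carrier_mat[OF ba]])
  ultimately have "det ?L * det ?M = x ^ n * det (x \<cdot>\<^sub>m 1\<^sub>m r - b * a)"
    using det_mult[OF L M] by (simp add: det_smult)
  moreover have "det ?L = x ^ r"
    using b by (subst det_four_block_mat_upper_right_zero[of _ n _ r]) auto
  ultimately have "x ^ r * det ?M = x ^ n * char_poly (B * A)"
    using cp[OF B A] by (simp add: char_poly_def a_def b_def)
  then show ?thesis unfolding 1 by (simp add: x_def)
qed

lemma proots_prod_list_linear:
  fixes f :: "nat \<Rightarrow> real"
  shows "proots (\<Prod>i\<leftarrow>xs. [:- f i, 1:]) = mset (map f xs)"
proof (induction xs)
  case (Cons i xs)
  have "(\<Prod>i\<leftarrow>xs. [:- f i, 1:]) \<noteq> 0" by (auto simp: prod_list_zero_iff)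
  then show ?case using Cons by (simp add: proots_mult del: mult_pCons_left)
qed simp

text \<open>X^T X and S^T S have the same nonzero eigenvalues by \<open>char_poly_mult_swap\<close>.
  Zeros are added on both sides so that no multiset or dimension has to be subtracted.\<close>

lemma proots_svd:
  assumes svd: "is_compact_svd r X U S V" and X: "X \<in> carrier_mat n1 n2"
  shows "proots (char_poly (transpose_mat X * X)) + replicate_mset r 0
       = replicate_mset n2 0 + mset (map (\<lambda>i. (S $$ (i, i))\<^sup>2) [0..<r])"
proof -
  have U: "U \<in> carrier_mat n1 r" and S: "S \<in> carrier_mat r r" and V: "V \<in> carrier_mat n2 r"
    and UU: "transpose_mat U * U = 1\<^sub>m r" and VV: "transpose_mat V * V = 1\<^sub>m r"
    and dg: "diagonal_mat S" and XX: "X = U * S * transpose_mat V"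
    using svd X unfolding is_compact_svd_def by auto
  have SS: "transpose_mat S * S \<in> carrier_mat r r" using S by simp
  have [simp]: "dim_row U = n1" "dim_col U = r" "dim_row S = r" "dim_col S = r" "dim_row V = n2" "dim_col V = r"
    using U S V by auto
  have "transpose_mat X * X = V * (transpose_mat S * ((transpose_mat U * U) * (S * transpose_mat V)))"
    by (simp add: XX transpose_mult_dim mult_assoc_dim del: assoc_mult_mat)
  also have "\<dots> = V * (transpose_mat S * S) * transpose_mat V"
    unfolding UU using S V by (simp add: mult_assoc_dim left_mult_one_mat[of _ r n2] del: assoc_mult_mat)
  finally have e: "transpose_mat X * X = (V * (transpose_mat S * S)) * transpose_mat V" .
  have ba: "transpose_mat V * (V * (transpose_mat S * S)) = transpose_mat S * S"
    using V SS VV by (simp add: assoc_mult_mat[symmetric, of _ r n2 _ r])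
  have ent: "(transpose_mat S * S) $$ (i, j) = (if i = j then (S $$ (i, i))\<^sup>2 else 0)"
    if "i < r" "j < r" for i j
  proof -
    have "(transpose_mat S * S) $$ (i, j) = (\<Sum>k<r. S $$ (k, i) * S $$ (k, j))"
      using S that by (simp add: scalar_prod_def atLeast0LessThan)
    also have "\<dots> = (\<Sum>k<r. if k = i then (if i = j then (S $$ (i, i))\<^sup>2 else 0) else 0)"
      using dg S that unfolding diagonal_mat_def
      by (intro sum.cong refl) (auto simp: power2_eq_square)
    also have "\<dots> = (if i = j then (S $$ (i, i))\<^sup>2 else 0)" using that by simp
    finally show ?thesis .
  qed
  have "char_poly (transpose_mat S * S) = (\<Prod>a\<leftarrow>diag_mat (transpose_mat S * S). [:- a, 1:])"
    by (rule char_poly_upper_triangular[OF SS]) (use S ent in \<open>auto simp: upper_triangular_def\<close>)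
  also have "diag_mat (transpose_mat S * S) = map (\<lambda>i. (S $$ (i, i))\<^sup>2) [0..<r]"
    using S ent by (auto simp: diag_mat_def simp del: index_mult_mat(1))
  finally have cS: "char_poly (transpose_mat S * S) = (\<Prod>i\<leftarrow>[0..<r]. [:- (S $$ (i, i))\<^sup>2, 1:])"
    by (simp add: o_def)
  have pr: "proots (char_poly (transpose_mat S * S)) = mset (map (\<lambda>i. (S $$ (i, i))\<^sup>2) [0..<r])"
    unfolding cS by (rule proots_prod_list_linear)
  have sw: "[:0, 1:] ^ r * char_poly (transpose_mat X * X)
      = [:0, 1:] ^ n2 * char_poly (transpose_mat S * S)"
    unfolding e using char_poly_mult_swap[of "V * (transpose_mat S * S)" n2 r "transpose_mat V"] V SS
    by (simp add: ba)
  have nz: "char_poly (transpose_mat X * X) \<noteq> 0" "char_poly (transpose_mat S * S) \<noteq> 0"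
    using degree_monic_char_poly[of "transpose_mat X * X" n2] degree_monic_char_poly[OF SS] X
    by auto
  show ?thesis
    using arg_cong[OF sw, of proots] nz pr
    by (simp add: proots_mult proots_power add.commute[of _ "replicate_mset r 0"])
qed

text \<open>\<open>sing_val\<close> looks up a position in a list, so the length of that list must
  be known first; \<open>proots_svd\<close> gives it as n2, together with nonnegative roots. The
  rest is sortedness.\<close>

lemma sing_val_order:
  assumes svd: "is_compact_svd r X U S V" and X: "X \<in> carrier_mat n1 n2" and r: "1 \<le> r" "r \<le> n2"
    and i: "i < r"
  shows "sing_val X (Suc i) \<le> sing_val X 1" "sing_val X r \<le> sing_val X (Suc i)" "0 \<le> sing_val X r"
proof -
  let ?A = "proots (char_poly (transpose_mat X * X))"
  note ms = proots_svd[OF svd X]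
  have "size ?A + r = n2 + r" using arg_cong[OF ms, of size] by simp
  then have sz: "size ?A = n2" by simp
  have pos: "x \<ge> 0" if "x \<in># ?A" for x
  proof -
    have "x \<in># ?A + replicate_mset r 0" using that by simp
    then show ?thesis unfolding ms by (auto split: if_splits)
  qed
  define xs where "xs = sorted_list_of_multiset (image_mset sqrt ?A)"
  have len: "length xs = n2" unfolding xs_def
    by (metis mset_sorted_list_of_multiset size_image_mset size_mset sz)
  have srt: "sorted xs" by (simp add: xs_def)
  have pxs: "x \<ge> 0" if "x \<in> set xs" for x
    using that pos by (auto simp: xs_def)
  have sv: "sing_val X (Suc k) = xs ! (n2 - Suc k)" if "k < n2" for k
    using that by (simp add: sing_val_def singular_values_def xs_def[symmetric] rev_nth len)
  have "sing_val X r = xs ! (n2 - r)" using sv[of "r - 1"] r by simp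
  moreover have "sing_val X 1 = xs ! (n2 - 1)" using sv[of 0] r by simp
  moreover have "sing_val X (Suc i) = xs ! (n2 - Suc i)" using sv[of i] r i by simp
  ultimately show "sing_val X (Suc i) \<le> sing_val X 1" "sing_val X r \<le> sing_val X (Suc i)"
      "0 \<le> sing_val X r"
    using r i by (auto simp: len intro!: sorted_nth_mono[OF srt] pxs)
qed

lemma rank_diag_product_le:
  fixes X U S V :: "real mat"
  assumes U: "U \<in> carrier_mat n1 r" and S: "S \<in> carrier_mat r r" and V: "V \<in> carrier_mat n2 r"
    and dg: "diagonal_mat S" and X: "X = U * S * transpose_mat V"
  shows "vec_space.rank n1 X \<le> card {i. i < r \<and> S $$ (i, i) \<noteq> 0}"
proof -
  interpret vec_space "TYPE(real)" n1 .
  define Y where "Y k = mat n1 n2 (\<lambda>(a, b). \<Sum>i<k. U $$ (a, i) * S $$ (i, i) * V $$ (b, i))" for k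
  have Y: "Y k \<in> carrier_mat n1 n2" for k by (simp add: Y_def)
  have "rank (Y k) \<le> card {i. i < k \<and> S $$ (i, i) \<noteq> 0}" for k
  proof (induction k)
    case 0
    have "Y 0 = 0\<^sub>m n1 n2" by (rule eq_matI) (auto simp: Y_def)
    then show ?case using rank_0I by simp
  next
    case (Suc k)
    let ?T = "mat n1 n2 (\<lambda>(a, b). (U $$ (a, k) * S $$ (k, k)) * V $$ (b, k))"
    have "Y (Suc k) = Y k + ?T" by (rule eq_matI) (auto simp: Y_def)
    then have *: "rank (Y (Suc k)) \<le> rank (Y k) + rank ?T"
      using rank_subadditive[OF Y, of ?T] by simp
    show ?case
    proof (cases "S $$ (k, k) = 0")
      case True
      then have "?T = 0\<^sub>m n1 n2" by (intro eq_matI) auto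
      moreover have "{i. i < Suc k \<and> S $$ (i, i) \<noteq> 0} = {i. i < k \<and> S $$ (i, i) \<noteq> 0}"
        using True less_Suc_eq by auto
      ultimately show ?thesis using * Suc rank_0I by simp
    next
      case False
      have "rank ?T \<le> 1" by (rule rank_le_1_product_entries[of _ n2 "\<lambda>a. U $$ (a, k) * S $$ (k, k)" "\<lambda>b. V $$ (b, k)"]) auto
      moreover have "{i. i < Suc k \<and> S $$ (i, i) \<noteq> 0} = insert k {i. i < k \<and> S $$ (i, i) \<noteq> 0}"
        using False less_Suc_eq by auto
      ultimately show ?thesis using * Suc by simp
    qed
  qed
  moreover have "X = Y r"
  proof (rule eq_matI)
    fix a b assume "a < dim_row (Y r)" "b < dim_col (Y r)"
    then have ab: "a < n1" "b < n2" by (auto simp: Y_def)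
    have US: "(U * S) $$ (a, i) = U $$ (a, i) * S $$ (i, i)" if "i < r" for i
    proof -
      have "(U * S) $$ (a, i) = (\<Sum>k<r. U $$ (a, k) * S $$ (k, i))"
        using U S ab that by (simp add: scalar_prod_def atLeast0LessThan)
      also have "\<dots> = (\<Sum>k<r. if k = i then U $$ (a, i) * S $$ (i, i) else 0)"
        using dg S that unfolding diagonal_mat_def by (intro sum.cong refl) auto
      finally show ?thesis using that by simp
    qed
    have "X $$ (a, b) = (\<Sum>i<r. (U * S) $$ (a, i) * V $$ (b, i))"
      unfolding X using U S V ab
      by (subst index_mult_mat(1)) (auto simp: scalar_prod_def atLeast0LessThan
        simp del: assoc_mult_mat row_mult intro!: sum.cong)
    also have "\<dots> = Y r $$ (a, b)" using ab US by (simp add: Y_def)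
    finally show "X $$ (a, b) = Y r $$ (a, b)" .
  qed (use U S V X in \<open>auto simp: Y_def\<close>)
  ultimately show ?thesis by simp
qed

lemma incoherent_mats_svd:
  assumes X: "X \<in> incoherent_mats n1 n2 r \<mu> \<kappa>" and r: "1 \<le> r"
  obtains U S V where
    "X \<in> carrier_mat n1 n2" "U \<in> carrier_mat n1 r" "S \<in> carrier_mat r r" "V \<in> carrier_mat n2 r"
    "transpose_mat U * U = 1\<^sub>m r" "transpose_mat V * V = 1\<^sub>m r" "X = U * S * transpose_mat V"
    "diagonal_mat S" "\<And>i. i < r \<Longrightarrow> sing_val X r \<le> S $$ (i, i) \<and> S $$ (i, i) \<le> sing_val X 1"
    "0 < sing_val X r" "sing_val X 1 = \<kappa> * sing_val X r" "1 \<le> \<kappa>"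
    "norm_2_inf U \<le> sqrt (\<mu> * real r / real n1)" "norm_2_inf V \<le> sqrt (\<mu> * real r / real n2)"
proof -
  have Xc: "X \<in> carrier_mat n1 n2" and rk: "vec_space.rank n1 X = r"
    and \<kappa>: "sing_val X 1 / sing_val X r = \<kappa>" and inc: "incoherent r \<mu> X"
    using X by (auto simp: incoherent_mats_def)
  obtain U S V where svd: "is_compact_svd r X U S V"
    and nU: "norm_2_inf U \<le> sqrt (\<mu> * real r / real n1)"
    and nV: "norm_2_inf V \<le> sqrt (\<mu> * real r / real n2)"
    using inc Xc by (auto simp: incoherent_def)
  have U: "U \<in> carrier_mat n1 r" and S: "S \<in> carrier_mat r r" and V: "V \<in> carrier_mat n2 r"
    and UU: "transpose_mat U * U = 1\<^sub>m r" and VV: "transpose_mat V * V = 1\<^sub>m r"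
    and dg: "diagonal_mat S" and XX: "X = U * S * transpose_mat V"
    and Sv: "\<And>i. i < r \<Longrightarrow> S $$ (i, i) = sing_val X (Suc i)"
    using svd Xc unfolding is_compact_svd_def by auto
  have rn: "r \<le> n2" using vec_space.rank_le_nc[OF Xc] rk by simp
  note ord = sing_val_order[OF svd Xc r rn]
  \<comment> \<open>The smallest of the first r singular values is positive: a zero at this diagonal
    position would leave at most r - 1 nonzero entries, and the rank would drop below r.\<close>
  have "S $$ (r - 1, r - 1) \<noteq> 0"
  proof
    assume z: "S $$ (r - 1, r - 1) = 0"
    have "{i. i < r \<and> S $$ (i, i) \<noteq> 0} \<subseteq> {..<r - 1}"
    proof
      fix i assume "i \<in> {i. i < r \<and> S $$ (i, i) \<noteq> 0}"
      then have "i < r" "i \<noteq> r - 1" using z by auto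
      then show "i \<in> {..<r - 1}" by simp
    qed
    then have "card {i. i < r \<and> S $$ (i, i) \<noteq> 0} \<le> r - 1"
      using card_mono[of "{..<r - 1}"] by fastforce
    then show False using rank_diag_product_le[OF U S V dg XX] rk r by simp
  qed
  then have pos: "0 < sing_val X r" using Sv[of "r - 1"] ord(3)[of 0] r by simp
  have s1: "sing_val X 1 = \<kappa> * sing_val X r" using \<kappa> pos by (simp add: field_simps)
  have "1 * sing_val X r \<le> \<kappa> * sing_val X r" using ord(2)[of 0] r s1 by simp
  then have "1 \<le> \<kappa>" using pos mult_right_le_imp_le by blast
  then show ?thesis
    using that[OF Xc U S V UU VV XX dg _ pos s1 _ nU nV] ord Sv by simp
qed

section \<open>Frobenius norm and operator bounds\<close>

lemma mult_add_dim:
  fixes A B C :: "'a::semiring_0 mat"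
  shows "dim_row B = dim_row C \<Longrightarrow> dim_col B = dim_col C \<Longrightarrow> dim_col A = dim_row B \<Longrightarrow>
    A * (B + C) = A * B + A * C"
  by (rule mult_add_distrib_mat) auto

lemma add_mult_dim:
  fixes A B C :: "'a::semiring_0 mat"
  shows "dim_row A = dim_row B \<Longrightarrow> dim_col A = dim_col B \<Longrightarrow> dim_col A = dim_row C \<Longrightarrow>
    (A + B) * C = A * C + B * C"
  by (rule add_mult_distrib_mat) auto

lemma mult_minus_dim:
  fixes A B C :: "'a::ring mat"
  shows "dim_row B = dim_row C \<Longrightarrow> dim_col B = dim_col C \<Longrightarrow> dim_col A = dim_row B \<Longrightarrow>
    A * (B - C) = A * B - A * C"
  by (rule mult_minus_distrib_mat) auto

lemma minus_mult_dim:
  fixes A B C :: "'a::ring mat"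
  shows "dim_row A = dim_row B \<Longrightarrow> dim_col A = dim_col B \<Longrightarrow> dim_col A = dim_row C \<Longrightarrow>
    (A - B) * C = A * C - B * C"
  by (rule minus_mult_distrib_mat) auto

lemma one_mult_dim: "n = dim_row A \<Longrightarrow> 1\<^sub>m n * A = (A :: 'a::semiring_1 mat)"
  by simp

lemma mult_one_dim: "n = dim_col A \<Longrightarrow> A * 1\<^sub>m n = (A :: 'a::semiring_1 mat)"
  by simp

lemma transpose_minus_dim:
  fixes A B :: "'a::group_add mat"
  shows "dim_row A = dim_row B \<Longrightarrow> dim_col A = dim_col B \<Longrightarrow>
    transpose_mat (A - B) = transpose_mat A - transpose_mat B"
  by (rule eq_matI) auto

lemmas mat_simps = mult_assoc_dim transpose_mult_dim mult_add_dim add_mult_dim mult_minus_dim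
  minus_mult_dim one_mult_dim mult_one_dim transpose_minus_dim

declare assoc_mult_mat [simp del]

definition finner :: "real mat \<Rightarrow> real mat \<Rightarrow> real" where
  "finner A B = (\<Sum>i<dim_row A. \<Sum>j<dim_col A. A $$ (i, j) * B $$ (i, j))"

lemma frob_on_sq: "(frob_on \<Omega> A)\<^sup>2 = (\<Sum>k\<in>\<Omega>. (A $$ k)\<^sup>2)"
  by (simp add: frob_on_def L2_set_def sum_nonneg)

lemma frob_sq: "(frob A)\<^sup>2 = finner A A"
  unfolding frob_def frob_on_sq finner_def sum.cartesian_product
  by (intro sum.cong refl) (auto simp: power2_eq_square)

lemma frob_nonneg [simp]: "0 \<le> frob A"
  by (simp add: frob_def frob_on_def)

lemma frob_on_nonneg [simp]: "0 \<le> frob_on \<Omega> A"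
  by (simp add: frob_on_def)

lemma finner_commute:
  "dim_row A = dim_row B \<Longrightarrow> dim_col A = dim_col B \<Longrightarrow> finner A B = finner B A"
  by (simp add: finner_def mult.commute)

lemma finner_transpose:
  "dim_row A = dim_row B \<Longrightarrow> dim_col A = dim_col B \<Longrightarrow>
    finner (transpose_mat A) (transpose_mat B) = finner A B"
  unfolding finner_def by (subst sum.swap) simp

lemma frob_transpose [simp]: "frob (transpose_mat A) = frob A"
  using finner_transpose[of A A] by (metis frob_nonneg frob_sq power2_eq_imp_eq)

lemma index_mult_sum:
  fixes A B :: "real mat"
  shows "i < dim_row A \<Longrightarrow> j < dim_col B \<Longrightarrow> dim_col A = dim_row B \<Longrightarrow>
    (A * B) $$ (i, j) = (\<Sum>k<dim_row B. A $$ (i, k) * B $$ (k, j))"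
  by (simp add: scalar_prod_def atLeast0LessThan)

lemma finner_mult_left:
  assumes "dim_col M = dim_row A" "dim_row M = dim_row B" "dim_col A = dim_col B"
  shows "finner (M * A) B = finner A (transpose_mat M * B)"
proof -
  have "finner (M * A) B = (\<Sum>i<dim_row M. \<Sum>j<dim_col A. \<Sum>k<dim_row A. M $$ (i, k) * A $$ (k, j) * B $$ (i, j))"
    using assms by (simp add: finner_def index_mult_sum sum_distrib_right del: index_mult_mat(1))
  also have "\<dots> = (\<Sum>k<dim_row A. \<Sum>j<dim_col A. \<Sum>i<dim_row M. M $$ (i, k) * A $$ (k, j) * B $$ (i, j))"
    by (subst sum.swap, subst (2) sum.swap, subst sum.swap) simp
  also have "\<dots> = finner A (transpose_mat M * B)"
    using assms
    by (simp add: finner_def index_mult_sum sum_distrib_left mult_ac del: index_mult_mat(1))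
  finally show ?thesis .
qed

lemma finner_minus_right:
  "dim_row A = dim_row B \<Longrightarrow> dim_col A = dim_col B \<Longrightarrow> dim_row B = dim_row C \<Longrightarrow> dim_col B = dim_col C \<Longrightarrow>
    finner A (B - C) = finner A B - finner A C"
  by (simp add: finner_def algebra_simps sum_subtractf)

lemma finner_le:
  assumes "dim_row A = dim_row B" "dim_col A = dim_col B"
  shows "finner A B \<le> frob A * frob B"
proof -
  let ?G = "{..<dim_row A} \<times> {..<dim_col A}"
  have "finner A B = (\<Sum>k\<in>?G. A $$ k * B $$ k)"
    unfolding finner_def sum.cartesian_product by (intro sum.cong) auto
  also have "\<dots> \<le> (\<Sum>k\<in>?G. \<bar>A $$ k\<bar> * \<bar>B $$ k\<bar>)"
    by (intro sum_mono) (metis abs_ge_self abs_mult)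
  also have "\<dots> \<le> frob A * frob B"
    unfolding frob_def frob_on_def using assms L2_set_mult_ineq[of "\<lambda>k. A $$ k" "\<lambda>k. B $$ k" ?G] by simp
  finally show ?thesis .
qed

lemma frob_on_triangle:
  assumes "\<Omega> \<subseteq> {..<dim_row B} \<times> {..<dim_col B}"
  shows "frob_on \<Omega> (A + B) \<le> frob_on \<Omega> A + frob_on \<Omega> B"
proof -
  have "frob_on \<Omega> (A + B) = L2_set (\<lambda>k. A $$ k + B $$ k) \<Omega>"
    unfolding frob_on_def by (intro L2_set_cong refl) (use assms in auto)
  then show ?thesis unfolding frob_on_def by (simp add: L2_set_triangle_ineq)
qed

lemma frob_triangle:
  "dim_row A = dim_row B \<Longrightarrow> dim_col A = dim_col B \<Longrightarrow> frob (A + B) \<le> frob A + frob B"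
  unfolding frob_def using frob_on_triangle[of "{..<dim_row B} \<times> {..<dim_col B}" B A] by simp

lemma frob_on_cong:
  "(\<And>i j. (i, j) \<in> \<Omega> \<Longrightarrow> A $$ (i, j) = B $$ (i, j)) \<Longrightarrow> frob_on \<Omega> A = frob_on \<Omega> B"
  unfolding frob_on_def by (intro L2_set_cong) auto

lemma frob_minus_commute:
  assumes "dim_row A = dim_row B" "dim_col A = dim_col B"
  shows "frob (A - B) = frob (B - A)"
proof -
  have "(frob (A - B))\<^sup>2 = (frob (B - A))\<^sup>2"
    unfolding frob_sq finner_def using assms by (auto intro!: sum.cong simp: algebra_simps)
  then show ?thesis by (simp add: power2_eq_iff_nonneg)
qed

lemma frob_triangle_minus:
  assumes "dim_row A = dim_row B" "dim_col A = dim_col B"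
  shows "frob A \<le> frob B + frob (A - B)"
proof -
  have "A = B + (A - B)" using assms by (intro eq_matI) auto
  then show ?thesis using frob_triangle[of B "A - B"] assms by simp
qed

lemma frob_on_le_frob:
  assumes "\<Omega> \<subseteq> {..<dim_row A} \<times> {..<dim_col A}"
  shows "frob_on \<Omega> A \<le> frob A"
proof -
  have "(frob_on \<Omega> A)\<^sup>2 \<le> (frob A)\<^sup>2"
    unfolding frob_def frob_on_sq by (rule sum_mono2) (use assms in auto)
  then show ?thesis by simp
qed

lemma frob_zero_iff: "frob A = 0 \<longleftrightarrow> (\<forall>i<dim_row A. \<forall>j<dim_col A. A $$ (i, j) = 0)"
proof -
  have "frob A = 0 \<longleftrightarrow> finner A A = 0" by (simp flip: frob_sq)
  also have "\<dots> \<longleftrightarrow> (\<forall>i<dim_row A. \<forall>j<dim_col A. A $$ (i, j) = 0)"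
    unfolding finner_def by (subst sum_nonneg_eq_0_iff | force simp: sum_nonneg sum_nonneg_eq_0_iff)+
  finally show ?thesis .
qed

lemma frob_mult_le:
  assumes "dim_col A = dim_row B"
  shows "frob (A * B) \<le> frob A * frob B"
proof -
  have "(frob (A * B))\<^sup>2 = (\<Sum>i<dim_row A. \<Sum>j<dim_col B. (\<Sum>k<dim_row B. A $$ (i, k) * B $$ (k, j))\<^sup>2)"
    unfolding frob_sq finner_def using assms
    by (simp add: index_mult_sum power2_eq_square del: index_mult_mat(1))
  also have "\<dots> \<le> (\<Sum>i<dim_row A. \<Sum>j<dim_col B. (\<Sum>k<dim_row B. (A $$ (i, k))\<^sup>2) * (\<Sum>k<dim_row B. (B $$ (k, j))\<^sup>2))"
    by (intro sum_mono Cauchy_Schwarz_ineq_sum)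
  also have "\<dots> = (\<Sum>i<dim_row A. \<Sum>k<dim_row B. (A $$ (i, k))\<^sup>2) * (\<Sum>j<dim_col B. \<Sum>k<dim_row B. (B $$ (k, j))\<^sup>2)"
    by (simp add: sum_product)
  also have "(\<Sum>j<dim_col B. \<Sum>k<dim_row B. (B $$ (k, j))\<^sup>2) = (frob B)\<^sup>2"
    unfolding frob_sq finner_def by (subst sum.swap) (simp add: power2_eq_square)
  also have "(\<Sum>i<dim_row A. \<Sum>k<dim_row B. (A $$ (i, k))\<^sup>2) = (frob A)\<^sup>2"
    unfolding frob_sq finner_def using assms by (simp add: power2_eq_square)
  finally have "(frob (A * B))\<^sup>2 \<le> (frob A * frob B)\<^sup>2" by (simp add: power_mult_distrib)
  then show ?thesis by (rule power2_le_imp_le) simp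
qed

section \<open>Operator bounds expressed through the Frobenius norm\<close>

text \<open>For s >= 0 this says that the spectral norm is at most s: one-column X give the usual
  definition, and a general X follows column by column. Quantifying over matrices of any width keeps
  vectors and spectral theory out of the later estimates.\<close>

definition op_le :: "real mat \<Rightarrow> real \<Rightarrow> bool" where
  "op_le A s \<longleftrightarrow> (\<forall>X. dim_row X = dim_col A \<longrightarrow> frob (A * X) \<le> s * frob X)"

text \<open>For s > 0 this says that A is injective and stretches every vector by at least s, so the
  smallest singular value is at least s.\<close>

definition op_ge :: "real mat \<Rightarrow> real \<Rightarrow> bool" where
  "op_ge A s \<longleftrightarrow> (\<forall>X. dim_row X = dim_col A \<longrightarrow> s * frob X \<le> frob (A * X))"

lemma op_leD: "op_le A s \<Longrightarrow> dim_row X = dim_col A \<Longrightarrow> frob (A * X) \<le> s * frob X"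
  by (simp add: op_le_def)

lemma op_geD: "op_ge A s \<Longrightarrow> dim_row X = dim_col A \<Longrightarrow> s * frob X \<le> frob (A * X)"
  by (simp add: op_ge_def)

lemma le_of_mult_self_le:
  fixes x c :: real
  assumes "x * x \<le> c * x" "0 \<le> x" "0 \<le> c"
  shows "x \<le> c"
  using assms by (cases "x = 0") (auto simp: mult_le_cancel_right)

text \<open>Duality: |A^T X|^2 = <X, A A^T X> <= |X| s |A^T X|.\<close>

lemma op_le_transpose:
  assumes "op_le A s" and s: "0 \<le> s"
  shows "op_le (transpose_mat A) s"
  unfolding op_le_def
proof (intro allI impI)
  fix X :: "real mat" assume d: "dim_row X = dim_col (transpose_mat A)"
  let ?Y = "transpose_mat A * X"
  have "frob ?Y * frob ?Y = finner ?Y ?Y" using frob_sq[of ?Y] by (simp add: power2_eq_square)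
  also have "\<dots> = finner X (A * ?Y)" using d by (subst finner_mult_left) auto
  also have "\<dots> \<le> frob X * frob (A * ?Y)" using d by (intro finner_le) auto
  also have "\<dots> \<le> frob X * (s * frob ?Y)" using d by (intro mult_left_mono op_leD[OF assms(1)]) auto
  finally have "frob ?Y * frob ?Y \<le> (s * frob X) * frob ?Y" by (simp add: mult_ac)
  then show "frob ?Y \<le> s * frob X" by (rule le_of_mult_self_le) (use s in auto)
qed

lemma frob_mult_op_le:
  assumes "op_le B s" "0 \<le> s" "dim_col A = dim_row B"
  shows "frob (A * B) \<le> s * frob A"
proof -
  have "frob (A * B) = frob (transpose_mat B * transpose_mat A)"
    using frob_transpose[of "A * B"] assms by (simp add: transpose_mult_dim del: frob_transpose)
  also have "\<dots> \<le> s * frob (transpose_mat A)"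
    using assms by (intro op_leD op_le_transpose) auto
  finally show ?thesis by simp
qed

lemma inverse_of_injective:
  fixes A :: "real mat"
  assumes A: "A \<in> carrier_mat r r"
    and inj: "\<And>X. X \<in> carrier_mat r 1 \<Longrightarrow> frob (A * X) = 0 \<Longrightarrow> frob X = 0"
  obtains G where "G \<in> carrier_mat r r" "A * G = 1\<^sub>m r" "G * A = 1\<^sub>m r"
proof -
  have "det A \<noteq> 0"
  proof
    assume "det A = 0"
    then obtain v where v: "v \<in> carrier_vec r" "v \<noteq> 0\<^sub>v r" "A *\<^sub>v v = 0\<^sub>v r"
      using det_0_iff_vec_prod_zero_field[OF A] by auto
    define X where "X = mat r 1 (\<lambda>(i, j). v $ i)"
    have X: "X \<in> carrier_mat r 1" by (simp add: X_def)
    have "(A * X) $$ (i, 0) = (A *\<^sub>v v) $ i" if "i < r" for i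
      using A v(1) that by (simp add: X_def scalar_prod_def)
    then have "frob (A * X) = 0" unfolding frob_zero_iff using A X v(3) by auto
    then have "frob X = 0" using inj X by blast
    then have "v = 0\<^sub>v r" unfolding frob_zero_iff using v(1) by (intro eq_vecI) (auto simp: X_def)
    with v(2) show False by simp
  qed
  from det_non_zero_imp_unit[OF A this, of "()"]
  obtain G where G: "G * A = 1\<^sub>m r" "G \<in> carrier_mat r r"
    unfolding Units_def ring_mat_def by auto
  from that[OF G(2) mat_mult_left_right_inverse[OF G(2) A G(1)] G(1)] show ?thesis .
qed

lemma op_ge_inverse:
  assumes A: "A \<in> carrier_mat r r" and c: "0 < c" and ge: "op_ge A c"
  obtains G where "G \<in> carrier_mat r r" "A * G = 1\<^sub>m r" "G * A = 1\<^sub>m r" "op_le G (1 / c)"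
proof -
  obtain G where G: "G \<in> carrier_mat r r" "A * G = 1\<^sub>m r" "G * A = 1\<^sub>m r"
  proof (rule inverse_of_injective[OF A])
    fix X :: "real mat" assume X: "X \<in> carrier_mat r 1" "frob (A * X) = 0"
    have "c * frob X \<le> 0" using op_geD[OF ge, of X] X A by simp
    then show "frob X = 0" using c frob_nonneg[of X] by (metis linorder_not_le mult_pos_pos order_less_le)
  qed
  have "op_le G (1 / c)" unfolding op_le_def
  proof (intro allI impI)
    fix X :: "real mat" assume d: "dim_row X = dim_col G"
    have "c * frob (G * X) \<le> frob (A * (G * X))" using A G d by (intro op_geD[OF ge]) auto
    also have "A * (G * X) = X" using A G d by (simp add: mult_assoc_dim[symmetric])
    finally show "frob (G * X) \<le> 1 / c * frob X" using c by (simp add: field_simps)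
  qed
  with G that show ?thesis by blast
qed

text \<open>For a square matrix the lower bound is a norm bound 1 / c on the inverse, and norm
  bounds pass to transposes.\<close>

lemma op_ge_transpose:
  assumes A: "A \<in> carrier_mat r r" and c: "0 < c" and ge: "op_ge A c"
  shows "op_ge (transpose_mat A) c"
proof -
  obtain G where G: "G \<in> carrier_mat r r" "A * G = 1\<^sub>m r" "op_le G (1 / c)"
    using op_ge_inverse[OF A c ge] by metis
  have GA: "transpose_mat G * transpose_mat A = 1\<^sub>m r"
    using arg_cong[OF G(2), of transpose_mat] A G(1) by (simp add: transpose_mult_dim)
  show ?thesis unfolding op_ge_def
  proof (intro allI impI)
    fix X :: "real mat" assume d: "dim_row X = dim_col (transpose_mat A)"
    have "frob X = frob (transpose_mat G * (transpose_mat A * X))"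
      using A G d GA by (simp add: mult_assoc_dim[symmetric])
    also have "\<dots> \<le> 1 / c * frob (transpose_mat A * X)"
      using A G d c by (intro op_leD op_le_transpose) auto
    finally show "c * frob X \<le> frob (transpose_mat A * X)" using c by (simp add: field_simps)
  qed
qed

lemma frob_mult_sq:
  assumes "dim_col A = dim_row X"
  shows "(frob (A * X))\<^sup>2 = finner X ((transpose_mat A * A) * X)"
  unfolding frob_sq using assms by (subst finner_mult_left) (auto simp: mult_assoc_dim)

lemma gram_difference_le:
  assumes "dim_col U = r" "dim_col V = r" "dim_row W = r"
  shows "(frob (U * W))\<^sup>2 \<le> (frob (V * W))\<^sup>2 + frob (transpose_mat U * U - transpose_mat V * V) * (frob W)\<^sup>2"
proof -
  let ?D = "transpose_mat U * U - transpose_mat V * V"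
  have "(frob (U * W))\<^sup>2 - (frob (V * W))\<^sup>2 = finner W (?D * W)"
    using assms by (simp add: frob_mult_sq minus_mult_dim finner_minus_right)
  also have "\<dots> \<le> frob W * frob (?D * W)" using assms by (intro finner_le) auto
  also have "\<dots> \<le> frob W * (frob ?D * frob W)" using assms by (intro mult_left_mono frob_mult_le) auto
  finally show ?thesis by (simp add: power2_eq_square mult_ac)
qed

text \<open>The successive ratios of the moments \<open>|W|\<^sup>2\<close>, \<open>|V W|\<^sup>2\<close>, \<open>|B W|\<^sup>2\<close>, \<open>|V B W|\<^sup>2\<close> of the Gram
  matrix \<open>B = V\<^sup>T V\<close> increase, and the last one is controlled by the product \<open>U V\<^sup>T\<close>.\<close>
lemma balanced_factor_upper:
  assumes U: "U \<in> carrier_mat n1 r" and V: "V \<in> carrier_mat n2 r"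
    and s: "op_le (U * transpose_mat V) s" "0 \<le> s"
    and \<delta>: "frob (transpose_mat U * U - transpose_mat V * V) \<le> \<delta>"
    and W: "dim_row W = r"
  shows "(frob (V * W))\<^sup>2 \<le> (s + \<delta>) * (frob W)\<^sup>2"
proof -
  let ?B = "transpose_mat V * V"
  have [simp]: "dim_row U = n1" "dim_col U = r" "dim_row V = n2" "dim_col V = r" using U V by auto
  define m0 m1 m2 m3 where "m0 = (frob W)\<^sup>2" and "m1 = (frob (V * W))\<^sup>2"
    and "m2 = (frob (?B * W))\<^sup>2" and "m3 = (frob (V * (?B * W)))\<^sup>2"
  have \<delta>0: "0 \<le> \<delta>" using \<delta> frob_nonneg order_trans by blast
  have nn: "m0 \<ge> 0" "m1 \<ge> 0" "m2 \<ge> 0" "m3 \<ge> 0" by (simp_all add: m0_def m1_def m2_def m3_def)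
  have "m1 \<le> frob W * frob (?B * W)"
    unfolding m1_def frob_mult_sq[of V W, simplified, OF W[symmetric]] using W by (intro finner_le) auto
  from power_mono[OF this nn(2), of 2] have a: "m1\<^sup>2 \<le> m0 * m2"
    by (simp add: m0_def m2_def power_mult_distrib)
  have "m2 = finner (V * W) (V * (?B * W))"
    unfolding m2_def frob_sq using W by (simp add: mult_assoc_dim finner_mult_left)
  also have "\<dots> \<le> frob (V * W) * frob (V * (?B * W))" using W by (intro finner_le) auto
  finally have "m2 \<le> frob (V * W) * frob (V * (?B * W))" .
  from power_mono[OF this nn(3), of 2] have b: "m2\<^sup>2 \<le> m1 * m3"
    by (simp add: m1_def m3_def power_mult_distrib)
  have "frob (U * (?B * W)) \<le> s * frob (V * W)"
    using op_leD[OF s(1), of "V * W"] W by (simp add: mult_assoc_dim)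
  from power_mono[OF this frob_nonneg, of 2] have "(frob (U * (?B * W)))\<^sup>2 \<le> s\<^sup>2 * m1"
    by (simp add: m1_def power_mult_distrib)
  moreover have "m3 \<le> (frob (U * (?B * W)))\<^sup>2 + \<delta> * m2"
  proof -
    have "frob (?B - transpose_mat U * U) \<le> \<delta>" using \<delta> by (subst frob_minus_commute) auto
    then have "frob (?B - transpose_mat U * U) * m2 \<le> \<delta> * m2" using nn by (intro mult_right_mono)
    then show ?thesis
      using gram_difference_le[of V r U "?B * W"] W unfolding m3_def m2_def by simp
  qed
  ultimately have c: "m3 \<le> s\<^sup>2 * m1 + \<delta> * m2" by simp
  have "m1 \<le> (s + \<delta>) * m0"
  proof (cases "m1 = 0")
    case True
    then show ?thesis using nn s \<delta>0 by simp
  next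
    case False
    then have m1: "m1 > 0" using nn by simp
    have "m2\<^sup>2 \<le> s\<^sup>2 * m1\<^sup>2 + \<delta> * m2 * m1"
      using b mult_left_mono[OF c nn(2)] by (simp add: algebra_simps power2_eq_square)
    \<comment> \<open>The ratio x = m2 / m1 satisfies x^2 <= s^2 + delta x, which forces x <= s +
      delta. Since m1 / m0 <= m2 / m1, this suffices.\<close>
    then have d: "m2 \<le> (s + \<delta>) * m1"
    proof -
      show ?thesis
      proof (rule ccontr)
        assume "\<not> m2 \<le> (s + \<delta>) * m1"
        then have g: "m2 > (s + \<delta>) * m1" by simp
        have "0 \<le> s * m1" "0 \<le> \<delta> * m1" using s \<delta>0 m1 by auto
        then have g2: "s * m1 < m2 - \<delta> * m1" "s * m1 < m2" using g by (auto simp: algebra_simps)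
        have "(s * m1) * (s * m1) < m2 * (m2 - \<delta> * m1)"
          using g2 \<open>0 \<le> s * m1\<close> by (intro mult_strict_mono) auto
        with \<open>m2\<^sup>2 \<le> s\<^sup>2 * m1\<^sup>2 + \<delta> * m2 * m1\<close> show False
          by (simp add: power2_eq_square algebra_simps)
      qed
    qed
    have "m1 * m1 \<le> ((s + \<delta>) * m0) * m1"
      using a mult_left_mono[OF d nn(1)] by (simp add: power2_eq_square algebra_simps)
    then show ?thesis using m1 by simp
  qed
  then show ?thesis by (simp add: m1_def m0_def)
qed

section \<open>Factorizations close to the target\<close>

lemma frob_orth_mult:
  assumes "transpose_mat Q * Q = 1\<^sub>m r" "dim_row X = r" "dim_col Q = r"
  shows "frob (Q * X) = frob X"
proof -
  have "(frob (Q * X))\<^sup>2 = finner X X" using assms by (simp add: frob_mult_sq)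
  also have "\<dots> = (frob X)\<^sup>2" by (simp add: frob_sq)
  finally have "(frob (Q * X))\<^sup>2 = (frob X)\<^sup>2" .
  then show ?thesis by (simp add: power2_eq_iff_nonneg)
qed

lemma op_le_orth: "transpose_mat Q * Q = 1\<^sub>m r \<Longrightarrow> dim_col Q = r \<Longrightarrow> op_le Q 1"
  by (simp add: op_le_def frob_orth_mult)

lemma op_le_mult:
  assumes "op_le A s" "op_le B t" "0 \<le> s" "dim_col A = dim_row B"
  shows "op_le (A * B) (s * t)"
  unfolding op_le_def
proof (intro allI impI)
  fix X :: "real mat" assume d: "dim_row X = dim_col (A * B)"
  have "frob (A * B * X) = frob (A * (B * X))" using assms(4) d by (simp add: mult_assoc_dim)
  also have "\<dots> \<le> s * frob (B * X)" using assms d by (intro op_leD) auto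
  also have "\<dots> \<le> s * (t * frob X)" using assms d by (intro mult_left_mono op_leD) auto
  finally show "frob (A * B * X) \<le> s * t * frob X" by simp
qed

lemma frob_minus_projection_le:
  assumes P: "P \<in> carrier_mat n n" "transpose_mat P = P" "P * P = P" and F: "dim_col F = n"
  shows "frob (F - F * P) \<le> frob F"
proof -
  have [simp]: "dim_row P = n" "dim_col P = n" using P by auto
  let ?F = "transpose_mat F" and ?Y = "P * transpose_mat F"
  have FP: "frob (F - F * P) = frob (?F - ?Y)"
    using frob_transpose[of "F - F * P"] F P(2)
    by (simp add: transpose_minus_dim transpose_mult_dim del: frob_transpose)
  have sym: "finner ?F ?Y = finner ?Y ?Y"
  proof -
    have "finner ?Y ?Y = finner ?F (P * (P * ?F))"
      using F P by (subst finner_mult_left) auto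
    then show ?thesis using F P(3) by (simp add: mult_assoc_dim[symmetric])
  qed
  have c: "finner ?Y ?F = finner ?F ?Y" using F by (intro finner_commute) auto
  have "(frob (?F - ?Y))\<^sup>2 = finner (?F - ?Y) ?F - finner (?F - ?Y) ?Y"
    unfolding frob_sq using F by (intro finner_minus_right) auto
  also have "finner (?F - ?Y) ?F = finner ?F ?F - finner ?F ?Y"
    using F finner_minus_right[of ?F ?F ?Y] finner_commute[of "?F - ?Y" ?F] by simp
  also have "finner (?F - ?Y) ?Y = finner ?F ?Y - finner ?Y ?Y"
    using F finner_minus_right[of ?Y ?F ?Y] finner_commute[of "?F - ?Y" ?Y] c by simp
  finally have "(frob (?F - ?Y))\<^sup>2 = (frob ?F)\<^sup>2 - (frob ?Y)\<^sup>2" using sym by (simp only: frob_sq)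
  then have "(frob (?F - ?Y))\<^sup>2 \<le> (frob ?F)\<^sup>2" by simp
  then show ?thesis unfolding FP by simp
qed

text \<open>V G is the transposed pseudo-inverse of V. Its norm bound 1 / b, rather than the 1 / b^2
  known for G, comes from |V G X|^2 = <G X, X> and b |G X| <= |V G X|.\<close>

lemma pseudo_inverse:
  assumes V: "V \<in> carrier_mat n r" and b: "0 < b" and lo: "op_ge V b"
  obtains G where "G \<in> carrier_mat r r" "(transpose_mat V * V) * G = 1\<^sub>m r"
    "G * (transpose_mat V * V) = 1\<^sub>m r" "transpose_mat G = G" "op_le (V * G) (1 / b)"
proof -
  let ?B = "transpose_mat V * V"
  have [simp]: "dim_row V = n" "dim_col V = r" using V by auto
  have B: "?B \<in> carrier_mat r r" by auto
  have "op_ge ?B (b\<^sup>2)" unfolding op_ge_def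
  proof (intro allI impI)
    fix X :: "real mat" assume d: "dim_row X = dim_col ?B"
    have "b * frob X \<le> frob (V * X)" using d by (intro op_geD[OF lo]) auto
    then have "(b * frob X)\<^sup>2 \<le> (frob (V * X))\<^sup>2" using b by (intro power_mono) auto
    also have "\<dots> = finner X (?B * X)" using d by (simp add: frob_mult_sq)
    also have "\<dots> \<le> frob X * frob (?B * X)" using d by (intro finner_le) auto
    finally have *: "(b\<^sup>2 * frob X) * frob X \<le> frob (?B * X) * frob X"
      by (simp add: power2_eq_square mult_ac)
    then show "b\<^sup>2 * frob X \<le> frob (?B * X)"
      using frob_nonneg[of X] by (cases "frob X = 0") auto
  qed
  then obtain G where G: "G \<in> carrier_mat r r" "?B * G = 1\<^sub>m r" "G * ?B = 1\<^sub>m r"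
    using op_ge_inverse[OF B] b by (metis zero_less_power)
  have [simp]: "dim_row G = r" "dim_col G = r" using G(1) by auto
  have "transpose_mat G * ?B = 1\<^sub>m r"
    using arg_cong[OF G(2), of transpose_mat] by (simp add: transpose_mult_dim)
  then have "transpose_mat G * ?B * G = G" by simp
  moreover have "transpose_mat G * ?B * G = transpose_mat G"
    using G(2) by (subst mult_assoc_dim) auto
  ultimately have sym: "transpose_mat G = G" by simp
  have "op_le (V * G) (1 / b)" unfolding op_le_def
  proof (intro allI impI)
    fix X :: "real mat" assume d: "dim_row X = dim_col (V * G)"
    let ?Y = "V * (G * X)"
    have lo': "b * frob (G * X) \<le> frob ?Y" using d by (intro op_geD[OF lo]) auto
    have BGX: "?B * (G * X) = X" using d G(2) by (simp add: mult_assoc_dim[symmetric])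
    have "(frob ?Y)\<^sup>2 = finner (G * X) X" using d BGX by (subst frob_mult_sq) auto
    also have "\<dots> \<le> frob (G * X) * frob X" using d by (intro finner_le) auto
    finally have "b * (frob ?Y)\<^sup>2 \<le> b * frob (G * X) * frob X" using b by (simp add: mult.assoc)
    also have "\<dots> \<le> frob ?Y * frob X" using lo' by (intro mult_right_mono) auto
    finally have "frob ?Y * frob ?Y \<le> (1 / b * frob X) * frob ?Y"
      using b by (simp add: field_simps power2_eq_square)
    then have "frob ?Y \<le> 1 / b * frob X" by (rule le_of_mult_self_le) (use b in auto)
    then show "frob (V * G * X) \<le> 1 / b * frob X" using d by (simp add: mult_assoc_dim)
  qed
  with G sym that show ?thesis by blast
qed

locale factored_target =
  fixes n1 n2 r :: nat and Us S Vs Xs :: "real mat" and s1 sr :: real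
  assumes Us: "Us \<in> carrier_mat n1 r" and S: "S \<in> carrier_mat r r" and Vs: "Vs \<in> carrier_mat n2 r"
    and UU: "transpose_mat Us * Us = 1\<^sub>m r" and VV: "transpose_mat Vs * Vs = 1\<^sub>m r"
    and Xs: "Xs = Us * S * transpose_mat Vs"
    and S_le: "op_le S s1" and S_ge: "op_ge S sr" and sr: "0 < sr" and sr_le: "sr \<le> s1"
begin

lemma dims [simp]: "dim_row Us = n1" "dim_col Us = r" "dim_row S = r" "dim_col S = r"
  "dim_row Vs = n2" "dim_col Vs = r" "dim_row Xs = n1" "dim_col Xs = n2"
  using Us S Vs by (auto simp: Xs)

lemma Xs_le: "op_le Xs s1"
proof -
  have "op_le (Us * S * transpose_mat Vs) (1 * s1 * 1)"
    using sr sr_le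
    by (intro op_le_mult op_le_transpose op_le_orth[OF UU] op_le_orth[OF VV] S_le) auto
  then show ?thesis by (simp add: Xs)
qed

lemma UU_mult: "dim_row X = r \<Longrightarrow> transpose_mat Us * (Us * X) = X"
  using UU by (simp add: mult_assoc_dim[symmetric])

lemma VV_mult: "dim_row X = r \<Longrightarrow> transpose_mat Vs * (Vs * X) = X"
  using VV by (simp add: mult_assoc_dim[symmetric])

text \<open>Compression to the singular spaces turns Xs into S, so the compressed product is S
  perturbed by at most the error. The compression is square and can be inverted.\<close>

lemma core_ge:
  assumes U: "U \<in> carrier_mat n1 r" and V: "V \<in> carrier_mat n2 r"
  shows "op_ge (transpose_mat Us * (U * transpose_mat V) * Vs) (sr - frob (U * transpose_mat V - Xs))"
  unfolding op_ge_def
proof (intro allI impI)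
  have [simp]: "dim_row U = n1" "dim_col U = r" "dim_row V = n2" "dim_col V = r" using U V by auto
  let ?J = "transpose_mat Us * (U * transpose_mat V) * Vs" and ?F = "U * transpose_mat V - Xs"
  fix X :: "real mat" assume d: "dim_row X = dim_col ?J"
  then have [simp]: "dim_row X = r" by simp
  have "?J * X - S * X = transpose_mat Us * (?F * (Vs * X))"
    unfolding Xs by (simp add: mult_assoc_dim minus_mult_dim mult_minus_dim UU_mult VV_mult)
  then have "frob (S * X - ?J * X) = frob (transpose_mat Us * (?F * (Vs * X)))"
    by (subst frob_minus_commute) auto
  also have "\<dots> \<le> 1 * frob (?F * (Vs * X))"
    by (intro op_leD op_le_transpose op_le_orth[OF UU]) auto
  also have "\<dots> \<le> 1 * (frob ?F * frob (Vs * X))" by (intro mult_left_mono frob_mult_le) auto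
  also have "frob (Vs * X) = frob X" by (rule frob_orth_mult[OF VV]) auto
  finally have "frob (S * X - ?J * X) \<le> frob ?F * frob X" by simp
  moreover have "sr * frob X \<le> frob (S * X)" by (intro op_geD[OF S_ge]) auto
  moreover have "frob (S * X) \<le> frob (?J * X) + frob (S * X - ?J * X)"
    by (intro frob_triangle_minus) auto
  ultimately show "(sr - frob ?F) * frob X \<le> frob (?J * X)" by (simp add: algebra_simps)
qed

text \<open>Stands in for a Weyl inequality on the r-th singular value of U V^T. Write W = V^T Y
  with Y in the range of V, so that |W|^2 = <V W, Y> and U W = U V^T Y. It remains to show a |Y| <=
  |U V^T Y|: Y is also V U^T Us A for some A, so |Y|^2 <= |A| |U W|, while the compression bound
  gives a |A| <= |Vs^T Y| <= |Y|.\<close>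

lemma factor_lower:
  assumes U: "U \<in> carrier_mat n1 r" and V: "V \<in> carrier_mat n2 r"
    and e: "frob (U * transpose_mat V - Xs) < sr" and W: "dim_row W = r"
  shows "(sr - frob (U * transpose_mat V - Xs)) * (frob W)\<^sup>2 \<le> frob (U * W) * frob (V * W)"
proof -
  have [simp]: "dim_row U = n1" "dim_col U = r" "dim_row V = n2" "dim_col V = r" "dim_row W = r"
    using U V W by auto
  define a where "a = sr - frob (U * transpose_mat V - Xs)"
  have a: "a > 0" using e by (simp add: a_def)
  define J where "J = transpose_mat Us * (U * transpose_mat V) * Vs"
  define P where "P = transpose_mat Us * U"
  define Q where "Q = transpose_mat Vs * V"
  have J: "J \<in> carrier_mat r r" and P: "P \<in> carrier_mat r r" and Q: "Q \<in> carrier_mat r r"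
    by (auto simp: J_def P_def Q_def)
  have [simp]: "dim_row J = r" "dim_col J = r" "dim_row P = r" "dim_col P = r" "dim_row Q = r" "dim_col Q = r"
    using J P Q by auto
  have Jge: "op_ge J a" unfolding J_def a_def by (rule core_ge[OF U V])
  have JPQ: "J = P * transpose_mat Q" by (simp add: J_def P_def Q_def mult_assoc_dim transpose_mult_dim)
  obtain Ji where Ji: "Ji \<in> carrier_mat r r" "J * Ji = 1\<^sub>m r" "Ji * J = 1\<^sub>m r"
    using op_ge_inverse[OF J a Jge] by metis
  have [simp]: "dim_row Ji = r" "dim_col Ji = r" using Ji by auto
  define Pi where "Pi = transpose_mat Q * Ji"
  have Pi: "Pi \<in> carrier_mat r r" by (auto simp: Pi_def)
  have [simp]: "dim_row Pi = r" "dim_col Pi = r" using Pi by auto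
  have "P * Pi = 1\<^sub>m r" using Ji(2) by (simp add: Pi_def JPQ mult_assoc_dim)
  then have "Pi * P = 1\<^sub>m r" by (rule mat_mult_left_right_inverse[OF P Pi])
  from arg_cong[OF this, of transpose_mat]
  have PPi: "transpose_mat P * transpose_mat Pi = 1\<^sub>m r" by (simp add: transpose_mult_dim)
  have QV: "frob (Q * X) \<le> frob (V * X)" if "dim_row X = r" for X
    using op_leD[OF op_le_transpose[OF op_le_orth[OF VV]], of "V * X"] that
    by (simp add: Q_def mult_assoc_dim)
  let ?B = "transpose_mat V * V"
  obtain G where G: "G \<in> carrier_mat r r" "?B * G = 1\<^sub>m r"
  proof (rule inverse_of_injective[of ?B r])
    fix X :: "real mat" assume X: "X \<in> carrier_mat r 1" "frob (?B * X) = 0"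
    have "(frob (V * X))\<^sup>2 \<le> frob X * frob (?B * X)"
      using X(1) by (subst frob_mult_sq) (auto intro!: finner_le)
    then have "frob (V * X) = 0" using X(2) by simp
    then have QX: "frob (Q * X) = 0" using QV[of X] X(1) by (simp add: order_antisym)
    have "transpose_mat Q * (Ji * P) = 1\<^sub>m r"
    proof (rule mat_mult_left_right_inverse[of "Ji * P"])
      show "Ji * P * transpose_mat Q = 1\<^sub>m r" using Ji(3) by (simp add: JPQ mult_assoc_dim)
    qed auto
    from arg_cong[OF this, of transpose_mat]
    have "transpose_mat (Ji * P) * Q = 1\<^sub>m r" by (simp add: transpose_mult_dim mult_assoc_dim)
    then have "X = transpose_mat (Ji * P) * (Q * X)" using X(1) by (simp add: mult_assoc_dim[symmetric])
    then have "frob X \<le> frob (transpose_mat (Ji * P)) * frob (Q * X)"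
      using frob_mult_le[of "transpose_mat (Ji * P)" "Q * X"] X(1) by simp
    then show "frob X = 0" using QX by (simp add: order_antisym)
  qed auto
  have [simp]: "dim_row G = r" "dim_col G = r" using G by auto
  define X where "X = G * W"
  have [simp]: "dim_row X = r" by (simp add: X_def)
  have BX: "?B * X = W" using G(2) by (simp add: X_def mult_assoc_dim[symmetric])
  define A where "A = transpose_mat Pi * X"
  have [simp]: "dim_row A = r" "dim_col X = dim_col W" "dim_col A = dim_col W"
    by (simp_all add: A_def X_def)
  define Y where "Y = V * X"
  have [simp]: "dim_row Y = n2" "dim_col Y = dim_col W" by (simp_all add: Y_def)
  have PA: "transpose_mat P * A = X" using PPi by (simp add: A_def mult_assoc_dim[symmetric])
  have YA: "Y = V * (transpose_mat U * (Us * A))"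
    unfolding Y_def PA[symmetric] by (simp add: P_def transpose_mult_dim mult_assoc_dim)
  have YW: "U * W = U * (transpose_mat V * Y)" unfolding Y_def BX[symmetric] by (simp add: mult_assoc_dim)
  have "a * frob A \<le> frob (transpose_mat J * A)"
    by (rule op_geD[OF op_ge_transpose[OF J a Jge]]) simp
  also have "transpose_mat J * A = transpose_mat Vs * Y"
    unfolding YA J_def by (simp add: transpose_mult_dim mult_assoc_dim)
  also have "frob \<dots> \<le> 1 * frob Y"
    by (intro op_leD op_le_transpose op_le_orth[OF VV]) auto
  finally have aA: "a * frob A \<le> frob Y" by simp
  have "frob Y * frob Y = finner Y Y" using frob_sq[of Y] by (simp add: power2_eq_square)
  also have "\<dots> = finner (Us * A) (U * W)"
    unfolding YW by (subst (1) YA, subst finner_mult_left, simp_all add: finner_mult_left)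
  also have "\<dots> \<le> frob (Us * A) * frob (U * W)" by (intro finner_le) auto
  also have "frob (Us * A) = frob A" by (rule frob_orth_mult[OF UU]) auto
  finally have "a * (frob Y * frob Y) \<le> a * (frob A * frob (U * W))" using a by simp
  also have "\<dots> = a * frob A * frob (U * W)" by simp
  also have "\<dots> \<le> frob Y * frob (U * W)" by (intro mult_right_mono aA) auto
  finally have "a * frob Y \<le> frob (U * W)"
    using frob_nonneg[of Y] by (cases "frob Y = 0") (auto simp: mult_ac)
  moreover have "(frob W)\<^sup>2 \<le> frob (V * W) * frob Y"
  proof -
    have "(frob W)\<^sup>2 = finner W (?B * X)" by (simp add: frob_sq BX)
    also have "\<dots> = finner (V * W) Y" unfolding Y_def
      by (subst finner_mult_left) (auto simp: mult_assoc_dim)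
    also have "\<dots> \<le> frob (V * W) * frob Y" by (intro finner_le) auto
    finally show ?thesis .
  qed
  then have "a * (frob W)\<^sup>2 \<le> a * (frob (V * W) * frob Y)" using a by simp
  ultimately have "a * (frob W)\<^sup>2 \<le> frob (V * W) * frob (U * W)"
    by (smt (verit, best) frob_nonneg mult.left_commute mult_left_mono)
  then show ?thesis by (simp add: a_def mult.commute)
qed

end

context factored_target
begin

text \<open>Near balance makes |U W| and |V W| comparable, so the bounds on their product and on U
  V^T yield two-sided bounds on each factor.\<close>

lemma factor_bounds:
  assumes U: "U \<in> carrier_mat n1 r" and V: "V \<in> carrier_mat n2 r"
    and e: "frob (U * transpose_mat V - Xs) \<le> sr / 100"
    and bal: "frob (transpose_mat U * U - transpose_mat V * V) \<le> sr / 10"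
  shows "op_ge U (94/100 * sqrt sr)" "op_ge V (94/100 * sqrt sr)"
    "op_le U (11/10 * sqrt s1)" "op_le V (11/10 * sqrt s1)"
proof -
  have [simp]: "dim_row U = n1" "dim_col U = r" "dim_row V = n2" "dim_col V = r" using U V by auto
  let ?X = "U * transpose_mat V"
  let ?D = "transpose_mat U * U - transpose_mat V * V" and ?D' = "transpose_mat V * V - transpose_mat U * U"
  have bal': "frob ?D' \<le> sr / 10" using bal by (subst frob_minus_commute) auto
  \<comment> \<open>If y were below 9/10 sr w, then x'^2 <= sr w and the squared product would be at
    most 9/10 (sr w)^2, against (99/100)^2 = 0.9801.\<close>
  have low: "9/10 * sr * w \<le> y"
    if "99/100 * sr * w \<le> x' * y'" "x'\<^sup>2 \<le> y + sr / 10 * w" "y'\<^sup>2 = y" "w \<ge> 0" "x' \<ge> 0" "y' \<ge> 0"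
    for w x' y' y
  proof (rule ccontr)
    assume "\<not> 9/10 * sr * w \<le> y"
    then have y: "y < 9/10 * sr * w" by simp
    have y0: "y \<ge> 0" using that(3) by (metis zero_le_power2)
    have "(99/100 * sr * w)\<^sup>2 \<le> (x' * y')\<^sup>2" using that sr by (intro power_mono) auto
    also have "\<dots> = x'\<^sup>2 * y" by (simp add: power_mult_distrib that(3))
    also have "\<dots> \<le> (sr * w) * y" using that(2) y y0 by (intro mult_right_mono) auto
    also have "\<dots> \<le> (sr * w) * (9/10 * sr * w)" using y that(4) sr by (intro mult_left_mono) auto
    also have "\<dots> = 9/10 * (sr * w)\<^sup>2" by (simp add: power2_eq_square)
    moreover have "(99/100 * sr * w)\<^sup>2 = 9801/10000 * (sr * w)\<^sup>2" by (simp add: power2_eq_square)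
    ultimately have "(sr * w)\<^sup>2 \<le> 0" by linarith
    then have "sr * w = 0" by simp
    with y y0 show False by simp
  qed
  have sq: "94/100 * sqrt sr * w \<le> y" if "9/10 * sr * w\<^sup>2 \<le> y\<^sup>2" "y \<ge> 0" for w y
  proof (rule power2_le_imp_le[OF _ that(2)])
    have "(94/100 * sqrt sr * w)\<^sup>2 = 8836/10000 * sr * w\<^sup>2"
      using sr by (simp add: power_mult_distrib power2_eq_square)
    also have "\<dots> \<le> 9/10 * sr * w\<^sup>2" using sr by (intro mult_right_mono) auto
    finally show "(94/100 * sqrt sr * w)\<^sup>2 \<le> y\<^sup>2" using that by simp
  qed
  have base: "99/100 * sr * (frob W)\<^sup>2 \<le> frob (U * W) * frob (V * W)"
      "(frob (U * W))\<^sup>2 \<le> (frob (V * W))\<^sup>2 + sr / 10 * (frob W)\<^sup>2"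
      "(frob (V * W))\<^sup>2 \<le> (frob (U * W))\<^sup>2 + sr / 10 * (frob W)\<^sup>2" if W: "dim_row W = r" for W
  proof -
    have "99/100 * sr * (frob W)\<^sup>2 \<le> (sr - frob (?X - Xs)) * (frob W)\<^sup>2"
      using e by (intro mult_right_mono) auto
    also have "\<dots> \<le> frob (U * W) * frob (V * W)"
      by (rule factor_lower[OF U V _ W]) (use e sr in linarith)
    finally show "99/100 * sr * (frob W)\<^sup>2 \<le> frob (U * W) * frob (V * W)" .
    show "(frob (U * W))\<^sup>2 \<le> (frob (V * W))\<^sup>2 + sr / 10 * (frob W)\<^sup>2"
      using gram_difference_le[of U r V W] W mult_right_mono[OF bal, of "(frob W)\<^sup>2"] by simp
    show "(frob (V * W))\<^sup>2 \<le> (frob (U * W))\<^sup>2 + sr / 10 * (frob W)\<^sup>2"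
      using gram_difference_le[of V r U W] W mult_right_mono[OF bal', of "(frob W)\<^sup>2"] by simp
  qed
  show "op_ge V (94/100 * sqrt sr)" unfolding op_ge_def
    by (intro allI impI sq frob_nonneg low[OF base(1,2)]) auto
  have base': "99/100 * sr * (frob W)\<^sup>2 \<le> frob (V * W) * frob (U * W)" if "dim_row W = r" for W
    using base(1)[OF that] by (simp add: mult.commute)
  show "op_ge U (94/100 * sqrt sr)" unfolding op_ge_def
    by (intro allI impI sq frob_nonneg low[OF base' base(3)]) auto
  have opX: "op_le ?X (s1 + sr / 100)" unfolding op_le_def
  proof (intro allI impI)
    fix Y :: "real mat" assume d: "dim_row Y = dim_col ?X"
    have "?X * Y - Xs * Y = (?X - Xs) * Y" using d by (simp add: minus_mult_dim)
    then have "frob (?X * Y) \<le> frob (Xs * Y) + frob ((?X - Xs) * Y)"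
      using frob_triangle_minus[of "?X * Y" "Xs * Y"] by simp
    also have "\<dots> \<le> s1 * frob Y + frob (?X - Xs) * frob Y"
      using d by (intro add_mono op_leD[OF Xs_le] frob_mult_le) auto
    also have "\<dots> \<le> s1 * frob Y + sr / 100 * frob Y" by (intro add_left_mono mult_right_mono e) simp
    finally show "frob (?X * Y) \<le> (s1 + sr / 100) * frob Y" by (simp add: algebra_simps)
  qed
  have sq': "y \<le> 11/10 * sqrt s1 * w" if "y\<^sup>2 \<le> (s1 + sr / 100 + sr / 10) * w\<^sup>2" "w \<ge> 0" for w y
  proof (rule power2_le_imp_le)
    have "(s1 + sr / 100 + sr / 10) * w\<^sup>2 \<le> 121/100 * s1 * w\<^sup>2"
      using sr sr_le by (intro mult_right_mono) auto
    also have "\<dots> = (11/10 * sqrt s1 * w)\<^sup>2"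
      using sr sr_le by (simp add: power_mult_distrib power2_eq_square)
    finally show "y\<^sup>2 \<le> (11/10 * sqrt s1 * w)\<^sup>2" using that by simp
  qed (use that sr sr_le in auto)
  have s0: "0 \<le> s1 + sr / 100" using sr sr_le by simp
  show "op_le V (11/10 * sqrt s1)" unfolding op_le_def
    by (intro allI impI sq' frob_nonneg balanced_factor_upper[OF U V opX s0 bal]) auto
  have opX': "op_le (V * transpose_mat U) (s1 + sr / 100)"
    using op_le_transpose[OF opX s0] by (simp add: transpose_mult_dim)
  show "op_le U (11/10 * sqrt s1)" unfolding op_le_def
    by (intro allI impI sq' frob_nonneg balanced_factor_upper[OF V U opX' s0 bal']) auto
qed

text \<open>Two least-squares steps: \<open>Ub\<close> fits \<open>Xs\<close> given \<open>V\<close>, and \<open>Vb\<close> fits \<open>Xs\<close> given \<open>Ub\<close>, which is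
  exact because the columns of \<open>Ub\<close> span those of \<open>Xs\<close>. No orthogonal alignment is needed.\<close>
lemma aligned_factor:
  assumes U: "U \<in> carrier_mat n1 r" and V: "V \<in> carrier_mat n2 r"
    and e: "frob (U * transpose_mat V - Xs) \<le> sr / 100"
    and bal: "frob (transpose_mat U * U - transpose_mat V * V) \<le> sr / 10"
  obtains R R' where "R \<in> carrier_mat r r" "R' \<in> carrier_mat r r"
    "(Us * R) * transpose_mat (Vs * R') = Xs"
    "(frob (Us * R - U))\<^sup>2 + (frob (Vs * R' - V))\<^sup>2 \<le> 5/2 * (frob (U * transpose_mat V - Xs))\<^sup>2 / sr"
    "op_le R (sqrt (3 * s1))" "op_le R' (sqrt (3 * s1))"
proof -
  have [simp]: "dim_row U = n1" "dim_col U = r" "dim_row V = n2" "dim_col V = r" using U V by auto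
  define F where "F = U * transpose_mat V - Xs"
  have [simp]: "dim_row F = n1" "dim_col F = n2" by (auto simp: F_def)
  note bounds = factor_bounds[OF U V e bal]
  define q where "q = sqrt sr"
  have q: "q > 0" "q\<^sup>2 = sr" using sr by (auto simp: q_def)
  have qs: "q \<le> sqrt s1" using sr_le by (simp add: q_def)
  have Fe: "frob F \<le> q\<^sup>2 / 100" using e by (simp add: F_def q)
  obtain G where G: "G \<in> carrier_mat r r" "(transpose_mat V * V) * G = 1\<^sub>m r"
    "G * (transpose_mat V * V) = 1\<^sub>m r" "transpose_mat G = G" "op_le (V * G) (1 / (94/100 * q))"
    using pseudo_inverse[OF V _ bounds(2)] q unfolding q_def by (metis q_def divide_pos_pos mult_pos_pos zero_less_numeral)
  have [simp]: "dim_row G = r" "dim_col G = r" using G by auto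
  define R where "R = S * (transpose_mat Vs * (V * G))"
  have R: "R \<in> carrier_mat r r" by (auto simp: R_def)
  have [simp]: "dim_row R = r" "dim_col R = r" using R by auto
  define Ub where "Ub = Us * R"
  have Ub: "Ub \<in> carrier_mat n1 r" by (auto simp: Ub_def)
  have [simp]: "dim_row Ub = n1" "dim_col Ub = r" using Ub by auto
  have UbX: "Ub = Xs * (V * G)" by (simp add: Ub_def R_def Xs mult_assoc_dim)
  have VVG: "transpose_mat V * (V * G) = 1\<^sub>m r" using G(2) by (simp add: mult_assoc_dim)
  have "F * (V * G) = U - Ub"
    unfolding F_def by (simp add: minus_mult_dim mult_assoc_dim VVG UbX)
  moreover have "frob (F * (V * G)) \<le> 1 / (94/100 * q) * frob F"
    using q by (intro frob_mult_op_le[OF G(5)]) auto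
  ultimately have dU: "frob (Ub - U) \<le> frob F / (94/100 * q)"
    by (subst frob_minus_commute) auto
  have "frob F / (94/100 * q) \<le> (q\<^sup>2 / 100) / (94/100 * q)" using Fe q by (intro divide_right_mono) auto
  also have "\<dots> \<le> 2/100 * q" using q(1) by (simp add: power2_eq_square field_simps)
  finally have dU': "frob (Ub - U) \<le> 2/100 * q" using dU by simp
  have Ub_ge: "op_ge Ub (9/10 * q)" unfolding op_ge_def
  proof (intro allI impI)
    fix W :: "real mat" assume d: "dim_row W = dim_col Ub"
    have "94/100 * q * frob W \<le> frob (U * W)" unfolding q_def using d by (intro op_geD[OF bounds(1)]) auto
    also have "\<dots> \<le> frob (Ub * W) + frob ((U - Ub) * W)"
      using frob_triangle_minus[of "U * W" "Ub * W"] d by (simp add: minus_mult_dim)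
    also have "frob ((U - Ub) * W) \<le> frob (U - Ub) * frob W" using d by (intro frob_mult_le) auto
    also have "frob (U - Ub) = frob (Ub - U)" by (rule frob_minus_commute) auto
    also have "frob (Ub - U) * frob W \<le> 2/100 * q * frob W" by (intro mult_right_mono dU') auto
    finally have "94/100 * q * frob W \<le> frob (Ub * W) + 2/100 * q * frob W" by simp
    moreover have "0 \<le> q * frob W" using q by simp
    ultimately show "9/10 * q * frob W \<le> frob (Ub * W)" by linarith
  qed
  obtain H where H: "H \<in> carrier_mat r r" "(transpose_mat Ub * Ub) * H = 1\<^sub>m r"
    "H * (transpose_mat Ub * Ub) = 1\<^sub>m r" "transpose_mat H = H" "op_le (Ub * H) (1 / (9/10 * q))"
    using pseudo_inverse[OF Ub _ Ub_ge] q by auto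
  have [simp]: "dim_row H = r" "dim_col H = r" using H by auto
  define R' where "R' = transpose_mat S * (transpose_mat Us * (Ub * H))"
  have R': "R' \<in> carrier_mat r r" by (auto simp: R'_def)
  have [simp]: "dim_row R' = r" "dim_col R' = r" using R' by auto
  define Vb where "Vb = Vs * R'"
  have Vb: "Vb \<in> carrier_mat n2 r" by (auto simp: Vb_def)
  have [simp]: "dim_row Vb = n2" "dim_col Vb = r" using Vb by auto
  have VbX: "Vb = transpose_mat Xs * (Ub * H)"
    by (simp add: Vb_def R'_def Xs mult_assoc_dim transpose_mult_dim)
  have exact: "Ub * transpose_mat Vb = Xs"
  proof -
    have UbUb: "transpose_mat Ub * Ub = transpose_mat R * R"
      by (simp add: Ub_def transpose_mult_dim mult_assoc_dim UU_mult)
    have "R * (H * transpose_mat R) = 1\<^sub>m r"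
      by (rule mat_mult_left_right_inverse[of "H * transpose_mat R"])
        (use H(3) in \<open>auto simp: UbUb mult_assoc_dim\<close>)
    then have RHR: "R * (H * (transpose_mat R * Y)) = Y" if "dim_row Y = r" for Y
      using that by (simp add: mult_assoc_dim[symmetric])
    have "Ub * transpose_mat Vb = Us * (R * (H * (transpose_mat R * (transpose_mat Us * (Us * (S * transpose_mat Vs))))))"
      by (simp add: Ub_def Vb_def R'_def transpose_mult_dim mult_assoc_dim H(4))
    also have "\<dots> = Xs" by (simp add: UU_mult RHR Xs mult_assoc_dim)
    finally show ?thesis .
  qed
  define P where "P = V * (G * transpose_mat V)"
  have P: "P \<in> carrier_mat n2 n2" "transpose_mat P = P" "P * P = P"
  proof -
    show "P \<in> carrier_mat n2 n2" by (auto simp: P_def)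
    show "transpose_mat P = P" by (simp add: P_def transpose_mult_dim mult_assoc_dim G(4))
    have "P * P = V * (G * ((transpose_mat V * (V * G)) * transpose_mat V))"
      by (simp add: P_def mult_assoc_dim)
    then show "P * P = P" by (simp add: VVG P_def)
  qed
  have [simp]: "dim_row P = n2" "dim_col P = n2" using P by auto
  have dV: "frob (Vb - V) \<le> frob F / (9/10 * q)"
  proof -
    have UUH: "transpose_mat Ub * (Ub * H) = 1\<^sub>m r" using H(2) by (simp add: mult_assoc_dim)
    have XP: "Ub * transpose_mat V = Xs * P" by (simp add: UbX P_def mult_assoc_dim)
    have UP: "U * (transpose_mat V * P) = U * transpose_mat V"
    proof -
      have "transpose_mat V * P = (transpose_mat V * (V * G)) * transpose_mat V"
        by (simp add: P_def mult_assoc_dim)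
      then show ?thesis by (simp add: VVG)
    qed
    \<comment> \<open>The residual of the first fit is Ub V^T - Xs = Xs P - Xs, and U V^T P = U V^T
      turns it into F - F P. Its norm is thus at most that of F, so the second fit starts without
      loss.\<close>
    have FP: "F - F * P = Xs * P - Xs"
      unfolding F_def by (simp add: minus_mult_dim mult_assoc_dim UP) (rule eq_matI, auto simp del: index_mult_mat(1))
    have "transpose_mat (Xs * P - Xs) * (Ub * H) = V - Vb"
      unfolding XP[symmetric]
      by (simp add: transpose_minus_dim transpose_mult_dim minus_mult_dim mult_assoc_dim UUH VbX)
    then have "frob (V - Vb) = frob (transpose_mat (F - F * P) * (Ub * H))" unfolding FP by simp
    also have "\<dots> \<le> 1 / (9/10 * q) * frob (transpose_mat (F - F * P))"
      using q by (intro frob_mult_op_le[OF H(5)]) auto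
    also have "\<dots> \<le> 1 / (9/10 * q) * frob F"
      using q frob_minus_projection_le[OF P, of F] by (intro mult_left_mono) auto
    finally show ?thesis by (subst frob_minus_commute) auto
  qed
  have "frob F / (9/10 * q) \<le> (q\<^sup>2 / 100) / (9/10 * q)" using Fe q by (intro divide_right_mono) auto
  also have "\<dots> \<le> 2/100 * q" using q(1) by (simp add: power2_eq_square field_simps)
  finally have dV': "frob (Vb - V) \<le> 2/100 * q" using dV by simp
  have dist: "(frob (Ub - U))\<^sup>2 + (frob (Vb - V))\<^sup>2 \<le> 5/2 * (frob F)\<^sup>2 / sr"
  proof -
    have "(frob (Ub - U))\<^sup>2 + (frob (Vb - V))\<^sup>2 \<le> (frob F / (94/100 * q))\<^sup>2 + (frob F / (9/10 * q))\<^sup>2"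
      by (intro add_mono power_mono dU dV) auto
    also have "\<dots> = (1 / (94/100)\<^sup>2 + 1 / (9/10)\<^sup>2) * ((frob F)\<^sup>2 / sr)"
      by (simp add: power_divide power_mult_distrib q(2) field_simps)
    also have "\<dots> \<le> 5/2 * ((frob F)\<^sup>2 / sr)"
      using sr by (intro mult_right_mono) (auto simp: power2_eq_square)
    finally show ?thesis by simp
  qed
  \<comment> \<open>As Q has orthonormal columns, |T X| = |Q T X|, so T inherits the bound on the
    nearby factor W. The bound sqrt (3 s1) is generous; it is what the radius of \<open>B_mu\<close>
    permits.\<close>
  have lift: "op_le T (sqrt (3 * s1))"
    if Q: "transpose_mat Q * Q = 1\<^sub>m r" "dim_col Q = r" and T: "dim_row T = r" "dim_col T = r"
      and W: "dim_row W = dim_row Q" "dim_col W = r" "op_le W (11/10 * sqrt s1)" and d: "frob (Q * T - W) \<le> 2/100 * q"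
    for Q T W
    unfolding op_le_def
  proof (intro allI impI)
    fix X :: "real mat" assume X: "dim_row X = dim_col T"
    have "frob (T * X) = frob (Q * T * X)"
      using Q T X by (simp add: mult_assoc_dim frob_orth_mult)
    also have "\<dots> \<le> frob (W * X) + frob ((Q * T - W) * X)"
      using frob_triangle_minus[of "Q * T * X" "W * X"] Q T W X by (simp add: minus_mult_dim)
    also have "\<dots> \<le> 11/10 * sqrt s1 * frob X + frob (Q * T - W) * frob X"
      using Q T W X by (intro add_mono op_leD frob_mult_le) auto
    also have "\<dots> \<le> 11/10 * sqrt s1 * frob X + 2/100 * q * frob X"
      by (intro add_left_mono mult_right_mono d) auto
    also have "\<dots> \<le> 11/10 * sqrt s1 * frob X + 2/100 * sqrt s1 * frob X"
      using qs by (intro add_left_mono mult_right_mono) auto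
    also have "\<dots> = (112/100 * sqrt s1) * frob X" by (simp add: algebra_simps)
    also have "\<dots> \<le> sqrt (3 * s1) * frob X"
    proof (rule mult_right_mono)
      have "112/100 \<le> sqrt (3::real)" by (rule real_le_rsqrt) (simp add: power2_eq_square)
      then show "112/100 * sqrt s1 \<le> sqrt (3 * s1)"
        unfolding real_sqrt_mult using sr sr_le by (intro mult_right_mono) auto
    qed simp
    finally show "frob (T * X) \<le> sqrt (3 * s1) * frob X" .
  qed
  show ?thesis
  proof (rule that[of R R'])
    show "op_le R (sqrt (3 * s1))"
      by (rule lift[OF UU _ _ _ _ _ bounds(3)]) (use dU' in \<open>auto simp: Ub_def\<close>)
    show "op_le R' (sqrt (3 * s1))"
      by (rule lift[OF VV _ _ _ _ _ bounds(4)]) (use dV' in \<open>auto simp: Vb_def\<close>)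
  qed (use R R' exact dist in \<open>simp_all add: Ub_def Vb_def F_def\<close>)
qed

end

section \<open>One step of the algorithm\<close>

lemma mult_le_half_sum_squares:
  fixes a b :: real
  shows "a * b \<le> (a\<^sup>2 + b\<^sup>2) / 2"
  using sum_squares_ge_zero[of "a - b" 0] by (simp add: power2_eq_square algebra_simps)

lemma frob_mult_transpose_le:
  "dim_col A = dim_col B \<Longrightarrow> frob (A * transpose_mat B) \<le> ((frob A)\<^sup>2 + (frob B)\<^sup>2) / 2"
  using frob_mult_le[of A "transpose_mat B"] mult_le_half_sum_squares[of "frob A" "frob B"] by simp

lemma frob_on_uminus:
  assumes "\<Omega> \<subseteq> {..<dim_row A} \<times> {..<dim_col A}"
  shows "frob_on \<Omega> (- A) = frob_on \<Omega> A"
  unfolding frob_on_def L2_set_def by (intro arg_cong[of _ _ sqrt] sum.cong) (use assms in auto)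

lemma bilinear_expansion:
  fixes U V Ub Vb X :: "real mat"
  assumes "U \<in> carrier_mat n1 r" "V \<in> carrier_mat n2 r" "Ub \<in> carrier_mat n1 r" "Vb \<in> carrier_mat n2 r"
    and X: "Ub * transpose_mat Vb = X"
  shows "U * transpose_mat V - X = (Ub * transpose_mat (V - Vb) + (U - Ub) * transpose_mat Vb)
      + (U - Ub) * transpose_mat (V - Vb)"
  using assms unfolding X[symmetric]
  by (auto simp: mat_simps simp del: index_mult_mat(1) intro!: eq_matI)

lemma linearization_error:
  fixes U V U' V' X :: "real mat"
  assumes "U \<in> carrier_mat n1 r" "V \<in> carrier_mat n2 r" "U' \<in> carrier_mat n1 r" "V' \<in> carrier_mat n2 r"
    and X: "X \<in> carrier_mat n1 n2"
  shows "U' * transpose_mat V' - X = (U * transpose_mat V' + U' * transpose_mat V - U * transpose_mat V - X)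
      + (U' - U) * transpose_mat (V' - V)"
  using assms by (auto simp: mat_simps simp del: index_mult_mat(1) intro!: eq_matI)

lemma gram_update:
  fixes U U' :: "real mat"
  assumes U: "U \<in> carrier_mat n r" and U': "U' \<in> carrier_mat n r" and s: "op_le U s" "0 \<le> s"
  shows "frob (transpose_mat U' * U' - transpose_mat U * U) \<le> 2 * s * frob (U' - U) + (frob (U' - U))\<^sup>2"
proof -
  let ?D = "U' - U"
  have [simp]: "dim_row U = n" "dim_col U = r" "dim_row U' = n" "dim_col U' = r" using U U' by auto
  have "transpose_mat U' * U' - transpose_mat U * U
      = (transpose_mat U * ?D + transpose_mat (transpose_mat U * ?D)) + transpose_mat ?D * ?D"
    by (auto simp: mat_simps simp del: index_mult_mat(1) intro!: eq_matI)
  then have "frob (transpose_mat U' * U' - transpose_mat U * U)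
      \<le> frob (transpose_mat U * ?D) + frob (transpose_mat (transpose_mat U * ?D)) + frob (transpose_mat ?D * ?D)"
    using frob_triangle[of "transpose_mat U * ?D + transpose_mat (transpose_mat U * ?D)" "transpose_mat ?D * ?D"]
      frob_triangle[of "transpose_mat U * ?D" "transpose_mat (transpose_mat U * ?D)"] by simp
  moreover have "frob (transpose_mat U * ?D) \<le> s * frob ?D"
    by (intro op_leD op_le_transpose s) auto
  moreover have "frob (transpose_mat ?D * ?D) \<le> (frob ?D)\<^sup>2"
    using frob_mult_le[of "transpose_mat ?D" ?D] by (simp add: power2_eq_square)
  ultimately show ?thesis unfolding frob_transpose by linarith
qed

text \<open>A row of Q T is a row of Q times T. Rows are read as matrices with one row, so that
  \<open>frob_mult_op_le\<close> applies.\<close>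

lemma norm_2_inf_mult_le:
  fixes Q T :: "real mat"
  assumes Q: "Q \<in> carrier_mat n r" and T: "T \<in> carrier_mat r r" and t: "op_le T t" "0 \<le> t" and n: "0 < n"
  shows "norm_2_inf (Q * T) \<le> t * norm_2_inf Q"
proof -
  have [simp]: "dim_row Q = n" "dim_col Q = r" "dim_row T = r" "dim_col T = r" using Q T by auto
  have row: "L2_set (\<lambda>j. A $$ (i, j)) {..<r} = frob (mat 1 r (\<lambda>(_, j). A $$ (i, j)))" for A :: "real mat" and i
  proof -
    have "(frob (mat 1 r (\<lambda>(_, j). A $$ (i, j))))\<^sup>2 = (\<Sum>j<r. (A $$ (i, j))\<^sup>2)"
      unfolding frob_sq finner_def by (simp add: power2_eq_square)
    then have "sqrt (\<Sum>j<r. (A $$ (i, j))\<^sup>2) = frob (mat 1 r (\<lambda>(_, j). A $$ (i, j)))"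
      by (metis frob_nonneg real_sqrt_unique)
    then show ?thesis by (simp add: L2_set_def)
  qed
  have le: "L2_set (\<lambda>j. (Q * T) $$ (i, j)) {..<r} \<le> t * norm_2_inf Q" if i: "i < n" for i
  proof -
    have "mat 1 r (\<lambda>(_, j). (Q * T) $$ (i, j)) = mat 1 r (\<lambda>(_, j). Q $$ (i, j)) * T"
      using i by (intro eq_matI) (auto simp: scalar_prod_def)
    then have "L2_set (\<lambda>j. (Q * T) $$ (i, j)) {..<r} \<le> t * L2_set (\<lambda>j. Q $$ (i, j)) {..<r}"
      unfolding row by (simp add: frob_mult_op_le[OF t])
    also have "\<dots> \<le> t * norm_2_inf Q"
      unfolding norm_2_inf_def using i t(2) by (intro mult_left_mono Max_ge) auto
    finally show ?thesis .
  qed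
  show ?thesis
    unfolding norm_2_inf_def[of "Q * T"] using n le by (subst Max_le_iff) auto
qed

locale sampled_target = factored_target +
  fixes \<Omega> :: entries and p :: real
  assumes \<Omega>: "\<Omega> \<subseteq> {..<n1} \<times> {..<n2}" and p: "0 < p" "p \<le> 1"
    and rip: "\<And>A B. A \<in> carrier_mat r n2 \<Longrightarrow> B \<in> carrier_mat n1 r \<Longrightarrow>
      \<bar>(frob_on \<Omega> (Us * A + B * transpose_mat Vs))\<^sup>2 - p * (frob (Us * A + B * transpose_mat Vs))\<^sup>2\<bar>
        \<le> p / 4 * (frob (Us * A + B * transpose_mat Vs))\<^sup>2"
begin

lemma frob_on_le: "dim_row A = n1 \<Longrightarrow> dim_col A = n2 \<Longrightarrow> frob_on \<Omega> A \<le> frob A"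
  using \<Omega> by (intro frob_on_le_frob) auto

lemma frob_on_add: "dim_row B = n1 \<Longrightarrow> dim_col B = n2 \<Longrightarrow> frob_on \<Omega> (A + B) \<le> frob_on \<Omega> A + frob_on \<Omega> B"
  using \<Omega> by (intro frob_on_triangle) auto

lemma frob_on_add_ge: "dim_row B = n1 \<Longrightarrow> dim_col B = n2 \<Longrightarrow> frob_on \<Omega> A - frob_on \<Omega> B \<le> frob_on \<Omega> (A + B)"
proof -
  assume d: "dim_row B = n1" "dim_col B = n2"
  have "frob_on \<Omega> A = frob_on \<Omega> ((A + B) + - B)"
    using d \<Omega> by (intro frob_on_cong) auto
  also have "\<dots> \<le> frob_on \<Omega> (A + B) + frob_on \<Omega> (- B)" using d by (intro frob_on_add) auto
  also have "frob_on \<Omega> (- B) = frob_on \<Omega> B" using d \<Omega> by (intro frob_on_uminus) auto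
  finally show ?thesis by simp
qed

lemma tangent_bounds:
  assumes R: "R \<in> carrier_mat r r" "R' \<in> carrier_mat r r" and D: "D \<in> carrier_mat n1 r" "D' \<in> carrier_mat n2 r"
  defines "M \<equiv> (Us * R) * transpose_mat D' + D * transpose_mat (Vs * R')"
  shows "86/100 * sqrt p * frob M \<le> frob_on \<Omega> M" "frob_on \<Omega> M \<le> 112/100 * sqrt p * frob M"
proof -
  have [simp]: "dim_row R = r" "dim_col R = r" "dim_row R' = r" "dim_col R' = r"
    "dim_row D = n1" "dim_col D = r" "dim_row D' = n2" "dim_col D' = r" using R D by auto
  have "M = Us * (R * transpose_mat D') + (D * transpose_mat R') * transpose_mat Vs"
    unfolding M_def by (simp add: mult_assoc_dim transpose_mult_dim)
  moreover have "R * transpose_mat D' \<in> carrier_mat r n2" "D * transpose_mat R' \<in> carrier_mat n1 r"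
    by (auto intro!: carrier_matI)
  ultimately have r: "\<bar>(frob_on \<Omega> M)\<^sup>2 - p * (frob M)\<^sup>2\<bar> \<le> p / 4 * (frob M)\<^sup>2"
    using rip by metis
  have pM: "0 \<le> p * (frob M)\<^sup>2" using p by simp
  have sq: "(c * sqrt p * frob M)\<^sup>2 = c\<^sup>2 * (p * (frob M)\<^sup>2)" for c
    using p by (simp add: power_mult_distrib)
  have lo: "3/4 * (p * (frob M)\<^sup>2) \<le> (frob_on \<Omega> M)\<^sup>2"
    and hi: "(frob_on \<Omega> M)\<^sup>2 \<le> 5/4 * (p * (frob M)\<^sup>2)" using r by linarith+
  show "86/100 * sqrt p * frob M \<le> frob_on \<Omega> M"
  proof (rule power2_le_imp_le)
    have "(86/100)\<^sup>2 * (p * (frob M)\<^sup>2) \<le> 3/4 * (p * (frob M)\<^sup>2)"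
      using pM by (intro mult_right_mono) (auto simp: power2_eq_square)
    then show "(86/100 * sqrt p * frob M)\<^sup>2 \<le> (frob_on \<Omega> M)\<^sup>2" using lo unfolding sq by linarith
  qed simp
  show "frob_on \<Omega> M \<le> 112/100 * sqrt p * frob M"
  proof (rule power2_le_imp_le)
    have "5/4 * (p * (frob M)\<^sup>2) \<le> (112/100)\<^sup>2 * (p * (frob M)\<^sup>2)"
      using pM by (intro mult_right_mono) (auto simp: power2_eq_square)
    then show "(frob_on \<Omega> M)\<^sup>2 \<le> (112/100 * sqrt p * frob M)\<^sup>2" using hi unfolding sq by linarith
  qed (use p in simp)
qed

text \<open>The reference pair is returned with the norm bounds on R and R' that later put it into
  \<open>B_mu\<close>. The conclusion is about every nearby competitor whose linearized residual is
  no larger; minimality supplies exactly this comparison.\<close>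

lemma gnmr_step:
  assumes U: "U \<in> carrier_mat n1 r" and V: "V \<in> carrier_mat n2 r"
    and e: "frob (U * transpose_mat V - Xs) \<le> sr * sqrt p / 1000"
    and bal: "frob (transpose_mat U * U - transpose_mat V * V) \<le> sr / 10"
  defines "e \<equiv> frob (U * transpose_mat V - Xs)"
    and "lin \<equiv> \<lambda>U' V'. frob_on \<Omega> (U * transpose_mat V' + U' * transpose_mat V - U * transpose_mat V - Xs)"
    and "near \<equiv> \<lambda>U' V'. (frob (U' - U))\<^sup>2 + (frob (V' - V))\<^sup>2
      \<le> 8 / (p * sr) * (frob_on \<Omega> (U * transpose_mat V - Xs))\<^sup>2"
  obtains R R' where "R \<in> carrier_mat r r" "R' \<in> carrier_mat r r"
    "op_le R (sqrt (3 * s1))" "op_le R' (sqrt (3 * s1))" "near (Us * R) (Vs * R')"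
    "\<And>U' V'. U' \<in> carrier_mat n1 r \<Longrightarrow> V' \<in> carrier_mat n2 r \<Longrightarrow> near U' V' \<Longrightarrow>
      lin U' V' \<le> lin (Us * R) (Vs * R') \<Longrightarrow>
      frob (U' * transpose_mat V' - Xs) \<le> 500 / (sr * sqrt p) * e\<^sup>2 \<and>
      frob (transpose_mat U' * U' - transpose_mat V' * V')
        \<le> frob (transpose_mat U * U - transpose_mat V * V) + 12 * sqrt (s1 / sr) * e"
proof -
  have [simp]: "dim_row U = n1" "dim_col U = r" "dim_row V = n2" "dim_col V = r" using U V by auto
  have Xc: "Xs \<in> carrier_mat n1 n2" by auto
  have sp: "0 < sqrt p" "sqrt p \<le> 1" using p by auto
  have e0: "0 \<le> e" by (simp add: e_def)
  have "sr * sqrt p \<le> sr * 1" using sp sr by (intro mult_left_mono) auto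
  then have e100: "frob (U * transpose_mat V - Xs) \<le> sr / 100" using e sr by linarith
  \<comment> \<open>Every bilinear term is a multiple of h. The assumed size of e makes h at most
    sqrt p e / 1000, which is negligible against the size sqrt p e of the tangent part on
    \<open>\<Omega>\<close>.\<close>
  define h where "h = e\<^sup>2 / sr"
  have h0: "0 \<le> h" using sr by (simp add: h_def)
  have "e * e \<le> e * (sr * sqrt p / 1000)" using e e0 by (intro mult_left_mono) (auto simp: e_def)
  then have he: "h \<le> sqrt p * e / 1000" using sr by (simp add: h_def power2_eq_square field_simps)
  have spe: "sqrt p * e \<le> 1 * e" using sp e0 by (intro mult_right_mono)
  note bounds = factor_bounds[OF U V e100 bal]
  obtain R R' where R: "R \<in> carrier_mat r r" "R' \<in> carrier_mat r r"
    and exact: "(Us * R) * transpose_mat (Vs * R') = Xs"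
    and dist: "(frob (Us * R - U))\<^sup>2 + (frob (Vs * R' - V))\<^sup>2 \<le> 5/2 * e\<^sup>2 / sr"
    and Rle: "op_le R (sqrt (3 * s1))" "op_le R' (sqrt (3 * s1))"
    using aligned_factor[OF U V e100 bal] unfolding e_def by metis
  have [simp]: "dim_row R = r" "dim_col R = r" "dim_row R' = r" "dim_col R' = r" using R by auto
  define Ub where "Ub = Us * R"
  define Vb where "Vb = Vs * R'"
  have Ub: "Ub \<in> carrier_mat n1 r" and Vb: "Vb \<in> carrier_mat n2 r" by (auto simp: Ub_def Vb_def)
  have [simp]: "dim_row Ub = n1" "dim_col Ub = r" "dim_row Vb = n2" "dim_col Vb = r" using Ub Vb by auto
  have exact': "Ub * transpose_mat Vb = Xs" using exact by (simp add: Ub_def Vb_def)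
  have dist': "(frob (Ub - U))\<^sup>2 + (frob (Vb - V))\<^sup>2 \<le> 5/2 * h"
    using dist by (simp add: Ub_def Vb_def h_def)
  define T where "T U' V' = Ub * transpose_mat (V' - Vb) + (U' - Ub) * transpose_mat Vb" for U' V'
  define N where "N U' V' = (U' - Ub) * transpose_mat (V' - Vb)" for U' V'
  have TN: "U' * transpose_mat V' - Xs = T U' V' + N U' V'"
    if "U' \<in> carrier_mat n1 r" "V' \<in> carrier_mat n2 r" for U' V'
    unfolding T_def N_def by (rule bilinear_expansion[OF that Ub Vb exact'])
  have dTN [simp]: "dim_row (T U' V') = n1" "dim_col (T U' V') = n2" "dim_row (N U' V') = n1" "dim_col (N U' V') = n2"
    if "U' \<in> carrier_mat n1 r" "V' \<in> carrier_mat n2 r" for U' V'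
    using that by (auto simp: T_def N_def)
  have Tb: "86/100 * sqrt p * frob (T U' V') \<le> frob_on \<Omega> (T U' V')"
      "frob_on \<Omega> (T U' V') \<le> 112/100 * sqrt p * frob (T U' V')"
    if "U' \<in> carrier_mat n1 r" "V' \<in> carrier_mat n2 r" for U' V'
    unfolding T_def Ub_def Vb_def
    by (rule tangent_bounds[OF R]; use that in \<open>auto simp: Ub_def Vb_def\<close>)+
  have NUV: "frob (N U V) \<le> 5/4 * h"
    unfolding N_def using frob_mult_transpose_le[of "U - Ub" "V - Vb"] dist'
    by (simp add: frob_minus_commute[of U Ub] frob_minus_commute[of V Vb])
  have NUVe: "frob (N U V) \<le> 2/1000 * (sqrt p * e)" using NUV he mult_nonneg_nonneg[of "sqrt p" e] sp e0 by linarith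
  have "frob (T U V) \<le> e + frob (N U V)" "e \<le> frob (T U V) + frob (N U V)"
  proof -
    have "frob (T U V) \<le> frob (T U V + N U V) + frob (T U V - (T U V + N U V))"
      using U V by (intro frob_triangle_minus) auto
    also have "frob (T U V - (T U V + N U V)) = frob (N U V)"
      using U V by (subst frob_minus_commute) (auto intro!: arg_cong[of _ _ frob] eq_matI)
    finally show "frob (T U V) \<le> e + frob (N U V)" by (simp add: e_def TN[OF U V])
    show "e \<le> frob (T U V) + frob (N U V)"
      unfolding e_def TN[OF U V] using U V by (intro frob_triangle) auto
  qed
  then have TUV: "frob (T U V) \<le> 1002/1000 * e" "998/1000 * e \<le> frob (T U V)"
    using NUVe spe by linarith+
  have F_up: "frob_on \<Omega> (U * transpose_mat V - Xs) \<le> 12/10 * (sqrt p * e)"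
  proof -
    have "frob_on \<Omega> (U * transpose_mat V - Xs) \<le> frob_on \<Omega> (T U V) + frob_on \<Omega> (N U V)"
      unfolding TN[OF U V] using U V by (intro frob_on_add) auto
    also have "\<dots> \<le> 112/100 * sqrt p * frob (T U V) + frob (N U V)"
      using U V by (intro add_mono Tb frob_on_le) auto
    also have "\<dots> \<le> 112/100 * sqrt p * (1002/1000 * e) + 2/1000 * (sqrt p * e)"
      using sp TUV NUVe by (intro add_mono mult_left_mono) auto
    also have "\<dots> \<le> 12/10 * (sqrt p * e)" using mult_nonneg_nonneg[of "sqrt p" e] sp e0 by simp
    finally show ?thesis .
  qed
  have F_lo: "8/10 * (sqrt p * e) \<le> frob_on \<Omega> (U * transpose_mat V - Xs)"
  proof -
    have "8/10 * (sqrt p * e) \<le> 86/100 * sqrt p * (998/1000 * e) - 2/1000 * (sqrt p * e)"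
      using mult_nonneg_nonneg[of "sqrt p" e] sp e0 by simp
    also have "\<dots> \<le> 86/100 * sqrt p * frob (T U V) - frob (N U V)"
      using sp TUV NUVe by (intro diff_mono mult_left_mono) auto
    also have "\<dots> \<le> frob_on \<Omega> (T U V) - frob_on \<Omega> (N U V)"
      using U V by (intro diff_mono Tb frob_on_le) auto
    also have "\<dots> \<le> frob_on \<Omega> (U * transpose_mat V - Xs)"
      unfolding TN[OF U V] using U V by (intro frob_on_add_ge) auto
    finally show ?thesis .
  qed
  have rate: "8 / (p * sr) * (c * (sqrt p * e))\<^sup>2 = 8 * c\<^sup>2 * h" for c
    using p sr by (simp add: h_def power_mult_distrib field_simps)
  \<comment> \<open>The radius 8 of \<open>C_step\<close> times (8/10)^2 from \<open>F_lo\<close> is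
    5.12, above the 5/2 of \<open>dist'\<close>.\<close>
  have nearb: "near Ub Vb"
  proof -
    have "(frob (Ub - U))\<^sup>2 + (frob (Vb - V))\<^sup>2 \<le> 8 * (8/10)\<^sup>2 * h"
      using dist' h0 by (simp add: power2_eq_square)
    also have "\<dots> \<le> 8 / (p * sr) * (frob_on \<Omega> (U * transpose_mat V - Xs))\<^sup>2"
      unfolding rate[symmetric] using p sr e0 sp F_lo by (intro mult_left_mono power_mono) auto
    finally show ?thesis by (simp add: near_def)
  qed
  have near_le: "(frob (U' - U))\<^sup>2 + (frob (V' - V))\<^sup>2 \<le> 12 * h" if "near U' V'" for U' V'
  proof -
    have "8 / (p * sr) * (frob_on \<Omega> (U * transpose_mat V - Xs))\<^sup>2 \<le> 8 * (12/10)\<^sup>2 * h"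
      unfolding rate[symmetric] using p sr F_up by (intro mult_left_mono power_mono) auto
    also have "\<dots> \<le> 12 * h" using h0 by (intro mult_right_mono) (auto simp: power2_eq_square)
    finally show ?thesis using that by (simp add: near_def)
  qed
  \<comment> \<open>As Ub Vb^T = Xs, the linearized residual at the reference pair is exactly -(Ub -
    U) (Vb - V)^T.\<close>
  have linb: "lin Ub Vb \<le> 5/4 * h"
  proof -
    have "lin Ub Vb = frob_on \<Omega> (- N U V)"
      unfolding lin_def
    proof (rule frob_on_cong)
      fix i j assume "(i, j) \<in> \<Omega>"
      then have ij: "i < n1" "j < n2" using \<Omega> by auto
      have "N U V = U * transpose_mat V - Xs - T U V"
        unfolding TN[OF U V] using U V by (intro eq_matI) auto
      moreover have "U * transpose_mat Vb + Ub * transpose_mat V - U * transpose_mat V - Xs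
          = T U V - (U * transpose_mat V - Xs)"
        unfolding T_def exact'[symmetric]
        by (auto simp: mat_simps simp del: index_mult_mat(1) intro!: eq_matI)
      ultimately show "(U * transpose_mat Vb + Ub * transpose_mat V - U * transpose_mat V - Xs) $$ (i, j)
          = (- N U V) $$ (i, j)"
        using ij U V by (simp del: index_mult_mat(1))
    qed
    also have "\<dots> = frob_on \<Omega> (N U V)"
      by (rule frob_on_uminus) (use U V \<Omega> in simp)
    also have "\<dots> \<le> frob (N U V)" using U V by (intro frob_on_le) auto
    finally show ?thesis using NUV by simp
  qed
  have main: "frob (U' * transpose_mat V' - Xs) \<le> 500 / (sr * sqrt p) * e\<^sup>2 \<and>
      frob (transpose_mat U' * U' - transpose_mat V' * V')
        \<le> frob (transpose_mat U * U - transpose_mat V * V) + 12 * sqrt (s1 / sr) * e"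
    if U': "U' \<in> carrier_mat n1 r" and V': "V' \<in> carrier_mat n2 r" and nr: "near U' V'"
      and ll: "lin U' V' \<le> lin Ub Vb" for U' V'
  proof
    have [simp]: "dim_row U' = n1" "dim_col U' = r" "dim_row V' = n2" "dim_col V' = r" using U' V' by auto
    note d' = near_le[OF nr]
    have sq2: "(a)\<^sup>2 \<le> 2 * b\<^sup>2 + 2 * c\<^sup>2" if "a \<le> b + c" "0 \<le> a" for a b c :: real
    proof -
      have "a\<^sup>2 \<le> (b + c)\<^sup>2" using that by (intro power_mono) auto
      also have "\<dots> \<le> 2 * b\<^sup>2 + 2 * c\<^sup>2"
        using mult_le_half_sum_squares[of b c] by (simp add: power2_eq_square algebra_simps)
      finally show ?thesis .
    qed
    have "frob (U' - Ub) \<le> frob (U' - U) + frob (Ub - U)"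
    proof -
      have "U' - Ub = (U' - U) + (U - Ub)" by (rule eq_matI) auto
      then show ?thesis using frob_triangle[of "U' - U" "U - Ub"] frob_minus_commute[of U Ub] by simp
    qed
    moreover have "frob (V' - Vb) \<le> frob (V' - V) + frob (Vb - V)"
    proof -
      have "V' - Vb = (V' - V) + (V - Vb)" by (rule eq_matI) auto
      then show ?thesis using frob_triangle[of "V' - V" "V - Vb"] frob_minus_commute[of V Vb] by simp
    qed
    ultimately have "(frob (U' - Ub))\<^sup>2 \<le> 2 * (frob (U' - U))\<^sup>2 + 2 * (frob (Ub - U))\<^sup>2"
      "(frob (V' - Vb))\<^sup>2 \<le> 2 * (frob (V' - V))\<^sup>2 + 2 * (frob (Vb - V))\<^sup>2"
      by (auto intro: sq2)
    \<comment> \<open>29 = 2 * 12 + 2 * 5/2, from the search radius and the distance to the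
      reference pair.\<close>
    then have "(frob (U' - Ub))\<^sup>2 + (frob (V' - Vb))\<^sup>2 \<le> 29 * h" using d' dist' by linarith
    then have N': "frob (N U' V') \<le> 29/2 * h"
      unfolding N_def using frob_mult_transpose_le[of "U' - Ub" "V' - Vb"] by simp
    have X': "frob_on \<Omega> (U' * transpose_mat V' - Xs) \<le> 29/4 * h"
    proof -
      let ?D = "(U' - U) * transpose_mat (V' - V)"
      have "frob_on \<Omega> (U' * transpose_mat V' - Xs) \<le> lin U' V' + frob_on \<Omega> ?D"
        unfolding lin_def linearization_error[OF U V U' V' Xc] by (intro frob_on_add) auto
      also have "frob_on \<Omega> ?D \<le> frob ?D" by (intro frob_on_le) auto
      also have "frob ?D \<le> 6 * h"
        using frob_mult_transpose_le[of "U' - U" "V' - V"] d' by simp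
      finally show ?thesis using ll linb by simp
    qed
    \<comment> \<open>The isometry concerns tangent matrices only: N is removed on
      \<open>\<Omega>\<close>, T passes from \<open>\<Omega>\<close> to all entries at the price 1 /
      sqrt p, and N is added back in the full norm.\<close>
    have "86/100 * sqrt p * frob (T U' V') \<le> frob_on \<Omega> (T U' V')" by (rule Tb[OF U' V'])
    also have "\<dots> \<le> frob_on \<Omega> (T U' V' + N U' V') + frob_on \<Omega> (N U' V')"
      using frob_on_add_ge[of "N U' V'" "T U' V'"] U' V' by simp
    also have "\<dots> \<le> 29/4 * h + 29/2 * h"
      using X' N' frob_on_le[of "N U' V'"] U' V' by (simp add: TN[OF U' V'])
    finally have "sqrt p * frob (T U' V') \<le> 26 * h" using h0 by simp
    moreover have "sqrt p * frob (N U' V') \<le> 1 * (29/2 * h)" using N' sp by (intro mult_mono) auto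
    moreover have "sqrt p * frob (U' * transpose_mat V' - Xs) \<le> sqrt p * (frob (T U' V') + frob (N U' V'))"
      unfolding TN[OF U' V'] using U' V' sp by (intro mult_left_mono frob_triangle) auto
    ultimately have "sqrt p * frob (U' * transpose_mat V' - Xs) \<le> 500 * h"
      using h0 by (simp add: algebra_simps)
    then show "frob (U' * transpose_mat V' - Xs) \<le> 500 / (sr * sqrt p) * e\<^sup>2"
      using sp sr by (simp add: h_def field_simps)
    let ?a = "frob (U' - U)" and ?b = "frob (V' - V)"
    let ?dU = "transpose_mat U' * U' - transpose_mat U * U" and ?dV = "transpose_mat V' * V' - transpose_mat V * V"
    have split: "transpose_mat U' * U' - transpose_mat V' * V'
        = (transpose_mat U * U - transpose_mat V * V) + (?dU - ?dV)"
      by (rule eq_matI) (auto simp del: index_mult_mat(1))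
    have "frob (transpose_mat U' * U' - transpose_mat V' * V')
        \<le> frob (transpose_mat U * U - transpose_mat V * V) + frob (?dU - ?dV)"
      unfolding split by (intro frob_triangle) auto
    also have "frob (?dU - ?dV) \<le> frob ?dU + frob ?dV"
    proof -
      have "frob (?dU - ?dV) \<le> frob ?dU + frob ((?dU - ?dV) - ?dU)"
        by (intro frob_triangle_minus) auto
      also have "frob ((?dU - ?dV) - ?dU) = frob ?dV"
        by (subst frob_minus_commute) (auto intro!: arg_cong[of _ _ frob] eq_matI simp del: index_mult_mat(1))
      finally show ?thesis .
    qed
    also have "frob ?dU + frob ?dV \<le> 22/10 * sqrt s1 * (?a + ?b) + (?a\<^sup>2 + ?b\<^sup>2)"
    proof -
      have "0 \<le> 11/10 * sqrt s1" using sr sr_le by simp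
      from gram_update[OF U U' bounds(3) this] gram_update[OF V V' bounds(4) this]
      show ?thesis unfolding distrib_left by linarith
    qed
    \<comment> \<open>a + b is at most sqrt (24 h), and 4.9^2 = 24.01; then 2.2 * 4.9 + 0.012 stays
      below 12.\<close>
    also have "\<dots> \<le> 22/10 * sqrt s1 * (49/10 * (e / sqrt sr)) + 12/1000 * (sqrt s1 / sqrt sr * e)"
    proof (intro add_mono mult_left_mono)
      have "(?a + ?b)\<^sup>2 \<le> 24 * h"
        using d' mult_le_half_sum_squares[of ?a ?b] by (simp add: power2_eq_square algebra_simps)
      also have "\<dots> \<le> 2401/100 * h" using h0 by simp
      also have "\<dots> = (49/10 * (e / sqrt sr))\<^sup>2"
        using sr by (simp add: power_mult_distrib power_divide h_def)
      finally show "?a + ?b \<le> 49/10 * (e / sqrt sr)"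
        by (rule power2_le_imp_le) (use e0 sr in auto)
      have "?a\<^sup>2 + ?b\<^sup>2 \<le> 12/1000 * e" using d' he spe by linarith
      also have "\<dots> \<le> 12/1000 * (sqrt s1 / sqrt sr * e)"
      proof (intro mult_left_mono)
        have "1 * e \<le> sqrt s1 / sqrt sr * e" using sr sr_le e0 by (intro mult_right_mono) auto
        then show "e \<le> sqrt s1 / sqrt sr * e" by simp
      qed simp
      finally show "?a\<^sup>2 + ?b\<^sup>2 \<le> 12/1000 * (sqrt s1 / sqrt sr * e)" .
    qed (use sr sr_le in auto)
    also have "\<dots> \<le> 12 * (sqrt s1 / sqrt sr * e)"
      using sr sr_le e0 by (simp add: field_simps)
    finally show "frob (transpose_mat U' * U' - transpose_mat V' * V')
        \<le> frob (transpose_mat U * U - transpose_mat V * V) + 12 * sqrt (s1 / sr) * e"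
      by (simp add: real_sqrt_divide mult.assoc)
  qed
  show ?thesis
    by (rule that[OF R Rle]) (use nearb main in \<open>auto simp: Ub_def Vb_def\<close>)
qed

end

section \<open>Iterating the step along a run\<close>

lemma gnmr_objective_eq:
  fixes U V U' V' X :: "real mat"
  assumes "U \<in> carrier_mat n1 r" "V \<in> carrier_mat n2 r" "U' \<in> carrier_mat n1 r" "V' \<in> carrier_mat n2 r"
    and X: "X \<in> carrier_mat n1 n2" and \<Omega>: "\<Omega> \<subseteq> {..<n1} \<times> {..<n2}"
  shows "gnmr_objective \<Omega> (sample \<Omega> X) (U, V) (U', V')
    = (frob_on \<Omega> (U * transpose_mat V' + U' * transpose_mat V - U * transpose_mat V - X))\<^sup>2"
  unfolding gnmr_objective_def frob_on_def sample_def prod.case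
  by (intro arg_cong[of _ _ "\<lambda>x. x\<^sup>2"] L2_set_cong refl)
    (use assms in \<open>auto simp del: index_mult_mat(1)\<close>)

context sampled_target
begin

lemma gnmr_run_step:
  assumes \<kappa>: "s1 = \<kappa> * sr" and n: "0 < n1" "0 < n2"
    and sv: "sing_val Xs r = sr" "sing_val Xs 1 = s1" and rate: "sampling_rate Xs \<Omega> = p"
    and inc: "norm_2_inf Us \<le> sqrt (\<mu> * real r / real n1)" "norm_2_inf Vs \<le> sqrt (\<mu> * real r / real n2)"
    and UV: "U \<in> carrier_mat n1 r" "V \<in> carrier_mat n2 r"
    and e: "frob (U * transpose_mat V - Xs) \<le> sr * sqrt p / 1000"
    and bal: "frob (transpose_mat U * U - transpose_mat V * V) \<le> sr / 10"
    and arg: "is_arg_min (gnmr_objective \<Omega> (sample \<Omega> Xs) (U, V))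
        (\<lambda>W. W \<in> B_mu r Xs \<mu> \<inter> C_step r Xs \<Omega> (U, V)) (U', V')"
  shows "U' \<in> carrier_mat n1 r \<and> V' \<in> carrier_mat n2 r \<and>
    frob (U' * transpose_mat V' - Xs) \<le> 500 / (sr * sqrt p) * (frob (U * transpose_mat V - Xs))\<^sup>2 \<and>
    frob (transpose_mat U' * U' - transpose_mat V' * V')
      \<le> frob (transpose_mat U * U - transpose_mat V * V) + 12 * sqrt \<kappa> * frob (U * transpose_mat V - Xs)"
proof -
  have Xc: "Xs \<in> carrier_mat n1 n2" by auto
  have feas: "(U', V') \<in> B_mu r Xs \<mu> \<inter> C_step r Xs \<Omega> (U, V)"
    and min: "\<And>A B. (A, B) \<in> B_mu r Xs \<mu> \<inter> C_step r Xs \<Omega> (U, V) \<Longrightarrow>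
      gnmr_objective \<Omega> (sample \<Omega> Xs) (U, V) (U', V') \<le> gnmr_objective \<Omega> (sample \<Omega> Xs) (U, V) (A, B)"
    using arg unfolding is_arg_min_def by (auto simp: not_less)
  have UV': "U' \<in> carrier_mat n1 r" "V' \<in> carrier_mat n2 r"
    using feas by (auto simp: B_mu_def factor_space_def)
  let ?lin = "\<lambda>U' V'. frob_on \<Omega> (U * transpose_mat V' + U' * transpose_mat V - U * transpose_mat V - Xs)"
  let ?near = "\<lambda>U' V'. (frob (U' - U))\<^sup>2 + (frob (V' - V))\<^sup>2
      \<le> 8 / (p * sr) * (frob_on \<Omega> (U * transpose_mat V - Xs))\<^sup>2"
  obtain R R' where R: "R \<in> carrier_mat r r" "R' \<in> carrier_mat r r"
    "op_le R (sqrt (3 * s1))" "op_le R' (sqrt (3 * s1))" "?near (Us * R) (Vs * R')"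
    and step: "\<And>U' V'. U' \<in> carrier_mat n1 r \<Longrightarrow> V' \<in> carrier_mat n2 r \<Longrightarrow> ?near U' V' \<Longrightarrow>
      ?lin U' V' \<le> ?lin (Us * R) (Vs * R') \<Longrightarrow>
      frob (U' * transpose_mat V' - Xs) \<le> 500 / (sr * sqrt p) * (frob (U * transpose_mat V - Xs))\<^sup>2 \<and>
      frob (transpose_mat U' * U' - transpose_mat V' * V')
        \<le> frob (transpose_mat U * U - transpose_mat V * V) + 12 * sqrt (s1 / sr) * frob (U * transpose_mat V - Xs)"
    using gnmr_step[OF UV e bal] by (metis (no_types, lifting))
  have cb: "Us * R \<in> carrier_mat n1 r" "Vs * R' \<in> carrier_mat n2 r" using R by auto
  have s1: "0 < s1" using sr sr_le by simp
  \<comment> \<open>The norm bound sqrt (3 s1) times the incoherence bound on the rows is exactly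
    the radius in \<open>B_mu\<close>, so the reference pair is feasible.\<close>
  have row: "norm_2_inf (Q * T) \<le> sqrt (3 * \<mu> * real r * s1 / real k)"
    if Q: "Q \<in> carrier_mat k r" "norm_2_inf Q \<le> sqrt (\<mu> * real r / real k)"
      and T: "T \<in> carrier_mat r r" "op_le T (sqrt (3 * s1))" and k: "0 < k" for Q T k
  proof -
    have "norm_2_inf (Q * T) \<le> sqrt (3 * s1) * norm_2_inf Q"
      using s1 by (intro norm_2_inf_mult_le[OF Q(1) T(1,2) _ k]) simp
    also have "\<dots> \<le> sqrt (3 * s1) * sqrt (\<mu> * real r / real k)"
      using s1 Q by (intro mult_left_mono) auto
    also have "\<dots> = sqrt (3 * \<mu> * real r * s1 / real k)"
      by (simp add: real_sqrt_mult[symmetric] mult_ac)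
    finally show ?thesis .
  qed
  have "(Us * R, Vs * R') \<in> B_mu r Xs \<mu> \<inter> C_step r Xs \<Omega> (U, V)"
    using cb R row[OF Us inc(1) R(1,3) n(1)] row[OF Vs inc(2) R(2,4) n(2)]
    by (simp add: B_mu_def C_step_def factor_space_def sv sv(2)[unfolded One_nat_def] rate)
  from min[OF this] have "(?lin U' V')\<^sup>2 \<le> (?lin (Us * R) (Vs * R'))\<^sup>2"
    unfolding gnmr_objective_eq[OF UV UV' Xc \<Omega>] gnmr_objective_eq[OF UV cb Xc \<Omega>] .
  then have "?lin U' V' \<le> ?lin (Us * R) (Vs * R')" by (rule power2_le_imp_le) simp
  moreover have "?near U' V'" using feas by (simp add: C_step_def sv rate)
  moreover have "s1 / sr = \<kappa>" using \<kappa> sr by simp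
  ultimately show ?thesis using step[OF UV'] UV' by simp
qed

lemma gnmr_run_converges:
  assumes \<kappa>: "s1 = \<kappa> * sr" and n: "0 < n1" "0 < n2"
    and sv: "sing_val Xs r = sr" "sing_val Xs 1 = s1" and rate: "sampling_rate Xs \<Omega> = p"
    and inc: "norm_2_inf Us \<le> sqrt (\<mu> * real r / real n1)" "norm_2_inf Vs \<le> sqrt (\<mu> * real r / real n2)"
    and run: "gnmr_run r Xs \<mu> \<Omega> Z"
    and init: "Z 0 \<in> B_err r Xs (sqrt p / (1000 * sqrt \<kappa>))" "Z 0 \<in> B_bln r Xs (1 / 20)"
  defines "\<gamma> \<equiv> 1000 / (2 * sr * sqrt p)"
  shows "frob (estimate (Z (Suc t)) - Xs) \<le> \<gamma> * (frob (estimate (Z t) - Xs))\<^sup>2 \<and>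
    \<gamma> * frob (estimate (Z t) - Xs) \<le> 1 / (2 * sqrt \<kappa>)"
proof -
  have k1: "1 \<le> \<kappa>"
  proof -
    have "1 * sr \<le> \<kappa> * sr" using sr_le \<kappa> by simp
    then show ?thesis using sr mult_right_le_imp_le by blast
  qed
  have sk: "1 \<le> sqrt \<kappa>" using k1 by simp
  have sp: "0 < sqrt p" "sqrt p \<le> 1" using p by auto
  \<comment> \<open>The admissible initial error. Its factor 1 / sqrt kappa cancels the sqrt kappa
    in the growth of the imbalance and also makes \<open>\<gamma> * E\<close> equal to 1 / (2 sqrt
    kappa).\<close>
  define E where "E = sqrt p / (1000 * sqrt \<kappa>) * sr"
  have E0: "0 < E" using sp sk sr by (auto simp: E_def intro!: mult_pos_pos divide_pos_pos)
  have E1: "E \<le> sr * sqrt p / 1000"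
  proof -
    have "E = sr * sqrt p / 1000 / sqrt \<kappa>" by (simp add: E_def)
    also have "\<dots> \<le> sr * sqrt p / 1000 / 1" using sk sp sr by (intro divide_left_mono) auto
    finally show ?thesis by simp
  qed
  have Ek: "12 * sqrt \<kappa> * E \<le> 12/1000 * sr"
  proof -
    have "12 * sqrt \<kappa> * E = 12/1000 * (sqrt p * sr)" using sk by (simp add: E_def)
    also have "\<dots> \<le> 12/1000 * (1 * sr)" using sp sr by (intro mult_left_mono mult_right_mono) auto
    finally show ?thesis by simp
  qed
  have \<gamma>0: "0 < \<gamma>" using sr sp by (simp add: \<gamma>_def)
  have \<gamma>E: "\<gamma> * E = 1 / (2 * sqrt \<kappa>)" using sr sp by (simp add: \<gamma>_def E_def)
  have \<gamma>E_half: "\<gamma> * E \<le> 1/2" 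
  proof -
    have "1 / sqrt \<kappa> \<le> 1 / 1" using sk by (intro divide_left_mono) auto
    then show ?thesis unfolding \<gamma>E by simp
  qed
  have \<gamma>_eq: "500 / (sr * sqrt p) = \<gamma>" by (simp add: \<gamma>_def field_simps)
  \<comment> \<open>Halving of the error is enough for the invariant. The imbalance then gains at
    most 12/1000 sr 2^(-t) in step t, in total 24/1000 sr; with the initial sr / 20 it stays below
    the sr / 10 that each step requires.\<close>
  define bounds_at where "bounds_at t U V \<longleftrightarrow> U \<in> carrier_mat n1 r \<and> V \<in> carrier_mat n2 r \<and>
     frob (U * transpose_mat V - Xs) \<le> E * (1/2) ^ t \<and>
     frob (transpose_mat U * U - transpose_mat V * V) \<le> sr / 20 + 24/1000 * sr * (1 - (1/2) ^ t)" for t :: nat and U V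
  have step: "frob (estimate (Z (Suc t)) - Xs) \<le> \<gamma> * (frob (estimate (Z t) - Xs))\<^sup>2 \<and>
      bounds_at (Suc t) (fst (Z (Suc t))) (snd (Z (Suc t)))"
    if i: "bounds_at t (fst (Z t)) (snd (Z t))" for t
  proof -
    obtain U V where Z: "Z t = (U, V)" by (cases "Z t")
    obtain U' V' where Z': "Z (Suc t) = (U', V')" by (cases "Z (Suc t)")
    have UV: "U \<in> carrier_mat n1 r" "V \<in> carrier_mat n2 r"
      and et: "frob (U * transpose_mat V - Xs) \<le> E * (1/2) ^ t"
      and bt: "frob (transpose_mat U * U - transpose_mat V * V) \<le> sr / 20 + 24/1000 * sr * (1 - (1/2) ^ t)"
      using i by (auto simp: bounds_at_def Z)
    have h: "0 < (1/2::real) ^ t" "(1/2::real) ^ t \<le> 1" by (auto simp: power_le_one)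
    let ?e = "frob (U * transpose_mat V - Xs)"
    have "E * (1/2) ^ t \<le> E * 1" using h E0 by (intro mult_left_mono) auto
    then have eE: "?e \<le> E" using et by simp
    have "24/1000 * sr * (1 - (1/2) ^ t) \<le> 24/1000 * sr * 1" using h sr by (intro mult_left_mono) auto
    then have b10: "frob (transpose_mat U * U - transpose_mat V * V) \<le> sr / 10" using bt sr by linarith
    have arg: "is_arg_min (gnmr_objective \<Omega> (sample \<Omega> Xs) (U, V))
        (\<lambda>W. W \<in> B_mu r Xs \<mu> \<inter> C_step r Xs \<Omega> (U, V)) (U', V')"
      using run Z Z' unfolding gnmr_run_def by metis
    note st = gnmr_run_step[OF \<kappa> n sv rate inc UV order_trans[OF eE E1] b10 arg]
    have quad: "frob (U' * transpose_mat V' - Xs) \<le> \<gamma> * ?e\<^sup>2" using st by (simp add: \<gamma>_eq)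
    have "\<gamma> * ?e\<^sup>2 = (\<gamma> * ?e) * ?e" by (simp add: power2_eq_square)
    also have "\<dots> \<le> (\<gamma> * E) * ?e" using eE \<gamma>0 by (intro mult_right_mono mult_left_mono) auto
    also have "\<dots> \<le> 1/2 * ?e" by (intro mult_right_mono \<gamma>E_half) auto
    also have "\<dots> \<le> E * (1/2) ^ Suc t" using et by simp
    finally have e': "frob (U' * transpose_mat V' - Xs) \<le> E * (1/2) ^ Suc t" using quad by linarith
    have "12 * sqrt \<kappa> * ?e \<le> 12 * sqrt \<kappa> * (E * (1/2) ^ t)" using et sk by (intro mult_left_mono) auto
    also have "\<dots> = 12 * sqrt \<kappa> * E * (1/2) ^ t" by simp
    also have "\<dots> \<le> 12/1000 * sr * (1/2) ^ t" using h by (intro mult_right_mono Ek) auto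
    finally have "12 * sqrt \<kappa> * ?e \<le> 12/1000 * sr * (1/2) ^ t" .
    moreover have "24/1000 * sr * (1 - (1/2) ^ Suc t) = 24/1000 * sr * (1 - (1/2) ^ t) + 12/1000 * sr * (1/2) ^ t"
      unfolding power_Suc right_diff_distrib by linarith
    ultimately have b': "frob (transpose_mat U' * U' - transpose_mat V' * V') \<le> sr / 20 + 24/1000 * sr * (1 - (1/2) ^ Suc t)"
      using st bt by linarith
    show ?thesis using quad e' b' st by (simp add: bounds_at_def estimate_def Z Z')
  qed
  have base: "bounds_at 0 (fst (Z 0)) (snd (Z 0))"
    using init by (auto simp: bounds_at_def B_err_def B_bln_def factor_space_def sv E_def)
  have all: "bounds_at t (fst (Z t)) (snd (Z t))" for t
    by (induction t) (use base step in auto)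
  have "frob (estimate (Z t) - Xs) \<le> E * (1/2) ^ t"
    using all[of t] by (auto simp: bounds_at_def estimate_def split: prod.splits)
  also have "\<dots> \<le> E * 1" using E0 by (intro mult_left_mono) (auto simp: power_le_one)
  finally have "\<gamma> * frob (estimate (Z t) - Xs) \<le> \<gamma> * E" using \<gamma>0 by simp
  then show ?thesis using step[OF all] \<gamma>E by simp
qed

end

section \<open>Isometry of a random sample on the tangent space\<close>

text \<open>The entries of I - Q Q^T. As a function of two indices, its Kronecker product on index
  pairs is a plain product of reals.\<close>

definition proj_compl :: "nat \<Rightarrow> real mat \<Rightarrow> nat \<Rightarrow> nat \<Rightarrow> real" where
  "proj_compl r Q i k = of_bool (i = k) - (\<Sum>s<r. Q $$ (i, s) * Q $$ (k, s))"

lemma proj_compl_commute: "proj_compl r Q i k = proj_compl r Q k i"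
  by (auto simp: proj_compl_def mult.commute)

lemma proj_compl_annihilates:
  assumes Q: "Q \<in> carrier_mat n r" "transpose_mat Q * Q = 1\<^sub>m r" and i: "i < n" and s: "s < r"
  shows "(\<Sum>k<n. proj_compl r Q i k * Q $$ (k, s)) = 0"
proof -
  have [simp]: "dim_row Q = n" "dim_col Q = r" using Q by auto
  have orth: "(\<Sum>k<n. Q $$ (k, t) * Q $$ (k, s)) = of_bool (t = s)" if t: "t < r" for t
  proof -
    have "(transpose_mat Q * Q) $$ (t, s) = (\<Sum>k<n. Q $$ (k, t) * Q $$ (k, s))"
      using t s by (simp add: index_mult_sum del: index_mult_mat(1))
    then have "(\<Sum>k<n. Q $$ (k, t) * Q $$ (k, s)) = 1\<^sub>m r $$ (t, s)" by (simp only: Q(2))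
    also have "\<dots> = of_bool (t = s)" using t s by simp
    finally show ?thesis .
  qed
  have "(\<Sum>k<n. proj_compl r Q i k * Q $$ (k, s))
      = (\<Sum>k<n. of_bool (i = k) * Q $$ (k, s)) - (\<Sum>k<n. \<Sum>t<r. Q $$ (i, t) * (Q $$ (k, t) * Q $$ (k, s)))"
    by (simp add: proj_compl_def left_diff_distrib sum_subtractf sum_distrib_right mult.assoc)
  also have "(\<Sum>k<n. of_bool (i = k) * Q $$ (k, s)) = Q $$ (i, s)" using i by simp
  also have "(\<Sum>k<n. \<Sum>t<r. Q $$ (i, t) * (Q $$ (k, t) * Q $$ (k, s)))
      = (\<Sum>t<r. Q $$ (i, t) * (\<Sum>k<n. Q $$ (k, t) * Q $$ (k, s)))"
    by (subst sum.swap) (simp add: sum_distrib_left)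
  also have "\<dots> = (\<Sum>t<r. Q $$ (i, t) * of_bool (t = s))" by (intro sum.cong refl) (simp add: orth)
  also have "\<dots> = Q $$ (i, s)" using s by simp
  finally show ?thesis by simp
qed

lemma proj_compl_idem:
  assumes Q: "Q \<in> carrier_mat n r" "transpose_mat Q * Q = 1\<^sub>m r" and i: "i < n" and u: "u < n"
  shows "(\<Sum>k<n. proj_compl r Q i k * proj_compl r Q k u) = proj_compl r Q i u"
proof -
  have "(\<Sum>k<n. proj_compl r Q i k * proj_compl r Q k u)
      = (\<Sum>k<n. proj_compl r Q i k * of_bool (k = u)) - (\<Sum>k<n. \<Sum>s<r. (proj_compl r Q i k * Q $$ (k, s)) * Q $$ (u, s))"
    by (simp add: proj_compl_def[of r Q k u for k] right_diff_distrib sum_subtractf sum_distrib_left mult.assoc)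
  also have "(\<Sum>k<n. proj_compl r Q i k * of_bool (k = u)) = proj_compl r Q i u" using u by simp
  also have "(\<Sum>k<n. \<Sum>s<r. (proj_compl r Q i k * Q $$ (k, s)) * Q $$ (u, s))
      = (\<Sum>s<r. (\<Sum>k<n. proj_compl r Q i k * Q $$ (k, s)) * Q $$ (u, s))"
    by (subst sum.swap) (simp add: sum_distrib_right)
  also have "\<dots> = 0" by (intro sum.neutral) (simp add: proj_compl_annihilates[OF Q i])
  finally show ?thesis by simp
qed

lemma row_norm_le:
  assumes Q: "Q \<in> carrier_mat n r" and i: "i < n" and inc: "norm_2_inf Q \<le> sqrt y"
  shows "0 \<le> y" "(\<Sum>s<r. Q $$ (i, s) * Q $$ (i, s)) \<le> y"
proof -
  let ?x = "L2_set (\<lambda>s. Q $$ (i, s)) {..<r}"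
  have "?x \<le> norm_2_inf Q"
    unfolding norm_2_inf_def using Q i by (intro Max_ge) auto
  then have x: "?x \<le> sqrt y" using inc by simp
  \<comment> \<open>\<open>sqrt\<close> is negative on negative reals, so the sign of y can be read
    off.\<close>
  then have "0 \<le> sqrt y" using L2_set_nonneg order_trans by blast
  then show y: "0 \<le> y" by simp
  have "?x\<^sup>2 \<le> (sqrt y)\<^sup>2" using x by (intro power_mono) auto
  then show "(\<Sum>s<r. Q $$ (i, s) * Q $$ (i, s)) \<le> y"
    using y by (simp add: L2_set_def sum_nonneg power2_eq_square)
qed

text \<open>The projection onto the tangent space is \<open>1 - (1 - Us Us\<^sup>T) \<otimes> (1 - Vs Vs\<^sup>T)\<close>.\<close>
lemma tangent_rip:
  assumes Us: "Us \<in> carrier_mat n1 r" "transpose_mat Us * Us = 1\<^sub>m r"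
    and Vs: "Vs \<in> carrier_mat n2 r" "transpose_mat Vs * Vs = 1\<^sub>m r"
    and inc: "norm_2_inf Us \<le> sqrt y1" "norm_2_inf Vs \<le> sqrt y2"
    and m: "0 < m" "m \<le> n1 * n2" and p: "p = real m / (real n1 * real n2)"
    and L: "0 < y1 + y2" and KL: "real (2 ^ j) * (y1 + y2) \<le> p"
  shows "measure_pmf.prob (uniform_sample n1 n2 m)
     {\<Omega>. \<Omega> \<subseteq> {..<n1} \<times> {..<n2} \<and> card \<Omega> = m \<and>
        (\<forall>A\<in>carrier_mat r n2. \<forall>B\<in>carrier_mat n1 r.
          \<bar>(frob_on \<Omega> (Us * A + B * transpose_mat Vs))\<^sup>2 - p * (frob (Us * A + B * transpose_mat Vs))\<^sup>2\<bar>
            \<le> p / 4 * (frob (Us * A + B * transpose_mat Vs))\<^sup>2)}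
     \<ge> 1 - real (n1 * n2 + 1) * real (n1 * n2) * (80 * real (2 ^ j) * (y1 + y2) / p) ^ (2 ^ j)"
    (is "_ \<le> measure_pmf.prob _ ?goal")
proof -
  let ?G = "{..<n1} \<times> {..<n2}"
  let ?c = "proj_compl r Us" and ?d = "proj_compl r Vs"
  define T where "T x y = ?c (fst x) (fst y) * ?d (snd x) (snd y)" for x y
  define P where "P x y = of_bool (x = y) - T x y" for x y :: "nat \<times> nat"
  have dims [simp]: "dim_row Us = n1" "dim_col Us = r" "dim_row Vs = n2" "dim_col Vs = r" using Us Vs by auto
  have cardG: "card ?G = n1 * n2" by simp
  have tens: "(\<Sum>y\<in>?G. (f (fst y) * g (snd y))) = (\<Sum>k<n1. f k) * (\<Sum>l<n2. g l)" for f g :: "nat \<Rightarrow> real"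
    by (simp add: sum_product sum.cartesian_product case_prod_unfold)
  have Tsym: "T x y = T y x" for x y
    by (simp add: T_def proj_compl_commute[of r Us "fst x"] proj_compl_commute[of r Vs "snd x"])
  have Tidem: "(\<Sum>y\<in>?G. T x y * T y z) = T x z" if x: "x \<in> ?G" and z: "z \<in> ?G" for x z
  proof -
    have "(\<Sum>y\<in>?G. T x y * T y z)
        = (\<Sum>y\<in>?G. (?c (fst x) (fst y) * ?c (fst y) (fst z)) * (?d (snd x) (snd y) * ?d (snd y) (snd z)))"
      by (intro sum.cong refl) (simp add: T_def mult_ac)
    also have "\<dots> = (\<Sum>k<n1. ?c (fst x) k * ?c k (fst z)) * (\<Sum>l<n2. ?d (snd x) l * ?d l (snd z))"
      by (rule tens)
    also have "\<dots> = T x z"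
      using x z by (auto simp: T_def proj_compl_idem[OF Us] proj_compl_idem[OF Vs])
    finally show ?thesis .
  qed
  have Psym: "P x y = P y x" for x y using Tsym by (auto simp: P_def)
  have Pidem: "(\<Sum>y\<in>?G. P x y * P y z) = P x z" if x: "x \<in> ?G" and z: "z \<in> ?G" for x z
  proof -
    have "(\<Sum>y\<in>?G. P x y * P y z) = (\<Sum>y\<in>?G. (if y = x then P x z else 0)
        - (if y = z then T x z else 0) + T x y * T y z)"
      by (intro sum.cong refl) (auto simp: P_def algebra_simps)
    also have "\<dots> = P x z - T x z + T x z"
      unfolding sum.distrib sum_subtractf Tidem[OF x z] using x z by simp
    finally show ?thesis by simp
  qed
  \<comment> \<open>The diagonal entry is 1 - (1 - a) (1 - b) = a + b - a b, where a and b are the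
    squared row norms bounded by incoherence.\<close>
  have Pdiag: "P x x \<le> y1 + y2" if x: "x \<in> ?G" for x
  proof -
    let ?a = "\<Sum>s<r. Us $$ (fst x, s) * Us $$ (fst x, s)" and ?b = "\<Sum>s<r. Vs $$ (snd x, s) * Vs $$ (snd x, s)"
    have "P x x = ?a + ?b - ?a * ?b"
      by (simp add: P_def T_def proj_compl_def algebra_simps)
    moreover have "0 \<le> ?a * ?b" by (intro mult_nonneg_nonneg sum_nonneg zero_le_square)
    moreover have "?a \<le> y1" "?b \<le> y2"
      using x row_norm_le(2)[OF Us(1) _ inc(1)] row_norm_le(2)[OF Vs(1) _ inc(2)] by auto
    ultimately show ?thesis by linarith
  qed
  let ?S = "{S. S \<subseteq> ?G \<and> card S = m}"
  let ?good = "{S. \<forall>v. (\<forall>x\<in>?G. (\<Sum>y\<in>?G. P x y * v y) = v x) \<longrightarrow>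
        \<bar>(\<Sum>k\<in>S. (v k)\<^sup>2) - p * (\<Sum>k\<in>?G. (v k)\<^sup>2)\<bar> \<le> p / 4 * (\<Sum>k\<in>?G. (v k)\<^sup>2)}"
  have prob: "1 - real (n1 * n2 + 1) * real (n1 * n2) * (80 * real (2 ^ j) * (y1 + y2) / p) ^ (2 ^ j)
      \<le> measure_pmf.prob (uniform_sample n1 n2 m) ?good"
    using uniform_rip[of ?G m P "y1 + y2" p j, OF _ m(1) _ Psym Pidem Pdiag _ L KL] m p
    unfolding uniform_sample_def cardG by simp
  \<comment> \<open>Every summand of M is a product of a row part and a column part, one of which is
    a column of Us or of Vs. The complementary projections annihilate it, so T M = 0 and P M =
    M.\<close>
  have fix_v: "(\<Sum>y\<in>?G. P x y * M $$ y) = M $$ x"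
    if A: "A \<in> carrier_mat r n2" and B: "B \<in> carrier_mat n1 r" and M: "M = Us * A + B * transpose_mat Vs"
      and x: "x \<in> ?G" for A B M x
  proof -
    have [simp]: "dim_row A = r" "dim_col A = n2" "dim_row B = n1" "dim_col B = r" using A B by auto
    have "(\<Sum>y\<in>?G. T x y * M $$ y) = (\<Sum>y\<in>?G. \<Sum>s<r.
        (?c (fst x) (fst y) * Us $$ (fst y, s)) * (?d (snd x) (snd y) * A $$ (s, snd y))
        + (?c (fst x) (fst y) * B $$ (fst y, s)) * (?d (snd x) (snd y) * Vs $$ (snd y, s)))"
    proof (rule sum.cong[OF refl])
      fix y assume "y \<in> ?G"
      then obtain k l where y: "y = (k, l)" "k < n1" "l < n2" by auto
      have "M $$ y = (\<Sum>s<r. Us $$ (k, s) * A $$ (s, l) + B $$ (k, s) * Vs $$ (l, s))"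
        using y unfolding M by (simp add: index_mult_sum sum.distrib del: index_mult_mat(1))
      then show "T x y * M $$ y = (\<Sum>s<r.
        (?c (fst x) (fst y) * Us $$ (fst y, s)) * (?d (snd x) (snd y) * A $$ (s, snd y))
        + (?c (fst x) (fst y) * B $$ (fst y, s)) * (?d (snd x) (snd y) * Vs $$ (snd y, s)))"
        by (simp add: T_def y sum_distrib_left algebra_simps)
    qed
    also have "\<dots> = (\<Sum>s<r. \<Sum>y\<in>?G.
        (?c (fst x) (fst y) * Us $$ (fst y, s)) * (?d (snd x) (snd y) * A $$ (s, snd y))
        + (?c (fst x) (fst y) * B $$ (fst y, s)) * (?d (snd x) (snd y) * Vs $$ (snd y, s)))"
      by (rule sum.swap)
    also have "\<dots> = 0"
    proof (rule sum.neutral, rule ballI)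
      fix s assume s: "s \<in> {..<r}"
      have "(\<Sum>y\<in>?G. (?c (fst x) (fst y) * Us $$ (fst y, s)) * (?d (snd x) (snd y) * A $$ (s, snd y))) = 0"
        using tens[of "\<lambda>k. ?c (fst x) k * Us $$ (k, s)" "\<lambda>l. ?d (snd x) l * A $$ (s, l)"]
          proj_compl_annihilates[OF Us, of "fst x" s] x s by auto
      moreover have "(\<Sum>y\<in>?G. (?c (fst x) (fst y) * B $$ (fst y, s)) * (?d (snd x) (snd y) * Vs $$ (snd y, s))) = 0"
        using tens[of "\<lambda>k. ?c (fst x) k * B $$ (k, s)" "\<lambda>l. ?d (snd x) l * Vs $$ (l, s)"]
          proj_compl_annihilates[OF Vs, of "snd x" s] x s by auto
      ultimately show "(\<Sum>y\<in>?G.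
        (?c (fst x) (fst y) * Us $$ (fst y, s)) * (?d (snd x) (snd y) * A $$ (s, snd y))
        + (?c (fst x) (fst y) * B $$ (fst y, s)) * (?d (snd x) (snd y) * Vs $$ (snd y, s))) = 0"
        by (simp only: sum.distrib add_0)
    qed
    finally have T0: "(\<Sum>y\<in>?G. T x y * M $$ y) = 0" .
    have "(\<Sum>y\<in>?G. P x y * M $$ y) = (\<Sum>y\<in>?G. (if y = x then M $$ x else 0) - T x y * M $$ y)"
      by (intro sum.cong refl) (auto simp: P_def algebra_simps)
    also have "\<dots> = M $$ x" unfolding sum_subtractf T0 using x by simp
    finally show ?thesis .
  qed
  have "?good \<inter> set_pmf (uniform_sample n1 n2 m) \<subseteq> ?goal"
  proof
    fix \<Omega> assume \<Omega>: "\<Omega> \<in> ?good \<inter> set_pmf (uniform_sample n1 n2 m)"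
    \<comment> \<open>\<open>pmf_of_set\<close> has the expected support only for a nonempty set.
      The support then supplies the inclusion and the cardinality demanded by the goal
      event.\<close>
    have "?S \<noteq> {}" using m obtain_subset_with_card_n[of m ?G] by (auto simp: cardG)
    then have S: "\<Omega> \<in> ?S" using \<Omega> by (simp add: uniform_sample_def)
    have "\<bar>(frob_on \<Omega> M)\<^sup>2 - p * (frob M)\<^sup>2\<bar> \<le> p / 4 * (frob M)\<^sup>2"
      if A: "A \<in> carrier_mat r n2" and B: "B \<in> carrier_mat n1 r" and M: "M = Us * A + B * transpose_mat Vs" for A B M
    proof -
      have "dim_row M = n1" "dim_col M = n2" using A B by (auto simp: M)
      then have "(frob M)\<^sup>2 = (\<Sum>k\<in>?G. (M $$ k)\<^sup>2)" by (simp add: frob_def frob_on_sq)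
      then show ?thesis using \<Omega> fix_v[OF A B M] by (auto simp: frob_on_sq)
    qed
    then show "\<Omega> \<in> ?goal" using S by auto
  qed
  then have "measure_pmf.prob (uniform_sample n1 n2 m) ?good \<le> measure_pmf.prob (uniform_sample n1 n2 m) ?goal"
    by (subst measure_Int_set_pmf[symmetric]) (intro measure_pmf.finite_measure_mono, auto)
  with prob show ?thesis by linarith
qed

section \<open>Constants and probability of success\<close>

text \<open>Provides the order of the moment, which must be a power of two. The lower bound on x
  covers j = 0, where 1 <= 2 x is needed.\<close>

lemma power_of_two_between:
  fixes x :: real
  assumes "1/2 \<le> x"
  obtains j where "x \<le> 2 ^ j" "2 ^ j \<le> 2 * x"
proof -
  obtain k :: nat where k: "x \<le> 2 ^ k" using real_arch_pow[of 2 x] by (auto intro: less_imp_le)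
  define j where "j = (LEAST k. x \<le> 2 ^ k)"
  have 1: "x \<le> 2 ^ j" unfolding j_def by (rule LeastI[of "\<lambda>k. x \<le> 2 ^ k", OF k])
  have "2 ^ j \<le> 2 * x"
  proof (cases j)
    case 0
    then show ?thesis using assms by simp
  next
    case (Suc i)
    then have "\<not> x \<le> 2 ^ i" using not_less_Least[of i "\<lambda>k. x \<le> 2 ^ k"] by (simp add: j_def)
    then show ?thesis using Suc by simp
  qed
  with 1 that show ?thesis by blast
qed

text \<open>The trace of Q^T Q. It makes \<open>\<mu> * r\<close> positive under incoherence and
  rules out a Q without rows when r >= 1.\<close>

lemma sum_col_squares:
  assumes Q: "Q \<in> carrier_mat n r" "transpose_mat Q * Q = 1\<^sub>m r"
  shows "(\<Sum>i<n. \<Sum>s<r. Q $$ (i, s) * Q $$ (i, s)) = (real r :: real)"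
proof -
  have [simp]: "dim_row Q = n" "dim_col Q = r" using Q by auto
  have "(\<Sum>i<n. Q $$ (i, s) * Q $$ (i, s)) = 1" if s: "s < r" for s
  proof -
    have "(transpose_mat Q * Q) $$ (s, s) = (\<Sum>k<n. Q $$ (k, s) * Q $$ (k, s))"
      using s by (simp add: index_mult_sum del: index_mult_mat(1))
    then show ?thesis using s by (simp add: Q(2))
  qed
  then show ?thesis by (subst sum.swap) simp
qed

lemma diagonal_op_bounds:
  fixes S :: "real mat"
  assumes S: "S \<in> carrier_mat r r" "diagonal_mat S"
    and b: "\<And>i. i < r \<Longrightarrow> a \<le> S $$ (i, i) \<and> S $$ (i, i) \<le> b" and a: "0 \<le> a" and ab: "a \<le> b"
  shows "op_le S b" "op_ge S a"
proof -
  have [simp]: "dim_row S = r" "dim_col S = r" using S by auto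
  have ent: "(S * X) $$ (i, j) = S $$ (i, i) * X $$ (i, j)" if "dim_row X = r" "i < r" "j < dim_col X" for X i j
  proof -
    have "(S * X) $$ (i, j) = (\<Sum>k<r. S $$ (i, k) * X $$ (k, j))"
      using that by (simp add: index_mult_sum del: index_mult_mat(1))
    also have "\<dots> = (\<Sum>k<r. if k = i then S $$ (i, i) * X $$ (i, j) else 0)"
      using that S(2) by (intro sum.cong refl) (auto simp: diagonal_mat_def)
    finally show ?thesis using that by simp
  qed
  have sq: "(frob (S * X))\<^sup>2 = (\<Sum>i<r. \<Sum>j<dim_col X. (S $$ (i, i))\<^sup>2 * (X $$ (i, j))\<^sup>2)"
    if "dim_row X = r" for X
    unfolding frob_sq finner_def using that
    by (simp add: ent power2_eq_square mult_ac del: index_mult_mat(1))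
  have sqX: "(c * frob X)\<^sup>2 = (\<Sum>i<r. \<Sum>j<dim_col X. c\<^sup>2 * (X $$ (i, j))\<^sup>2)" if "dim_row X = r" for X c
    unfolding power_mult_distrib frob_sq finner_def using that
    by (simp add: sum_distrib_left power2_eq_square)
  have d: "a\<^sup>2 \<le> (S $$ (i, i))\<^sup>2" "(S $$ (i, i))\<^sup>2 \<le> b\<^sup>2" if "i < r" for i
    using b[OF that] a by (auto intro!: power_mono)
  show "op_le S b" unfolding op_le_def
  proof (intro allI impI)
    fix X :: "real mat" assume X: "dim_row X = dim_col S"
    have "(frob (S * X))\<^sup>2 \<le> (b * frob X)\<^sup>2"
      using X d by (simp add: sq sqX) (intro sum_mono mult_right_mono; simp)
    then show "frob (S * X) \<le> b * frob X" by (rule power2_le_imp_le) (use a ab in auto)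
  qed
  show "op_ge S a" unfolding op_ge_def
  proof (intro allI impI)
    fix X :: "real mat" assume X: "dim_row X = dim_col S"
    have "(a * frob X)\<^sup>2 \<le> (frob (S * X))\<^sup>2"
      using X d by (simp add: sq sqX) (intro sum_mono mult_right_mono; simp)
    then show "a * frob X \<le> frob (S * X)" by (rule power2_le_imp_le) simp
  qed
qed

text \<open>The prefactor is at most 2 n^4 and q^K is at most exp (-7 ln n) = n^(-7); the exponent 7
  is chosen to leave n^(-3).\<close>

lemma failure_probability_le:
  fixes n K N :: nat and q :: real
  assumes n: "2 \<le> n" and N: "1 \<le> N" "N \<le> n * n" and K: "ln (real n) \<le> real K"
    and q: "0 \<le> q" "q \<le> exp (-7)"
  shows "real (N + 1) * real N * q ^ K \<le> 3 / real n ^ 3"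
proof -
  have n0: "0 < real n" using n by simp
  have "q ^ K \<le> exp (-7) ^ K" using q by (intro power_mono)
  also have "\<dots> = exp (- (7 * real K))" by (simp add: exp_of_nat_mult[symmetric] mult.commute)
  also have "\<dots> \<le> exp (- (7 * ln (real n)))" using K by simp
  also have "\<dots> = inverse (real n ^ 7)"
    using n0 exp_of_nat_mult[of 7 "ln (real n)"] by (simp add: exp_minus)
  finally have q7: "q ^ K \<le> inverse (real n ^ 7)" .
  have N': "real N \<le> real n ^ 2" using N(2) by (simp add: power2_eq_square flip: of_nat_mult)
  have "real (N + 1) = real N + 1" "1 \<le> real N" using N(1) by auto
  then have "real (N + 1) \<le> 2 * real n ^ 2" using N' by linarith
  then have "real (N + 1) * real N \<le> (2 * real n ^ 2) * real n ^ 2"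
    using N' by (intro mult_mono) auto
  then have "real (N + 1) * real N * q ^ K \<le> (2 * real n ^ 2 * real n ^ 2) * inverse (real n ^ 7)"
    using q by (intro mult_mono[OF _ q7]) auto
  also have "\<dots> = 2 / real n ^ 3"
    using n0 by (simp add: field_simps flip: power_add)
  also have "\<dots> \<le> 3 / real n ^ 3" using n0 by (intro divide_right_mono) auto
  finally show ?thesis .
qed

lemma gnmr_success_probability:
  fixes \<beta> :: real
  assumes \<beta>: "0 < \<beta>"
    and n: "n = max n1 n2" "\<beta> * real n \<le> real (min n1 n2)" "2 \<le> n"
    and r: "1 \<le> r" and X: "Xs \<in> incoherent_mats n1 n2 r \<mu> \<kappa>"
    and m: "m \<le> n1 * n2" and p: "p = real m / (real n1 * real n2)"
    and np: "320 * exp 7 / \<beta> * \<mu> * real r * ln (real n) \<le> real n * p"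
    and \<gamma>: "\<gamma> = 1000 / (2 * sing_val Xs r * sqrt p)"
  shows "1 - 3 / real n ^ 3 \<le> measure_pmf.prob (uniform_sample n1 n2 m)
     {\<Omega>. \<forall>Z. Z 0 \<in> B_err r Xs (sqrt p / (1000 * sqrt \<kappa>)) \<inter> B_bln r Xs (1 / 20) \<inter> B_mu r Xs \<mu> \<longrightarrow>
          gnmr_run r Xs \<mu> \<Omega> Z \<longrightarrow>
          (\<forall>t. frob (estimate (Z (Suc t)) - Xs) \<le> \<gamma> * (frob (estimate (Z t) - Xs))\<^sup>2 \<and>
               \<gamma> * frob (estimate (Z t) - Xs) \<le> 1 / (2 * sqrt \<kappa>) \<and>
               1 / (2 * sqrt \<kappa>) \<le> 1 / 2)}" (is "_ \<le> measure_pmf.prob _ ?goal")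
proof -
  obtain U S V where Xc: "Xs \<in> carrier_mat n1 n2" and U: "U \<in> carrier_mat n1 r" and S: "S \<in> carrier_mat r r"
    and V: "V \<in> carrier_mat n2 r" and UU: "transpose_mat U * U = 1\<^sub>m r" and VV: "transpose_mat V * V = 1\<^sub>m r"
    and XX: "Xs = U * S * transpose_mat V" and dg: "diagonal_mat S"
    and sv: "\<And>i. i < r \<Longrightarrow> sing_val Xs r \<le> S $$ (i, i) \<and> S $$ (i, i) \<le> sing_val Xs 1"
    and sr: "0 < sing_val Xs r" and s1: "sing_val Xs 1 = \<kappa> * sing_val Xs r" and \<kappa>: "1 \<le> \<kappa>"
    and inc: "norm_2_inf U \<le> sqrt (\<mu> * real r / real n1)" "norm_2_inf V \<le> sqrt (\<mu> * real r / real n2)"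
    using incoherent_mats_svd[OF X r] by metis
  have "real (min n1 n2) > 0" using \<beta> n by (smt (verit) mult_pos_pos of_nat_0_less_iff zero_less_numeral order_less_le_trans)
  then have n12: "0 < n1" "0 < n2" by auto
  have n0: "0 < real n" and ln_n: "1/2 \<le> ln (real n)"
  proof -
    show "0 < real n" using n by simp
    have "1/2 \<le> ln (2::real)" using ln2_ge_two_thirds by simp
    also have "\<dots> \<le> ln (real n)" using n by simp
    finally show "1/2 \<le> ln (real n)" .
  qed
  let ?y1 = "\<mu> * real r / real n1" and ?y2 = "\<mu> * real r / real n2"
  \<comment> \<open>Positivity of \<open>\<mu> * r\<close> comes from incoherence: the squared rows
    of U sum to r, and each is at most \<open>\<mu> * r / n1\<close>.\<close>
  have "real r = (\<Sum>i<n1. \<Sum>s<r. U $$ (i, s) * U $$ (i, s))" using sum_col_squares[OF U UU] by simp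
  also have "\<dots> \<le> (\<Sum>i<n1. ?y1)" by (intro sum_mono row_norm_le(2)[OF U _ inc(1)]) auto
  finally have \<mu>r: "0 < \<mu> * real r" using n12 r by simp
  have L: "0 < ?y1 + ?y2" using \<mu>r n12 by (intro add_pos_pos divide_pos_pos) auto
  have "320 * exp 7 / \<beta> * \<mu> * real r * ln (real n) = (320 * exp 7 / \<beta>) * (\<mu> * real r) * ln (real n)" by simp
  also have "\<dots> > 0"
    by (rule mult_pos_pos[OF mult_pos_pos[OF _ \<mu>r]]) (use \<beta> ln_n in auto)
  finally have "0 < real n * p" using np by linarith
  then have p0: "0 < p" using n0 by (simp add: zero_less_mult_iff)
  then have m0: "0 < m" using p by (intro gr0I) auto
  have "real m \<le> real n1 * real n2" using m by (simp flip: of_nat_mult)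
  then have p1: "p \<le> 1" using p n12 by simp
  obtain j where j: "ln (real n) \<le> 2 ^ j" "2 ^ j \<le> 2 * ln (real n)" using power_of_two_between[OF ln_n] by blast
  have Lle: "?y1 + ?y2 \<le> 2 * (\<mu> * real r) / (\<beta> * real n)"
  proof -
    have "\<beta> * real n \<le> real n1" "\<beta> * real n \<le> real n2" using n by auto
    then have "?y1 \<le> \<mu> * real r / (\<beta> * real n)" "?y2 \<le> \<mu> * real r / (\<beta> * real n)"
      using \<mu>r \<beta> n0 n12 by (auto intro!: divide_left_mono)
    then show ?thesis by simp
  qed
  \<comment> \<open>Origin of the sampling constant: 320 = 80 * 2 * 2, with 80 from the deviation
    bound, one 2 from 2^j <= 2 ln n and one from the two sides of the matrix. The factor exp 7 then
    yields q <= exp (-7).\<close>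
  define q where "q = 80 * real (2 ^ j) * (?y1 + ?y2) / p"
  have q0: "0 \<le> q" using L p0 by (simp add: q_def)
  have q7: "q \<le> exp (-7)"
  proof -
    have "80 * real (2 ^ j) * (?y1 + ?y2) \<le> 80 * (2 * ln (real n)) * (2 * (\<mu> * real r) / (\<beta> * real n))"
      using j L Lle ln_n by (intro mult_mono) auto
    also have "\<dots> = exp (-7) * ((320 * exp 7 / \<beta> * \<mu> * real r * ln (real n)) / real n)"
      by (simp add: exp_minus field_simps)
    also have "\<dots> \<le> exp (-7) * (real n * p / real n)"
      by (intro mult_left_mono divide_right_mono np) auto
    also have "\<dots> = exp (-7) * p" using n0 by simp
    finally show ?thesis using p0 by (simp add: q_def divide_le_eq)
  qed
  have "q \<le> 1" using q7 by (rule order_trans) simp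
  then have "80 * (real (2 ^ j) * (?y1 + ?y2)) \<le> p" using p0 by (simp add: q_def divide_le_eq mult.assoc)
  then have KL: "real (2 ^ j) * (?y1 + ?y2) \<le> p" using L by (smt (verit) mult_nonneg_nonneg of_nat_0_le_iff)
  have N: "1 \<le> n1 * n2" "n1 * n2 \<le> n * n" using n12 n by (auto intro!: mult_le_mono)
  have fail: "real (n1 * n2 + 1) * real (n1 * n2) * q ^ (2 ^ j) \<le> 3 / real n ^ 3"
    by (rule failure_probability_le[OF n(3) N _ q0 q7]) (use j in simp)
  let ?rip = "{\<Omega>. \<Omega> \<subseteq> {..<n1} \<times> {..<n2} \<and> card \<Omega> = m \<and>
        (\<forall>A\<in>carrier_mat r n2. \<forall>B\<in>carrier_mat n1 r.
          \<bar>(frob_on \<Omega> (U * A + B * transpose_mat V))\<^sup>2 - p * (frob (U * A + B * transpose_mat V))\<^sup>2\<bar>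
            \<le> p / 4 * (frob (U * A + B * transpose_mat V))\<^sup>2)}"
  have prob: "1 - 3 / real n ^ 3 \<le> measure_pmf.prob (uniform_sample n1 n2 m) ?rip"
    using tangent_rip[OF U UU V VV inc m0 m p L KL] fail unfolding q_def by linarith
  have s1r: "sing_val Xs r \<le> sing_val Xs 1"
    unfolding s1 using mult_right_mono[OF \<kappa>, of "sing_val Xs r"] sr by simp
  have "?rip \<subseteq> ?goal"
  proof
    fix \<Omega> assume \<Omega>: "\<Omega> \<in> ?rip"
    interpret st: sampled_target n1 n2 r U S V Xs "sing_val Xs 1" "sing_val Xs r" \<Omega> p
      using U S V UU VV XX sr s1r p0 p1 \<Omega> diagonal_op_bounds[OF S dg sv _ s1r]
      by unfold_locales auto
    have rate: "sampling_rate Xs \<Omega> = p" using \<Omega> by (simp add: sampling_rate_def p)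
    have "1 / sqrt \<kappa> \<le> 1 / 1" using \<kappa> by (intro divide_left_mono) auto
    then show "\<Omega> \<in> ?goal"
      using st.gnmr_run_converges[OF s1 n12 refl refl rate inc] by (auto simp: \<gamma>)
  qed
  then have "measure_pmf.prob (uniform_sample n1 n2 m) ?rip \<le> measure_pmf.prob (uniform_sample n1 n2 m) ?goal"
    by (intro measure_pmf.finite_measure_mono) auto
  with prob show ?thesis by linarith
qed

theorem theorem3p7:
  fixes \<beta> :: real
  assumes "0 < \<beta>" and "\<beta> \<le> 1"
  shows "\<exists>C c\<^sub>e c\<^sub>l :: real. C > 0 \<and> c\<^sub>e > 0 \<and> c\<^sub>l > 0 \<and>
    (\<forall>(n1::nat) (n2::nat) (r::nat) (m::nat) (\<mu>::real) (\<kappa>::real) (Xs::real mat) (n::nat) (p::real) (\<gamma>::real).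
       n = max n1 n2 \<longrightarrow> real (min n1 n2) \<ge> \<beta> * real n \<longrightarrow>
       1 \<le> r \<longrightarrow> Xs \<in> incoherent_mats n1 n2 r \<mu> \<kappa> \<longrightarrow>
       m \<le> n1 * n2 \<longrightarrow> p = real m / (real n1 * real n2) \<longrightarrow>
       real n * p \<ge> C * \<mu> * real r * ln (real n) \<longrightarrow>
       \<gamma> = c\<^sub>e / (2 * sing_val Xs r * sqrt p) \<longrightarrow>
       measure_pmf.prob (uniform_sample n1 n2 m)
         {\<Omega>. \<forall>Z. Z 0 \<in> B_err r Xs (sqrt p / (c\<^sub>e * sqrt \<kappa>)) \<inter> B_bln r Xs (1 / c\<^sub>l) \<inter> B_mu r Xs \<mu> \<longrightarrow>
              gnmr_run r Xs \<mu> \<Omega> Z \<longrightarrow>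
              (\<forall>t. frob (estimate (Z (Suc t)) - Xs) \<le> \<gamma> * (frob (estimate (Z t) - Xs))\<^sup>2 \<and>
                   \<gamma> * frob (estimate (Z t) - Xs) \<le> 1 / (2 * sqrt \<kappa>) \<and>
                   1 / (2 * sqrt \<kappa>) \<le> 1 / 2)}
         \<ge> 1 - 3 / real n ^ 3)"
proof (rule exI[of _ "320 * exp 7 / \<beta>"], rule exI[of _ 1000], rule exI[of _ 20],
    intro conjI allI impI)
  fix n1 n2 r m :: nat and \<mu> \<kappa> :: real and Xs :: "real mat" and n :: nat and p \<gamma> :: real
  let ?prob = "measure_pmf.prob (uniform_sample n1 n2 m)
         {\<Omega>. \<forall>Z. Z 0 \<in> B_err r Xs (sqrt p / (1000 * sqrt \<kappa>)) \<inter> B_bln r Xs (1 / 20) \<inter> B_mu r Xs \<mu> \<longrightarrow>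
              gnmr_run r Xs \<mu> \<Omega> Z \<longrightarrow>
              (\<forall>t. frob (estimate (Z (Suc t)) - Xs) \<le> \<gamma> * (frob (estimate (Z t) - Xs))\<^sup>2 \<and>
                   \<gamma> * frob (estimate (Z t) - Xs) \<le> 1 / (2 * sqrt \<kappa>) \<and>
                   1 / (2 * sqrt \<kappa>) \<le> 1 / 2)}"
  assume n: "n = max n1 n2" "\<beta> * real n \<le> real (min n1 n2)" and r: "1 \<le> r"
    and X: "Xs \<in> incoherent_mats n1 n2 r \<mu> \<kappa>" and m: "m \<le> n1 * n2"
    and p: "p = real m / (real n1 * real n2)"
    and np: "320 * exp 7 / \<beta> * \<mu> * real r * ln (real n) \<le> real n * p"
    and \<gamma>: "\<gamma> = 1000 / (2 * sing_val Xs r * sqrt p)"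
  \<comment> \<open>Division by zero yields 0, so for n = 0 the claimed probability would be 1. The
    case is void because r >= 1 orthonormal columns need at least one row.\<close>
  have "n \<noteq> 0"
  proof
    assume "n = 0"
    then have "n1 = 0" using n by simp
    have Xc: "Xs \<in> carrier_mat n1 n2" and "incoherent r \<mu> Xs" using X by (simp_all add: incoherent_mats_def)
    then obtain U S V where "is_compact_svd r Xs U S V" unfolding incoherent_def by blast
    then have U: "U \<in> carrier_mat n1 r" "transpose_mat U * U = 1\<^sub>m r"
      using Xc unfolding is_compact_svd_def by (metis carrier_matD(1))+
    show False using sum_col_squares[OF U] \<open>n1 = 0\<close> r by simp
  qed
  then consider "n = 1" | "2 \<le> n" by linarith
  then show "1 - 3 / real n ^ 3 \<le> ?prob"
  proof cases
    case 1
    \<comment> \<open>Here ln n = 0 and the sampling condition carries no information, but the bound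
      to be shown is negative.\<close>
    then have "1 - 3 / real n ^ 3 \<le> 0" by simp
    also have "0 \<le> ?prob" by simp
    finally show ?thesis .
  next
    case 2
    show ?thesis by (rule gnmr_success_probability[OF assms(1) n 2 r X m p np \<gamma>])
  qed
qed (use assms in auto)

end
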